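(* Let $N\ge 1$, $0<p<1$, $R>0$, $\mu<\tfrac14$, $\mu\neq 0$, and let $\Omega=B_R=\{x\in\mathbb{R}^N:|x|<R\}$, $\delta(x)=R-|x|$. Consider nonnegative solutions of $$\Delta u+\frac{\mu}{\delta(x)^2}u=u^p\quad\text{in } B_R. \qquad (\ast)$$ (i) For any given value $u(0)>0$, problem $(\ast)$ possesses a unique positive radial solution in the ball with this value at the origin. At the boundary it behaves like $c\,\delta^{\beta_-}$ for some $c>0$. These solutions are monotone increasing with respect to $u(0)$. (ii) For any $0<R_0<R$ there exists a nonnegative radial solution of $(\ast)$ in the ball with a dead core in $B_{R_0}$. At the boundary it behaves like $c\,\delta^{\beta_-}$ for some $c>0$. (iii) There exists a radial solution of $(\ast)$ of the form $u(r)=r^{\frac{2}{1-p}}(c''+w(r))$, $r=|x|$, with $c''=\Big(\mu^*+\frac{2(N-1)}{1-p}\Big)^{\frac{1}{p-1}}$ and $w(0)=0$ ($w$ continuous). At the boundary it behaves like $c\,\delta^{\beta_-}$ for some $c>0$.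
   Context: $\beta_-=\frac12-\sqrt{\frac14-\mu}$ and $\mu^*=\frac{2(p+1)}{(1-p)^2}$. "At the boundary $u$ behaves like $c\,\delta^{\beta_-}$" means $u/\delta^{\beta_-}\to c$ as $\delta\to0$. "$u$ has a dead core in $B_{R_0}$" means that $u$ vanishes identically in $B_{R_0}$ and is positive at points with $|x|$ slightly larger than $R_0$. *)

theory Defs
  imports "HOL-Analysis.Analysis"
begin

definition partial_deriv :: "'a::euclidean_space \<Rightarrow> ('a \<Rightarrow> real) \<Rightarrow> 'a \<Rightarrow> real" where
  "partial_deriv b f x = deriv (\<lambda>t. f (x + t *\<^sub>R b)) 0"

definition laplacian :: "('a::euclidean_space \<Rightarrow> real) \<Rightarrow> 'a \<Rightarrow> real" where
  "laplacian f x = (\<Sum>b\<in>Basis. partial_deriv b (partial_deriv b f) x)"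

(* The two following notions are meant for open sets S; there they only depend on f restricted to S. *)
definition C1_on :: "'a::euclidean_space set \<Rightarrow> ('a \<Rightarrow> real) \<Rightarrow> bool" where
  "C1_on S f \<longleftrightarrow>
     (\<forall>x\<in>S. f differentiable (at x)) \<and> (\<forall>b\<in>Basis. continuous_on S (partial_deriv b f))"

definition C2_on :: "'a::euclidean_space set \<Rightarrow> ('a \<Rightarrow> real) \<Rightarrow> bool" where
  "C2_on S f \<longleftrightarrow> C1_on S f \<and> (\<forall>b\<in>Basis. C1_on S (partial_deriv b f))"

(* Nonnegative classical solutions. Since u is nonnegative and 0 powr p = 0,
   u x powr p is the usual power also where u vanishes. *)
definition hardy_solution ::
    "real \<Rightarrow> real \<Rightarrow> real \<Rightarrow> ('a::euclidean_space \<Rightarrow> real) \<Rightarrow> bool" where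
  "hardy_solution \<mu> p R u \<longleftrightarrow>
     C2_on (ball 0 R) u \<and>
     (\<forall>x\<in>ball 0 R. 0 \<le> u x \<and>
        laplacian u x + \<mu> / (R - norm x)\<^sup>2 * u x = u x powr p)"

definition radial_on :: "'a::real_normed_vector set \<Rightarrow> ('a \<Rightarrow> real) \<Rightarrow> bool" where
  "radial_on S u \<longleftrightarrow> (\<forall>x\<in>S. \<forall>y\<in>S. norm x = norm y \<longrightarrow> u x = u y)"

definition radial_solution ::
    "real \<Rightarrow> real \<Rightarrow> real \<Rightarrow> ('a::euclidean_space \<Rightarrow> real) \<Rightarrow> bool" where
  "radial_solution \<mu> p R u \<longleftrightarrow> hardy_solution \<mu> p R u \<and> radial_on (ball 0 R) u"

definition positive_radial_solution ::
    "real \<Rightarrow> real \<Rightarrow> real \<Rightarrow> ('a::euclidean_space \<Rightarrow> real) \<Rightarrow> bool" where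
  "positive_radial_solution \<mu> p R u \<longleftrightarrow>
     radial_solution \<mu> p R u \<and> (\<forall>x\<in>ball 0 R. 0 < u x)"

definition beta_minus :: "real \<Rightarrow> real" where
  "beta_minus \<mu> = 1/2 - sqrt (1/4 - \<mu>)"

definition mu_star :: "real \<Rightarrow> real" where
  "mu_star p = 2 * (p + 1) / (1 - p)\<^sup>2"

(* u / delta^beta tends to c as delta(x) = R - |x| tends to 0 from above, i.e. from within
   the ball and uniformly in the direction of x. *)
definition boundary_behaviour ::
    "real \<Rightarrow> real \<Rightarrow> real \<Rightarrow> ('a::real_normed_vector \<Rightarrow> real) \<Rightarrow> bool" where
  "boundary_behaviour R \<beta> c u \<longleftrightarrow>
     ((\<lambda>x. u x / (R - norm x) powr \<beta>) \<longlongrightarrow> c) (filtercomap (\<lambda>x. R - norm x) (at_right 0))"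

definition dead_core :: "real \<Rightarrow> ('a::real_normed_vector \<Rightarrow> real) \<Rightarrow> bool" where
  "dead_core R0 u \<longleftrightarrow>
     (\<forall>x\<in>ball 0 R0. u x = 0) \<and>
     (\<exists>\<epsilon>>0. \<forall>x. R0 < norm x \<and> norm x < R0 + \<epsilon> \<longrightarrow> 0 < u x)"

end

theory Submission
  imports Defs
begin

text \<open>
  Write \<open>n = N - 1\<close>, \<open>\<beta> = \<beta>\<^sub>-\<close> and let \<open>L\<close> be the linear operator \<open>L u = u'' + n u'/r + \<mu> u/\<delta>\<^sup>2\<close>.
  The idea is to divide by an explicit positive function \<open>\<phi>\<close> that is of class \<open>C\<^sup>2\<close> with \<open>\<phi>'(0) = 0\<close>,
  satisfies \<open>L \<phi> = - P \<phi>\<close> with \<open>P \<ge> 0\<close>, and behaves like \<open>\<delta>\<^sup>\<beta>\<close> at the boundary. Then \<open>u = \<phi> v\<close>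
  is a radial solution iff \<open>(W v')' = W (\<phi> powr (p - 1) v powr p + P v)\<close> with \<open>W = r ^ n \<phi>\<^sup>2\<close>, i.e. iff
  \<open>v\<close> is a fixed point of a monotone Volterra operator \<open>T\<close>, whatever the sign of \<open>\<mu>\<close>.

  Fixed points arise by monotone iteration from a subsolution: \<open>0\<close> if \<open>v(0) > 0\<close>, and a small multiple of
  \<open>(r - R0) powr (2 / (1 - p))\<close>, cut off at \<open>R0\<close>, if \<open>v(0) = 0\<close>. They are nondecreasing, and bounded because \<open>P\<close>
  is only of order \<open>1/\<delta>\<close> and \<open>\<beta> < 1/2\<close>; so \<open>v\<close> has a positive limit at the boundary. Since \<open>T\<close> is concave,
  comparing two fixed points through the minimum of their quotient gives uniqueness and monotonicity,
  and inserting the best constants in \<open>m r powr k \<le> v \<le> M r powr k\<close> into \<open>v = T v\<close> shows that both tend to \<open>c''\<close> at the origin.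
\<close>

section \<open>Integrals and powers\<close>

text \<open>Dividing by \<phi> is forced by the term \<mu> u / \<delta>^2. Moved to the right-hand
  side it destroys monotonicity in u when \<mu> > 0, and for either sign it has a double pole at the
  boundary. The indicial equation b (1 - b) = \<mu> of the powers \<delta>^b cancels that pole, and
  the remaining P has at most a simple one. The weight W is of order \<delta>^(2 b) at the boundary,
  so b < 1/2 is exactly the integrability of 1 / W there.

  The second obstacle is that x powr p is not Lipschitz at 0. For v(0) = 0 the zero function is a
  fixed point and iteration from it never leaves it, which is why a nontrivial subsolution is
  needed; the same failure of uniqueness is what permits dead cores. The exponent k = 2 / (1 - p)
  solves k - 2 = k p. One construction, with R0 > 0 and with R0 = 0, gives (ii) and (iii), and c''
  is the positive solution of C = D C powr p with D = 1 / (k (k + N - 2)).\<close>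

lemma cont_Icc: "continuous_on {0..<R} h \<Longrightarrow> t < R \<Longrightarrow> continuous_on {0..t} h"
  for R :: real
  by (erule continuous_on_subset) auto

lemma integral_real_deriv:
  fixes k :: "real \<Rightarrow> real"
  assumes "continuous_on {0..<R} k" "0 < t" "t < R"
  shows "((\<lambda>r. integral {0..r} k) has_real_derivative k t) (at t)"
proof -
  define r1 where "r1 = (t + R) / 2"
  have r1: "t < r1" "r1 < R" using assms by (auto simp: r1_def)
  have "((\<lambda>r. integral {0..r} k) has_real_derivative k t) (at t within {0..r1})"
    using r1 assms by (intro integral_has_real_derivative cont_Icc[OF assms(1)]) auto
  then show ?thesis
    using r1 assms at_within_Icc_at[of 0 t r1] by simp
qed

text \<open>Integrability is the right hypothesis because this result is applied to the flux of the
  limit of the iteration, whose continuity is not known at that stage.\<close>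

lemma integral_cont:
  fixes k :: "real \<Rightarrow> real"
  assumes "\<And>t. 0 \<le> t \<Longrightarrow> t < R \<Longrightarrow> k integrable_on {0..t}"
  shows "continuous_on {0..<R} (\<lambda>r. integral {0..r} k)"
proof -
  have "continuous (at t within {0..<R}) (\<lambda>r. integral {0..r} k)" if t: "0 \<le> t" "t < R" for t
  proof -
    define r1 where "r1 = (t + R) / 2"
    have r1: "t < r1" "r1 < R" using t by (auto simp: r1_def)
    have "continuous (at t within {0..r1}) (\<lambda>r. integral {0..r} k)"
      using indefinite_integral_continuous_1[OF assms[of r1]] r1 t
      by (auto simp: continuous_on_eq_continuous_within)
    moreover have "at t within {0..<R} = at t within {0..r1}"
      by (rule at_within_nhd[of _ "{..<r1}"]) (use r1 in auto)
    ultimately show ?thesis by simp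
  qed
  then show ?thesis by (auto simp: continuous_on_eq_continuous_within)
qed

lemma powr_has_integral:
  fixes a t \<alpha> :: real
  assumes "0 < \<alpha>" "a \<le> t"
  shows "((\<lambda>s. (s - a) powr \<alpha>) has_integral (t - a) powr (\<alpha> + 1) / (\<alpha> + 1)) {a..t}"
proof -
  have "((\<lambda>s. (s - a) powr \<alpha>) has_integral
      (t - a) powr (\<alpha> + 1) / (\<alpha> + 1) - (a - a) powr (\<alpha> + 1) / (\<alpha> + 1)) {a..t}"
  proof (rule fundamental_theorem_of_calculus_interior)
    show "continuous_on {a..t} (\<lambda>s. (s - a) powr (\<alpha> + 1) / (\<alpha> + 1))"
      using assms by (intro continuous_on_divide continuous_on_powr' continuous_on_diff
        continuous_on_id continuous_on_const) auto
    fix x assume x: "x \<in> {a<..<t}"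
    show "((\<lambda>s. (s - a) powr (\<alpha> + 1) / (\<alpha> + 1)) has_vector_derivative (x - a) powr \<alpha>) (at x)"
      unfolding has_real_derivative_iff_has_vector_derivative[symmetric]
      by (rule derivative_eq_intros refl | use x assms in force)+
  qed (use assms in auto)
  then show ?thesis by simp
qed

text \<open>For p < 1 a best constant that is compared with a multiple of its own p-th power can be
  isolated. This version yields lower bounds, \<open>le_powr_mult_self\<close> upper bounds.\<close>

lemma powr_mult_self_le:
  fixes x y p :: real
  assumes "0 < x" "p < 1" "0 \<le> y" "y * x powr p \<le> x"
  shows "y powr (1 / (1 - p)) \<le> x"
proof -
  have "x powr (1 - p) = x / x powr p" using assms(1) by (simp add: powr_diff)
  then have "y \<le> x powr (1 - p)" using assms by (simp add: pos_le_divide_eq)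
  then have "y powr (1 / (1 - p)) \<le> (x powr (1 - p)) powr (1 / (1 - p))"
    using assms by (intro powr_mono2) auto
  then show ?thesis using assms by (simp add: powr_powr)
qed

lemma le_powr_mult_self:
  fixes x y p :: real
  assumes "0 < x" "p < 1" "x \<le> y * x powr p"
  shows "x \<le> y powr (1 / (1 - p))"
proof -
  have "x powr (1 - p) = x / x powr p" using assms(1) by (simp add: powr_diff)
  then have "x powr (1 - p) \<le> y" using assms by (simp add: pos_divide_le_eq)
  then have "(x powr (1 - p)) powr (1 / (1 - p)) \<le> y powr (1 / (1 - p))"
    using assms by (intro powr_mono2) auto
  then show ?thesis using assms by (simp add: powr_powr)
qed

section \<open>A monotone Volterra equation\<close>

locale radial_volterra =
  fixes R p :: real and n :: nat and \<phi> A P :: "real \<Rightarrow> real"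
  assumes R_pos: "0 < R" and p_pos: "0 < p" and p_less: "p < 1"
    and cont_phi: "continuous_on {0..<R} \<phi>" and phi_pos: "\<And>r. 0 \<le> r \<Longrightarrow> r < R \<Longrightarrow> 0 < \<phi> r"
    and cont_A: "continuous_on {0..<R} A" and A_pos: "\<And>r. 0 \<le> r \<Longrightarrow> r < R \<Longrightarrow> 0 < A r"
    and cont_P: "continuous_on {0..<R} P" and P_nonneg: "\<And>r. 0 \<le> r \<Longrightarrow> r < R \<Longrightarrow> 0 \<le> P r"
begin

text \<open>For \<open>n > 0\<close> we have \<open>W 0 = 0\<close>, so \<open>flux h 0 = 0\<close> by the convention \<open>x / 0 = 0\<close>; this is also its limit at \<open>0\<close>.\<close>

definition W :: "real \<Rightarrow> real" where "W t = t ^ n * (\<phi> t)\<^sup>2"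

definition src :: "(real \<Rightarrow> real) \<Rightarrow> real \<Rightarrow> real" where
  "src v s = A s * v s powr p + P s * v s"

definition flux :: "(real \<Rightarrow> real) \<Rightarrow> real \<Rightarrow> real" where
  "flux h t = integral {0..t} (\<lambda>s. W s * h s) / W t"

definition T :: "real \<Rightarrow> (real \<Rightarrow> real) \<Rightarrow> real \<Rightarrow> real" where
  "T a v r = a + integral {0..r} (flux (src v))"

definition solves :: "real \<Rightarrow> (real \<Rightarrow> real) \<Rightarrow> bool" where
  "solves a v \<longleftrightarrow> continuous_on {0..<R} v \<and> (\<forall>r\<in>{0..<R}. 0 \<le> v r \<and> v r = T a v r)"

lemma solves_cont: "solves a v \<Longrightarrow> continuous_on {0..<R} v"
  by (simp add: solves_def)

lemma solves_nonneg: "solves a v \<Longrightarrow> 0 \<le> r \<Longrightarrow> r < R \<Longrightarrow> 0 \<le> v r"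
  by (meson atLeastLessThan_iff solves_def)

lemma solves_eq: "solves a v \<Longrightarrow> 0 \<le> r \<Longrightarrow> r < R \<Longrightarrow> v r = T a v r"
  by (meson atLeastLessThan_iff solves_def)

lemma cont_W: "continuous_on {0..<R} W"
  unfolding W_def by (intro continuous_intros cont_phi)

lemma W_nonneg: "0 \<le> t \<Longrightarrow> 0 \<le> W t"
  by (simp add: W_def)

lemma W_pos: "0 < t \<Longrightarrow> t < R \<Longrightarrow> 0 < W t"
  using phi_pos[of t] by (simp add: W_def)

lemma cont_src:
  assumes "continuous_on {0..<R} v" "\<And>r. 0 \<le> r \<Longrightarrow> r < R \<Longrightarrow> 0 \<le> v r"
  shows "continuous_on {0..<R} (src v)"
  unfolding src_def
  by (intro continuous_on_add continuous_on_mult cont_A cont_P assms(1) continuous_on_powr' continuous_on_const)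
     (use assms p_pos in auto)

lemma src_nonneg: "0 \<le> r \<Longrightarrow> r < R \<Longrightarrow> 0 \<le> v r \<Longrightarrow> 0 \<le> src v r"
  using A_pos[of r] P_nonneg[of r] by (simp add: src_def less_imp_le)

lemma src_mono:
  "0 \<le> r \<Longrightarrow> r < R \<Longrightarrow> 0 \<le> u r \<Longrightarrow> u r \<le> v r \<Longrightarrow> src u r \<le> src v r"
  unfolding src_def using A_pos[of r] P_nonneg[of r] p_pos
  by (intro add_mono mult_left_mono powr_mono2) auto

lemma integrable_W:
  assumes "continuous_on {0..<R} h" "t < R"
  shows "(\<lambda>s. W s * h s) integrable_on {0..t}"
  by (rule integrable_continuous_interval, rule continuous_on_subset[of "{0..<R}"])
     (use assms in \<open>auto intro!: continuous_intros cont_W\<close>)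

section \<open>Regularity and monotonicity of the flux\<close>

lemma flux_0 [simp]: "flux h 0 = 0"
  by (simp add: flux_def)

lemma flux_mono_gen:
  assumes "(\<lambda>s. W s * h s) integrable_on {0..t}" "(\<lambda>s. W s * k s) integrable_on {0..t}"
    "0 \<le> t" "t < R" "\<And>s. 0 \<le> s \<Longrightarrow> s \<le> t \<Longrightarrow> h s \<le> k s"
  shows "flux h t \<le> flux k t"
  unfolding flux_def using assms
  by (intro divide_right_mono integral_le mult_left_mono) (auto intro: W_nonneg)

lemma flux_mono:
  assumes "continuous_on {0..<R} h" "continuous_on {0..<R} k"
    "0 \<le> t" "t < R" "\<And>s. 0 \<le> s \<Longrightarrow> s \<le> t \<Longrightarrow> h s \<le> k s"
  shows "flux h t \<le> flux k t"
  using assms by (intro flux_mono_gen integrable_W) auto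

lemma flux_cmult: "flux (\<lambda>s. c * h s) t = c * flux h t"
  by (simp add: flux_def mult.left_commute)

lemma flux_nonneg:
  assumes "continuous_on {0..<R} h" "0 \<le> t" "t < R" "\<And>s. 0 \<le> s \<Longrightarrow> s \<le> t \<Longrightarrow> 0 \<le> h s"
  shows "0 \<le> flux h t"
  unfolding flux_def using assms
  by (intro divide_nonneg_nonneg integral_nonneg integrable_W mult_nonneg_nonneg) (auto intro: W_nonneg)

lemma integrable_cont: "continuous_on {0..<R} h \<Longrightarrow> t < R \<Longrightarrow> h integrable_on {0..t}"
  for h :: "real \<Rightarrow> real"
  by (intro integrable_continuous_interval cont_Icc)

lemma phi_bounds:
  assumes "r < R"
  obtains a b where "0 < a" "\<And>s. 0 \<le> s \<Longrightarrow> s \<le> r \<Longrightarrow> a \<le> \<phi> s \<and> \<phi> s \<le> b"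
proof (cases "0 \<le> r")
  case True
  have c: "continuous_on {0..r} \<phi>" by (rule cont_Icc[OF cont_phi assms])
  obtain x where x: "x \<in> {0..r}" "\<And>y. y \<in> {0..r} \<Longrightarrow> \<phi> x \<le> \<phi> y"
    using continuous_attains_inf[OF compact_Icc _ c] True by fastforce
  obtain z where z: "z \<in> {0..r}" "\<And>y. y \<in> {0..r} \<Longrightarrow> \<phi> y \<le> \<phi> z"
    using continuous_attains_sup[OF compact_Icc _ c] True by fastforce
  show thesis
    by (rule that[of "\<phi> x" "\<phi> z"]) (use x z assms phi_pos[of x] in auto)
qed (rule that[of 1 1], auto)

text \<open>For s <= t the factor (s / t)^n is at most 1, so only the bounds of
  \<open>\<phi>\<close> on a compact interval matter and the singularity of 1 / W at the origin does
  not enter.\<close>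

lemma W_ratio:
  assumes "r < R"
  obtains C where "0 < C" "\<And>s t. 0 \<le> s \<Longrightarrow> s \<le> t \<Longrightarrow> t \<le> r \<Longrightarrow> W s \<le> C * W t"
proof -
  obtain a b where ab: "0 < a" "\<And>s. 0 \<le> s \<Longrightarrow> s \<le> r \<Longrightarrow> a \<le> \<phi> s \<and> \<phi> s \<le> b"
    using phi_bounds[OF assms] by blast
  show thesis
  proof (rule that[of "(b\<^sup>2 + 1) / a\<^sup>2"])
    show "0 < (b\<^sup>2 + 1) / a\<^sup>2" using ab(1) by (intro divide_pos_pos add_nonneg_pos) auto
    fix s t assume st: "0 \<le> s" "s \<le> t" "t \<le> r"
    have "(\<phi> s)\<^sup>2 \<le> b\<^sup>2" using ab(2)[of s] st ab(1) by (intro power_mono) auto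
    also have "\<dots> \<le> (b\<^sup>2 + 1) / a\<^sup>2 * a\<^sup>2" using ab(1) by simp
    also have "\<dots> \<le> (b\<^sup>2 + 1) / a\<^sup>2 * (\<phi> t)\<^sup>2"
      using ab(2)[of t] st ab(1) by (intro mult_left_mono power_mono) auto
    finally have "s ^ n * (\<phi> s)\<^sup>2 \<le> t ^ n * ((b\<^sup>2 + 1) / a\<^sup>2 * (\<phi> t)\<^sup>2)"
      using st by (intro mult_mono power_mono) auto
    then show "W s \<le> (b\<^sup>2 + 1) / a\<^sup>2 * W t" by (simp add: W_def algebra_simps)
  qed
qed

text \<open>The kernel \<open>W s / W t\<close> is bounded for s <= t and the interval of
  integration has length t. Linear vanishing at 0 gives continuity of the flux there and the
  quadratic bound on \<open>growth\<close>.\<close>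

lemma flux_linear_bound:
  assumes h: "continuous_on {0..<R} h" and "r < R"
  obtains C where "0 \<le> C" "\<And>t. 0 \<le> t \<Longrightarrow> t \<le> r \<Longrightarrow> \<bar>flux h t\<bar> \<le> C * t"
proof -
  obtain C where C: "0 < C" "\<And>s t. 0 \<le> s \<Longrightarrow> s \<le> t \<Longrightarrow> t \<le> r \<Longrightarrow> W s \<le> C * W t"
    using W_ratio[OF assms(2)] by blast
  have "bounded (h ` {0..r})"
    by (intro compact_imp_bounded compact_continuous_image cont_Icc[OF h] assms(2) compact_Icc)
  then obtain M where M: "0 < M" "\<And>s. s \<in> {0..r} \<Longrightarrow> \<bar>h s\<bar> \<le> M"
    by (auto simp: bounded_pos)
  show thesis
  proof (rule that[of "C * M"])
    show "0 \<le> C * M" using C M by simp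
    fix t assume t: "0 \<le> t" "t \<le> r"
    have "norm (integral {0..t} (\<lambda>s. W s * h s)) \<le> C * W t * M * (t - 0)"
    proof (rule integral_bound)
      show "continuous_on {0..t} (\<lambda>s. W s * h s)"
        using t assms by (intro cont_Icc[of R] continuous_intros cont_W) auto
      fix s assume s: "s \<in> {0..t}"
      have "\<bar>W s\<bar> \<le> C * W t" using C(2)[of s t] W_nonneg[of s] s t by auto
      then show "norm (W s * h s) \<le> C * W t * M"
        using M(2)[of s] s t by (auto simp: abs_mult intro!: mult_mono)
    qed (use t in auto)
    then have "\<bar>integral {0..t} (\<lambda>s. W s * h s)\<bar> \<le> C * M * t * W t"
      by (simp add: algebra_simps)
    then show "\<bar>flux h t\<bar> \<le> C * M * t"
      using W_pos[of t] t assms by (cases "t = 0") (auto simp: flux_def field_simps)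
  qed
qed

lemma W_integral_deriv:
  assumes "continuous_on {0..<R} h" "0 < t" "t < R"
  shows "((\<lambda>r. integral {0..r} (\<lambda>s. W s * h s)) has_real_derivative W t * h t) (at t)"
  by (intro integral_real_deriv[of R "\<lambda>s. W s * h s"] continuous_intros cont_W assms)

lemma cont_flux:
  assumes h: "continuous_on {0..<R} h"
  shows "continuous_on {0..<R} (flux h)"
proof -
  have "continuous (at t within {0..<R}) (flux h)" if t: "0 \<le> t" "t < R" for t
  proof (cases "t = 0")
    case False
    have "continuous_on {0<..<R} (\<lambda>r. integral {0..r} (\<lambda>s. W s * h s))"
      using W_integral_deriv[OF h] DERIV_isCont by (fastforce intro!: continuous_at_imp_continuous_on)
    then have "continuous_on {0<..<R} (\<lambda>r. integral {0..r} (\<lambda>s. W s * h s) / W r)"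
      using W_pos by (intro continuous_on_divide continuous_on_subset[OF cont_W]) (auto simp: less_le)
    then have "isCont (\<lambda>r. integral {0..r} (\<lambda>s. W s * h s) / W r) t"
      using t False by (simp add: continuous_on_eq_continuous_at)
    then show ?thesis unfolding flux_def[abs_def] by (rule continuous_at_imp_continuous_at_within)
  next
    case True
    obtain C where C: "\<And>t. 0 \<le> t \<Longrightarrow> t \<le> R/2 \<Longrightarrow> \<bar>flux h t\<bar> \<le> C * t"
      using flux_linear_bound[OF h, of "R/2"] R_pos by auto
    have "(flux h \<longlongrightarrow> 0) (at 0 within {0..<R})"
    proof (rule Lim_null_comparison)
      have "eventually (\<lambda>x. x < R/2) (nhds (0::real))"
        using R_pos eventually_nhds_in_open[of "{..<R/2}" 0] by simp
      then show "eventually (\<lambda>x. norm (flux h x) \<le> C * x) (at 0 within {0..<R})"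
        unfolding eventually_at_filter by eventually_elim (auto intro!: C)
      show "((\<lambda>x. C * x) \<longlongrightarrow> 0) (at 0 within {0..<R})"
        by (intro tendsto_eq_intros) auto
    qed
    then show ?thesis by (simp add: True continuous_within)
  qed
  then show ?thesis by (auto simp: continuous_on_eq_continuous_within)
qed

section \<open>Monotonicity of the Volterra operator\<close>

lemma T_0 [simp]: "T a v 0 = a"
  by (simp add: T_def)

context
  fixes v :: "real \<Rightarrow> real"
  assumes v: "continuous_on {0..<R} v" and v0: "\<And>r. 0 \<le> r \<Longrightarrow> r < R \<Longrightarrow> 0 \<le> v r"
begin

lemma cont_flux_src: "continuous_on {0..<R} (flux (src v))"
  by (intro cont_flux cont_src v v0)

lemma flux_src_nonneg: "0 \<le> t \<Longrightarrow> t < R \<Longrightarrow> 0 \<le> flux (src v) t"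
  by (intro flux_nonneg cont_src src_nonneg v v0) auto

lemma T_deriv: "0 < t \<Longrightarrow> t < R \<Longrightarrow> (T a v has_real_derivative flux (src v) t) (at t)"
  unfolding T_def[abs_def]
  by (rule derivative_eq_intros integral_real_deriv[OF cont_flux_src] refl | simp)+

lemma cont_T: "continuous_on {0..<R} (T a v)"
  unfolding T_def[abs_def]
  by (intro continuous_intros integral_cont integrable_cont cont_flux_src)

lemma T_mono_arg:
  assumes "0 \<le> r" "r \<le> s" "s < R"
  shows "T a v r \<le> T a v s"
  unfolding T_def using assms
  by (intro add_left_mono integral_subset_le integrable_cont cont_flux_src)
     (auto intro!: flux_src_nonneg)

lemma T_ge: "0 \<le> r \<Longrightarrow> r < R \<Longrightarrow> a \<le> T a v r"
  using T_mono_arg[of 0 r a] by simp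

end

text \<open>\<open>T\<close> is causal, so an ordering on [0, r] alone suffices. This locality keeps
  the iterates zero on a dead core and allows fixed points to be compared on compact
  intervals.\<close>

lemma T_mono:
  assumes "continuous_on {0..<R} u" "\<And>r. 0 \<le> r \<Longrightarrow> r < R \<Longrightarrow> 0 \<le> u r"
    "continuous_on {0..<R} v" "\<And>r. 0 \<le> r \<Longrightarrow> r < R \<Longrightarrow> 0 \<le> v r"
    and uv: "\<And>s. 0 \<le> s \<Longrightarrow> s \<le> r \<Longrightarrow> u s \<le> v s" and "0 \<le> r" "r < R"
  shows "T a u r \<le> T a v r"
  unfolding T_def using assms
  by (intro add_left_mono integral_le integrable_cont cont_flux_src flux_mono cont_src src_mono) auto

text \<open>Since \<open>1 powr p = 1\<close>, this is \<open>T 0\<close> of the constant function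
  1. Its boundedness up to R bounds the fixed points below \<open>upper_sol\<close>; its quadratic
  vanishing at 0 gives an a priori bound of order \<open>r powr k\<close>.\<close>

definition growth :: "real \<Rightarrow> real" where
  "growth r = integral {0..r} (flux (\<lambda>s. A s + P s))"

lemma cont_AP: "continuous_on {0..<R} (\<lambda>s. A s + P s)"
  by (intro continuous_intros cont_A cont_P)

lemma growth_deriv: "0 < t \<Longrightarrow> t < R \<Longrightarrow> (growth has_real_derivative flux (\<lambda>s. A s + P s) t) (at t)"
  unfolding growth_def[abs_def] by (rule integral_real_deriv[OF cont_flux[OF cont_AP]])

lemma cont_growth: "continuous_on {0..<R} growth"
  unfolding growth_def[abs_def] by (intro integral_cont integrable_cont cont_flux cont_AP)

lemma flux_AP_nonneg: "0 \<le> t \<Longrightarrow> t < R \<Longrightarrow> 0 \<le> flux (\<lambda>s. A s + P s) t"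
  using A_pos P_nonneg by (intro flux_nonneg cont_AP) (auto intro!: add_nonneg_nonneg intro: less_imp_le)

lemma growth_mono:
  assumes "0 \<le> r" "r \<le> s" "s < R" shows "growth r \<le> growth s"
  unfolding growth_def using assms
  by (intro integral_subset_le integrable_cont cont_flux cont_AP) (auto intro!: flux_AP_nonneg)

lemma growth_0 [simp]: "growth 0 = 0"
  by (simp add: growth_def)

text \<open>
  A supersolution: \<open>S = upper_sol B\<close> solves \<open>S' = growth' (1 + S)\<close>, \<open>S 0 = B\<close>, where the right-hand side
  dominates the flux of \<open>S\<close> because \<open>S\<close> is nondecreasing and \<open>x powr p \<le> 1 + x\<close>.
\<close>

definition upper_sol :: "real \<Rightarrow> real \<Rightarrow> real" where
  "upper_sol B r = (1 + B) * exp (growth r) - 1"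

lemma cont_upper_sol: "continuous_on {0..<R} (upper_sol B)"
  unfolding upper_sol_def[abs_def] by (intro continuous_intros cont_growth)

lemma upper_sol_ge:
  assumes "0 \<le> B" "0 \<le> r" "r < R" shows "B \<le> upper_sol B r"
proof -
  have "1 \<le> exp (growth r)" using growth_mono[of 0 r] assms by simp
  then have "(1 + B) * 1 \<le> (1 + B) * exp (growth r)" using assms by (intro mult_left_mono) auto
  then show ?thesis by (simp add: upper_sol_def)
qed

lemma upper_sol_mono:
  assumes "0 \<le> B" "0 \<le> r" "r \<le> s" "s < R" shows "upper_sol B r \<le> upper_sol B s"
  unfolding upper_sol_def using growth_mono[of r s] assms by (auto intro!: mult_left_mono)

lemma upper_sol_supersolution:
  assumes "0 \<le> a" "a \<le> B" "0 \<le> r" "r < R"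
  shows "T a (upper_sol B) r \<le> upper_sol B r"
proof -
  have S0: "0 \<le> upper_sol B s" if "0 \<le> s" "s < R" for s
    using upper_sol_ge[of B s] assms that by simp
  have "((\<lambda>t. (1 + B) * (exp (growth t) * flux (\<lambda>s. A s + P s) t)) has_integral
      upper_sol B r - upper_sol B 0) {0..r}"
  proof (rule fundamental_theorem_of_calculus_interior)
    show "continuous_on {0..r} (upper_sol B)" by (rule cont_Icc[OF cont_upper_sol assms(4)])
    fix x assume "x \<in> {0<..<r}"
    then show "(upper_sol B has_vector_derivative (1 + B) * (exp (growth x) * flux (\<lambda>s. A s + P s) x)) (at x)"
      unfolding has_real_derivative_iff_has_vector_derivative[symmetric] upper_sol_def[abs_def]
      using assms(4) by (auto intro!: derivative_eq_intros growth_deriv)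
  qed (use assms in auto)
  from integral_unique[OF this]
  have *: "integral {0..r} (\<lambda>t. (1 + B) * (exp (growth t) * flux (\<lambda>s. A s + P s) t)) = upper_sol B r - B"
    by (simp only: upper_sol_def growth_0) simp
  have "flux (src (upper_sol B)) t \<le> (1 + B) * (exp (growth t) * flux (\<lambda>s. A s + P s) t)"
    if t: "0 \<le> t" "t \<le> r" for t
  proof -
    have "src (upper_sol B) s \<le> (1 + B) * exp (growth t) * (A s + P s)" if s: "0 \<le> s" "s \<le> t" for s
    proof -
      let ?x = "upper_sol B s"
      have x: "0 \<le> ?x" "1 + ?x \<le> (1 + B) * exp (growth t)"
        using S0[of s] upper_sol_mono[of B s t] s t assms by (auto simp: upper_sol_def)
      have "?x powr p \<le> (1 + ?x) powr p" using x p_pos by (intro powr_mono2) auto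
      also have "\<dots> \<le> (1 + ?x) powr 1" using x p_less by (intro powr_mono) auto
      finally have "?x powr p \<le> (1 + B) * exp (growth t)" using x by simp
      then have "A s * ?x powr p + P s * ?x \<le> A s * ((1 + B) * exp (growth t)) + P s * ((1 + B) * exp (growth t))"
        using A_pos[of s] P_nonneg[of s] x s t assms by (intro add_mono mult_left_mono) auto
      then show ?thesis by (simp add: src_def algebra_simps)
    qed
    then have "flux (src (upper_sol B)) t \<le> flux (\<lambda>s. (1 + B) * exp (growth t) * (A s + P s)) t"
      using t assms by (intro flux_mono continuous_intros cont_src cont_upper_sol cont_A cont_P S0) auto
    then show ?thesis by (simp add: flux_cmult mult.assoc)
  qed
  then have "integral {0..r} (flux (src (upper_sol B))) \<le> upper_sol B r - B"
    unfolding *[symmetric] using assms S0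
    by (intro integral_le integrable_cont cont_flux cont_src cont_upper_sol
        continuous_on_mult continuous_on_exp cont_growth cont_AP continuous_on_const) auto
  then show ?thesis using assms by (simp add: T_def)
qed

text \<open>The iterates increase from \<open>v0\<close> and stay below \<open>upper_sol B\<close>,
  which also supplies the majorants for both limits under the integral. The last conclusion is the
  source of dead cores: zeros of \<open>v0\<close> on an initial interval survive the limit.\<close>

lemma solution_exists:
  assumes v0: "continuous_on {0..<R} v0" "\<And>r. 0 \<le> r \<Longrightarrow> r < R \<Longrightarrow> 0 \<le> v0 r"
    "\<And>r. 0 \<le> r \<Longrightarrow> r < R \<Longrightarrow> v0 r \<le> T a v0 r" "\<And>r. 0 \<le> r \<Longrightarrow> r < R \<Longrightarrow> v0 r \<le> B"
    and "0 \<le> a" "a \<le> B"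
  obtains v where "solves a v" "\<And>r. 0 \<le> r \<Longrightarrow> r < R \<Longrightarrow> v0 r \<le> v r"
    "\<And>r. 0 \<le> r \<Longrightarrow> r < R \<Longrightarrow> v r \<le> upper_sol B r"
    "\<And>r0 r. a = 0 \<Longrightarrow> (\<And>s. 0 \<le> s \<Longrightarrow> s \<le> r0 \<Longrightarrow> v0 s = 0) \<Longrightarrow> 0 \<le> r \<Longrightarrow> r \<le> r0 \<Longrightarrow> r < R \<Longrightarrow> v r = 0"
proof -
  define vs where "vs k = (T a ^^ k) v0" for k
  have vs_Suc: "vs (Suc k) = T a (vs k)" and vs_0: "vs 0 = v0" for k by (simp_all add: vs_def)
  have S0: "0 \<le> upper_sol B s" if "0 \<le> s" "s < R" for s
    using upper_sol_ge[of B s] assms that by simp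
  \<comment> \<open>The bounds are carried through the induction together: continuity and
    nonnegativity make \<open>T_mono\<close> applicable, the comparison with
    \<open>T a (vs k)\<close> makes the sequence increase, and the upper bound makes it
    converge.\<close>
  have vs: "continuous_on {0..<R} (vs k) \<and> (\<forall>r. 0 \<le> r \<and> r < R \<longrightarrow>
      0 \<le> vs k r \<and> v0 r \<le> vs k r \<and> vs k r \<le> T a (vs k) r \<and> vs k r \<le> upper_sol B r)" for k
  proof (induction k)
    case 0
    have "v0 r \<le> upper_sol B r" if "0 \<le> r" "r < R" for r
      using v0(4)[OF that] upper_sol_ge[of B r] assms(5,6) that by linarith
    then show ?case using v0 by (auto simp: vs_0)
  next
    case (Suc k)
    have c: "continuous_on {0..<R} (T a (vs k))" using Suc by (intro cont_T) auto
    have le: "vs k r \<le> T a (vs k) r" if "0 \<le> r" "r < R" for r using Suc that by auto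
    have nn: "0 \<le> T a (vs k) r" if "0 \<le> r" "r < R" for r using Suc that le[OF that] by force
    have "T a (vs k) r \<le> T a (T a (vs k)) r" if "0 \<le> r" "r < R" for r
      using Suc c nn le that by (intro T_mono) auto
    moreover have "T a (vs k) r \<le> upper_sol B r" if "0 \<le> r" "r < R" for r
    proof -
      have "T a (vs k) r \<le> T a (upper_sol B) r"
        using Suc that S0 by (intro T_mono cont_upper_sol) auto
      then show ?thesis using upper_sol_supersolution[of a B r] assms that by simp
    qed
    ultimately show ?case using c nn le Suc by (auto simp: vs_Suc intro: order_trans)
  qed
  define v where "v r = lim (\<lambda>k. vs k r)" for r
  have lim: "(\<lambda>k. vs k r) \<longlonglongrightarrow> v r" if "0 \<le> r" "r < R" for r
  proof -
    have "incseq (\<lambda>k. vs k r)" using vs that by (intro incseq_SucI) (auto simp: vs_Suc)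
    moreover have "\<And>k. vs k r \<le> upper_sol B r" using vs that by auto
    ultimately have "convergent (\<lambda>k. vs k r)"
      by (metis incseq_convergent convergent_def)
    then show ?thesis by (simp add: v_def convergent_LIMSEQ_iff)
  qed
  have nn: "0 \<le> v r" "v0 r \<le> v r" "v r \<le> upper_sol B r" if "0 \<le> r" "r < R" for r
    using vs that lim[OF that]
    by (auto intro!: LIMSEQ_le_const[OF lim[OF that]] LIMSEQ_le_const2[OF lim[OF that]])
  \<comment> \<open>Each of the two integrals in \<open>T\<close> needs its own dominated
    convergence; the pointwise limits of the fluxes obtained here are the integrands of the second
    one.\<close>
  have inner: "(\<lambda>k. flux (src (vs k)) t) \<longlonglongrightarrow> flux (src v) t" if t: "0 \<le> t" "t < R" for t
  proof -
    have "(\<lambda>k. integral {0..t} (\<lambda>s. W s * src (vs k) s)) \<longlonglongrightarrow> integral {0..t} (\<lambda>s. W s * src v s)"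
    proof (rule dominated_convergence(2)[where h = "\<lambda>s. W s * src (upper_sol B) s"])
      show "(\<lambda>s. W s * src (vs k) s) integrable_on {0..t}" for k
        using vs t by (intro integrable_W cont_src) auto
      show "(\<lambda>s. W s * src (upper_sol B) s) integrable_on {0..t}"
        using S0 t by (intro integrable_W cont_src cont_upper_sol) auto
      show "norm (W s * src (vs k) s) \<le> W s * src (upper_sol B) s" if "s \<in> {0..t}" for k s
        using that t vs[of k] W_nonneg[of s] src_nonneg[of s "vs k"]
        by (auto simp: abs_mult intro!: mult_left_mono src_mono)
      show "(\<lambda>k. W s * src (vs k) s) \<longlonglongrightarrow> W s * src v s" if "s \<in> {0..t}" for s
        unfolding src_def using that t vs p_pos
        by (intro tendsto_intros lim tendsto_powr') (auto intro!: always_eventually)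
    qed
    then show ?thesis unfolding flux_def divide_inverse by (intro tendsto_intros)
  qed
  have fnn: "norm (flux (src (vs k)) t) \<le> flux (src (upper_sol B)) t" if "0 \<le> t" "t < R" for k t
  proof -
    have "0 \<le> flux (src (vs k)) t" using vs that by (intro flux_src_nonneg) auto
    moreover have "flux (src (vs k)) t \<le> flux (src (upper_sol B)) t"
      using vs that S0 by (intro flux_mono cont_src cont_upper_sol src_mono) auto
    ultimately show ?thesis by simp
  qed
  have outer: "flux (src v) integrable_on {0..r}"
    "(\<lambda>k. integral {0..r} (flux (src (vs k)))) \<longlonglongrightarrow> integral {0..r} (flux (src v))"
    if r: "0 \<le> r" "r < R" for r
  proof -
    have 1: "flux (src (vs k)) integrable_on {0..r}" for k
      using vs r by (intro integrable_cont cont_flux_src) auto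
    have 2: "flux (src (upper_sol B)) integrable_on {0..r}"
      using S0 r by (intro integrable_cont cont_flux_src cont_upper_sol) auto
    show "flux (src v) integrable_on {0..r}"
      by (rule dominated_convergence(1)[where f = "\<lambda>k. flux (src (vs k))", OF 1 2])
         (use fnn inner r in auto)
    show "(\<lambda>k. integral {0..r} (flux (src (vs k)))) \<longlonglongrightarrow> integral {0..r} (flux (src v))"
      by (rule dominated_convergence(2)[where f = "\<lambda>k. flux (src (vs k))", OF 1 2])
         (use fnn inner r in auto)
  qed
  have fixp: "v r = T a v r" if r: "0 \<le> r" "r < R" for r
  proof (rule LIMSEQ_unique)
    show "(\<lambda>k. vs (Suc k) r) \<longlonglongrightarrow> v r" using lim[OF r] by (rule LIMSEQ_Suc)
    show "(\<lambda>k. vs (Suc k) r) \<longlonglongrightarrow> T a v r"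
      unfolding vs_Suc T_def by (intro tendsto_intros outer r)
  qed
  \<comment> \<open>A monotone pointwise limit need not be continuous. Continuity comes from the
    equation v = T a v, whose right-hand side is an indefinite integral.\<close>
  have "continuous_on {0..<R} (T a v)"
    unfolding T_def[abs_def] by (intro continuous_intros integral_cont outer)
  then have "continuous_on {0..<R} v"
    using fixp by (subst continuous_on_cong[OF refl, of _ _ "T a v"]) auto
  then have sol: "solves a v" using nn fixp by (auto simp: solves_def)
  have zero: "v r = 0" if a: "a = 0" and z: "\<And>s. 0 \<le> s \<Longrightarrow> s \<le> r0 \<Longrightarrow> v0 s = 0"
    and r: "0 \<le> r" "r \<le> r0" "r < R" for r0 r
  proof -
    have "\<forall>s. 0 \<le> s \<and> s \<le> r0 \<and> s < R \<longrightarrow> vs k s = 0" for k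
    proof (induction k)
      case 0 show ?case using z by (simp add: vs_0)
    next
      case (Suc k)
      have "T a (vs k) s = 0" if s: "0 \<le> s" "s \<le> r0" "s < R" for s
      proof (rule antisym)
        \<comment> \<open>By the induction hypothesis the iterate is zero on all of [0, s], and
          \<open>T 0\<close> fixes the zero function.\<close>
        have "T a (vs k) s \<le> T a (\<lambda>_. 0) s"
          using vs[of k] s Suc by (intro T_mono) auto
        also have "\<dots> = 0" using a by (simp add: T_def src_def[abs_def] flux_def[abs_def])
        finally show "T a (vs k) s \<le> 0" .
        show "0 \<le> T a (vs k) s" using vs[of "Suc k"] s by (simp add: vs_Suc)
      qed
      then show ?case by (simp add: vs_Suc)
    qed
    then have "(\<lambda>k. vs k r) = (\<lambda>_. 0)" using r by auto
    then show ?thesis using lim[OF r(1,3)] by (simp add: LIMSEQ_const_iff)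
  qed
  show thesis
  proof (rule that[OF sol])
    show "v0 r \<le> v r" "v r \<le> upper_sol B r" if "0 \<le> r" "r < R" for r
      using nn[OF that] by auto
    show "v r = 0" if "a = 0" "\<And>s. 0 \<le> s \<Longrightarrow> s \<le> r0 \<Longrightarrow> v0 s = 0" "0 \<le> r" "r \<le> r0" "r < R" for r0 r
      by (rule zero[OF that])
  qed
qed

text \<open>
  If the minimum \<open>l\<close> of \<open>v / u\<close> were less than \<open>1\<close>, concavity would give \<open>v = T b v \<ge> b + l (T a u - a) > l u\<close>,
  also where the minimum is attained.
\<close>

lemma solves_gap:
  assumes u: "solves a u" and v: "solves b v" and "0 < a" "a \<le> b" and r: "0 \<le> r" "r < R"
  shows "u r + (b - a) \<le> v r"
proof -
  have cu: "continuous_on {0..<R} u" and cv: "continuous_on {0..<R} v"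
    and u0: "\<And>s. 0 \<le> s \<Longrightarrow> s < R \<Longrightarrow> 0 \<le> u s" and v0: "\<And>s. 0 \<le> s \<Longrightarrow> s < R \<Longrightarrow> 0 \<le> v s"
    and Tu: "\<And>s. 0 \<le> s \<Longrightarrow> s < R \<Longrightarrow> u s = T a u s" and Tv: "\<And>s. 0 \<le> s \<Longrightarrow> s < R \<Longrightarrow> v s = T b v s"
    using solves_cont[OF u] solves_cont[OF v] solves_nonneg[OF u] solves_nonneg[OF v]
      solves_eq[OF u] solves_eq[OF v] by blast+
  have ua: "a \<le> u s" if "0 \<le> s" "s < R" for s
    using T_ge[OF cu u0 that, of a] Tu[OF that] by simp
  have vb: "b \<le> v s" if "0 \<le> s" "s < R" for s
    using T_ge[OF cv v0 that, of b] Tv[OF that] by simp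
  have "continuous_on {0..r} (\<lambda>s. v s / u s)"
    using ua r \<open>0 < a\<close> by (intro continuous_on_divide cont_Icc[OF cu] cont_Icc[OF cv]) force+
  then obtain x where x: "0 \<le> x" "x \<le> r" "\<And>s. 0 \<le> s \<Longrightarrow> s \<le> r \<Longrightarrow> v x / u x \<le> v s / u s"
    using continuous_attains_inf[OF compact_Icc, of 0 r "\<lambda>s. v s / u s"] r by auto
  define l where "l = v x / u x"
  have pos: "0 < u s" if "0 \<le> s" "s \<le> r" for s using ua[of s] that r \<open>0 < a\<close> by simp
  have lv: "l * u s \<le> v s" if "0 \<le> s" "s \<le> r" for s
    using x(3)[OF that] pos[OF that] by (simp add: l_def pos_le_divide_eq)
  have l0: "0 < l" using vb[of x] pos[of x] x r assms by (simp add: l_def)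
  have "1 \<le> l"
  proof (rule ccontr)
    assume "\<not> 1 \<le> l"
    then have l1: "l < 1" by simp
    have f: "l * flux (src u) t \<le> flux (src v) t" if t: "0 \<le> t" "t \<le> x" for t
    proof -
      have "l * src u s \<le> src v s" if s: "0 \<le> s" "s \<le> t" for s
      proof -
        \<comment> \<open>Concavity of the source enters through l <= l powr p for 0 < l <
          1.\<close>
        have "l powr 1 \<le> l powr p" using l0 l1 p_less by (intro powr_mono') auto
        then have "l * u s powr p \<le> (l * u s) powr p"
          using l0 by (simp add: powr_mult mult_right_mono)
        then have "l * src u s \<le> src (\<lambda>s. l * u s) s"
          using A_pos[of s] s t x r by (auto simp: src_def algebra_simps)
        also have "\<dots> \<le> src v s" using lv[of s] l0 u0[of s] s t x r by (intro src_mono) auto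
        finally show ?thesis .
      qed
      then have "flux (\<lambda>s. l * src u s) t \<le> flux (src v) t"
        using t x r by (intro flux_mono continuous_intros cont_src cu cv u0 v0) auto
      then show ?thesis by (simp add: flux_cmult)
    qed
    have "l * integral {0..x} (flux (src u)) \<le> integral {0..x} (flux (src v))"
      unfolding integral_mult_right[symmetric] using x r f
      by (intro integral_le integrable_cont continuous_intros cont_flux_src cu cv u0 v0) auto
    then have "l * (u x - a) \<le> v x - b"
      using Tu[of x] Tv[of x] x r by (simp add: T_def)
    moreover have "l * u x = v x" using pos[of x] x by (simp add: l_def)
    \<comment> \<open>The two preceding facts give b <= l a at the minimum point, so the positive
      initial value supplies the contradiction.\<close>
    moreover have "l * a < b" using l1 \<open>0 < a\<close> \<open>a \<le> b\<close> mult_strict_right_mono[of l 1 a] by linarith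
    ultimately show False by (simp add: algebra_simps)
  qed
  have "u s \<le> v s" if "0 \<le> s" "s \<le> r" for s
    using mult_right_mono[OF \<open>1 \<le> l\<close>, of "u s"] lv[OF that] pos[OF that] by linarith
  \<comment> \<open>One more application of the operator upgrades the plain ordering to the gap
    \<open>b - a\<close>, which later gives strict monotonicity.\<close>
  then have "T a u r \<le> T a v r" using r by (intro T_mono cu cv u0 v0)
  then show ?thesis using Tu[OF r] Tv[OF r] by (simp add: T_def)
qed

text \<open>The model equation \<open>(r ^ n v')' = r ^ n v powr p\<close> has the solution \<open>D powr (1 / (1 - p)) * r powr k\<close>.\<close>

definition k :: real where "k = 2 / (1 - p)"

definition D :: real where "D = 1 / (k * (k + real n - 1))"

text \<open>The identity is the balance of exponents behind k: a source of order r powr (k p) gains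
  two powers under the two integrations and returns to order r powr k.\<close>

lemma k_gt: "2 < k" and kp: "k * p + 2 = k"
  using p_pos p_less by (simp_all add: k_def field_simps)

lemma D_pos: "0 < D"
  using k_gt by (simp add: D_def)

text \<open>Inner integration of the model problem: the kernel adds n to the exponent, integration
  adds 1, and k p + n + 1 = k + n - 1. The outer one, in \<open>profile_integral2\<close>,
  contributes the remaining factor 1 / k of \<open>D\<close>.\<close>

lemma profile_integral:
  assumes "R0 < t"
  shows "((\<lambda>s. K * ((s - R0) / (t - R0)) ^ n * (s - R0) powr (k * p)) has_integral
     K / (k + real n - 1) * (t - R0) powr (k * p + 1)) {R0..t}"
proof -
  have kp0: "0 < k * p" using k_gt p_pos by simp
  have "((\<lambda>s. K / (t - R0) ^ n * (s - R0) powr (k * p + real n)) has_integral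
     K / (t - R0) ^ n * ((t - R0) powr (k * p + real n + 1) / (k * p + real n + 1))) {R0..t}"
    using assms kp0 by (intro has_integral_mult_right powr_has_integral) auto
  moreover have "K / (t - R0) ^ n * (s - R0) powr (k * p + real n) =
      K * ((s - R0) / (t - R0)) ^ n * (s - R0) powr (k * p)" if "s \<in> {R0..t}" for s
    using that by (cases "s = R0") (auto simp: powr_add powr_realpow power_divide)
  moreover have "K / (t - R0) ^ n * ((t - R0) powr (k * p + real n + 1) / (k * p + real n + 1)) =
      K / (k + real n - 1) * (t - R0) powr (k * p + 1)"
  proof -
    have 1: "(t - R0) powr (k * p + real n + 1) = (t - R0) powr (k * p + 1) * (t - R0) ^ n"
      using assms by (simp add: powr_add powr_realpow)
    have 2: "k * p + real n + 1 = k + real n - 1" using kp by simp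
    have 3: "a / X * (Y * X / Z) = a / Z * Y" if "X \<noteq> 0" for a X Y Z :: real
      using that by simp
    show ?thesis
      unfolding 1 unfolding 2 by (rule 3) (use assms in simp)
  qed
  ultimately show ?thesis
    using has_integral_cong[of "{R0..t}"
      "\<lambda>s. K / (t - R0) ^ n * (s - R0) powr (k * p + real n)"
      "\<lambda>s. K * ((s - R0) / (t - R0)) ^ n * (s - R0) powr (k * p)"] by simp
qed

lemma profile_integral2:
  assumes "R0 \<le> r"
  shows "((\<lambda>t. K / (k + real n - 1) * (t - R0) powr (k * p + 1)) has_integral K * D * (r - R0) powr k) {R0..r}"
proof -
  have "0 < k * p" using k_gt p_pos by simp
  then have "((\<lambda>t. K / (k + real n - 1) * (t - R0) powr (k * p + 1)) has_integral
      K / (k + real n - 1) * ((r - R0) powr (k * p + 1 + 1) / (k * p + 1 + 1))) {R0..r}"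
    using assms by (intro has_integral_mult_right powr_has_integral) auto
  moreover have "k * p + 1 + 1 = k" using kp by simp
  ultimately show ?thesis by (simp add: D_def mult.commute)
qed

text \<open>
  For \<open>R0 > 0\<close> the kernel \<open>(s / t) ^ n\<close> is estimated from below by \<open>((s - R0) / (t - R0)) ^ n\<close>,
  which makes the integrals explicit and independent of \<open>R0\<close>.
\<close>

lemma T_profile_lower:
  assumes v: "continuous_on {0..<R} v" "\<And>r. 0 \<le> r \<Longrightarrow> r < R \<Longrightarrow> 0 \<le> v r"
    and R0: "0 \<le> R0" "R0 \<le> r" "r < R"
    and le: "\<And>s t. R0 < s \<Longrightarrow> s \<le> t \<Longrightarrow> t \<le> r \<Longrightarrow>
      K * ((s - R0) / (t - R0)) ^ n * (s - R0) powr (k * p) * W t \<le> W s * src v s"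
  shows "K * D * (r - R0) powr k \<le> T 0 v r"
proof -
  have flux: "K / (k + real n - 1) * (t - R0) powr (k * p + 1) \<le> flux (src v) t" if t: "R0 \<le> t" "t \<le> r" for t
  proof (cases "R0 = t")
    case True
    then show ?thesis using flux_src_nonneg[OF v, of t] R0 t by simp
  next
    case False
    then have Rt: "R0 < t" using t by simp
    have I: "(\<lambda>s. W s * src v s) integrable_on {0..t}" using t R0 v by (intro integrable_W cont_src) auto
    have I': "(\<lambda>s. W s * src v s) integrable_on {R0..t}"
      by (rule integrable_on_subinterval[OF I]) (use R0 in auto)
    have "K / (k + real n - 1) * (t - R0) powr (k * p + 1) * W t \<le> integral {R0..t} (\<lambda>s. W s * src v s)"
    proof (rule has_integral_le)
      show "((\<lambda>s. K * ((s - R0) / (t - R0)) ^ n * (s - R0) powr (k * p) * W t) has_integral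
        K / (k + real n - 1) * (t - R0) powr (k * p + 1) * W t) {R0..t}"
        by (rule has_integral_mult_left[OF profile_integral[OF Rt]])
      show "((\<lambda>s. W s * src v s) has_integral integral {R0..t} (\<lambda>s. W s * src v s)) {R0..t}"
        by (rule integrable_integral[OF I'])
      fix s assume s: "s \<in> {R0..t}"
      show "K * ((s - R0) / (t - R0)) ^ n * (s - R0) powr (k * p) * W t \<le> W s * src v s"
      proof (cases "s = R0")
        case True
        then show ?thesis using W_nonneg[of s] src_nonneg[of s v] v R0 t by simp
      next
        case False
        then show ?thesis using le[of s t] s t by simp
      qed
    qed
    also have "\<dots> \<le> integral {0..t} (\<lambda>s. W s * src v s)"
      using R0 t W_nonneg src_nonneg[of _ v] v by (intro integral_subset_le I I') auto
    finally show ?thesis using W_pos[of t] Rt R0 t by (simp add: flux_def pos_le_divide_eq)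
  qed
  have I: "flux (src v) integrable_on {0..r}" using R0 v by (intro integrable_cont cont_flux_src) auto
  have I': "flux (src v) integrable_on {R0..r}"
    by (rule integrable_on_subinterval[OF I]) (use R0 in auto)
  have "K * D * (r - R0) powr k \<le> integral {R0..r} (flux (src v))"
    using flux by (intro has_integral_le[OF profile_integral2[OF R0(2)] integrable_integral[OF I']]) auto
  also have "\<dots> \<le> integral {0..r} (flux (src v))"
    using R0 flux_src_nonneg[of v] v by (intro integral_subset_le I I') auto
  finally show ?thesis by (simp add: T_def)
qed

text \<open>The shifted kernel used for R0 > 0 is only a lower bound, so upper estimates are made at
  the origin alone. The hypothesis \<open>v 0 = 0\<close> settles s = 0, where the weight is
  positive if n = 0.\<close>

lemma T_profile_upper:
  assumes v: "continuous_on {0..<R} v" "\<And>r. 0 \<le> r \<Longrightarrow> r < R \<Longrightarrow> 0 \<le> v r"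
    and r: "0 \<le> r" "r < R" and "v 0 = 0"
    and le: "\<And>s t. 0 < s \<Longrightarrow> s \<le> t \<Longrightarrow> t \<le> r \<Longrightarrow>
      W s * src v s \<le> K * (s / t) ^ n * s powr (k * p) * W t"
  shows "T 0 v r \<le> K * D * r powr k"
proof -
  have flux: "flux (src v) t \<le> K / (k + real n - 1) * (t - 0) powr (k * p + 1)" if t: "0 \<le> t" "t \<le> r" for t
  proof (cases "0 = t")
    case False
    then have Rt: "0 < t" using t by simp
    have I: "(\<lambda>s. W s * src v s) integrable_on {0..t}" using t r v by (intro integrable_W cont_src) auto
    have "integral {0..t} (\<lambda>s. W s * src v s) \<le> K / (k + real n - 1) * (t - 0) powr (k * p + 1) * W t"
    proof (rule has_integral_le)
      show "((\<lambda>s. K * ((s - 0) / (t - 0)) ^ n * (s - 0) powr (k * p) * W t) has_integral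
        K / (k + real n - 1) * (t - 0) powr (k * p + 1) * W t) {0..t}"
        by (rule has_integral_mult_left[OF profile_integral[OF Rt]])
      show "((\<lambda>s. W s * src v s) has_integral integral {0..t} (\<lambda>s. W s * src v s)) {0..t}"
        by (rule integrable_integral[OF I])
      fix s assume s: "s \<in> {0..t}"
      show "W s * src v s \<le> K * ((s - 0) / (t - 0)) ^ n * (s - 0) powr (k * p) * W t"
      proof (cases "s = 0")
        case True
        then show ?thesis using \<open>v 0 = 0\<close> by (simp add: src_def)
      next
        case False
        then show ?thesis using le[of s t] s t by simp
      qed
    qed
    then show ?thesis using W_pos[of t] Rt r t by (simp add: flux_def pos_divide_le_eq)
  qed (simp)
  have I: "flux (src v) integrable_on {0..r}" using r v by (intro integrable_cont cont_flux_src) auto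
  have "integral {0..r} (flux (src v)) \<le> K * D * (r - 0) powr k"
    using flux by (intro has_integral_le[OF integrable_integral[OF I] profile_integral2[OF r(1)]]) auto
  then show ?thesis by (simp add: T_def)
qed

text \<open>On a compact interval \<open>\<phi>\<close> lies between positive constants and
  \<open>A\<close> is bounded away from 0. A crude m is enough to find a subsolution; the sharp
  constant at the origin comes from \<open>kernel_limit\<close>.\<close>

lemma kernel_lower:
  assumes "r < R"
  obtains m where "0 < m" "\<And>s t. 0 < s \<Longrightarrow> s \<le> t \<Longrightarrow> t \<le> r \<Longrightarrow> m * (s / t) ^ n * W t \<le> W s * A s"
proof (cases "0 \<le> r")
  case True
  obtain a b where ab: "0 < a" "\<And>s. 0 \<le> s \<Longrightarrow> s \<le> r \<Longrightarrow> a \<le> \<phi> s \<and> \<phi> s \<le> b"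
    using phi_bounds[OF assms] by blast
  have c: "continuous_on {0..r} A" by (rule cont_Icc[OF cont_A assms])
  obtain x where x: "x \<in> {0..r}" "\<And>y. y \<in> {0..r} \<Longrightarrow> A x \<le> A y"
    using continuous_attains_inf[OF compact_Icc _ c] True by fastforce
  have Ax: "0 < A x" using A_pos x assms by auto
  have b0: "0 < b" using ab(1) ab(2)[of 0] True by simp
  show thesis
  proof (rule that[of "a\<^sup>2 * A x / b\<^sup>2"])
    show "0 < a\<^sup>2 * A x / b\<^sup>2" using Ax ab b0 by simp
    fix s t assume st: "0 < s" "s \<le> t" "t \<le> r"
    have "a\<^sup>2 * A x / b\<^sup>2 * (\<phi> t)\<^sup>2 \<le> a\<^sup>2 * A x / b\<^sup>2 * b\<^sup>2"
      using ab(2)[of t] ab(1) Ax st by (intro mult_left_mono power_mono) auto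
    also have "\<dots> = a\<^sup>2 * A x" using b0 by simp
    also have "\<dots> \<le> (\<phi> s)\<^sup>2 * A s"
      using ab(2)[of s] ab(1) Ax st x by (intro mult_mono power_mono) auto
    finally have "s ^ n * (a\<^sup>2 * A x / b\<^sup>2 * (\<phi> t)\<^sup>2) \<le> s ^ n * ((\<phi> s)\<^sup>2 * A s)"
      using st by (intro mult_left_mono) auto
    then show "a\<^sup>2 * A x / b\<^sup>2 * (s / t) ^ n * W t \<le> W s * A s"
      using st by (simp add: W_def power_divide algebra_simps)
  qed
qed (rule that[of 1], auto)

text \<open>The case R0 = 0 is included. There the lower bound by a power is the essential output:
  it excludes the zero solution when the profile at the origin is determined.\<close>

lemma dead_core_solution_exists:
  assumes R0: "0 \<le> R0" "R0 < R"
  obtains v c R1 B where "solves 0 v" "0 < c" "R0 < R1" "R1 < R" "0 \<le> B"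
    "\<And>r. 0 \<le> r \<Longrightarrow> r \<le> R0 \<Longrightarrow> v r = 0"
    "\<And>r. R0 \<le> r \<Longrightarrow> r \<le> R1 \<Longrightarrow> c * (r - R0) powr k \<le> v r"
    "\<And>r. 0 \<le> r \<Longrightarrow> r < R \<Longrightarrow> v r \<le> upper_sol B r"
proof -
  define R1 where "R1 = (R0 + R) / 2"
  have R1: "R0 < R1" "R1 < R" using R0 by (auto simp: R1_def)
  obtain m where m: "0 < m" "\<And>s t. 0 < s \<Longrightarrow> s \<le> t \<Longrightarrow> t \<le> R1 \<Longrightarrow> m * (s / t) ^ n * W t \<le> W s * A s"
    using kernel_lower[OF R1(2)] by blast
  \<comment> \<open>This is the solution of m D c powr p = c, so the lower bound for
    \<open>T\<close> applied to the profile is the profile itself.\<close>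
  define c where "c = (m * D) powr (1 / (1 - p))"
  have c0: "0 < c" using m D_pos by (simp add: c_def)
  have "c = c powr (1 - p) * c powr p" using c0 by (simp add: powr_add[symmetric])
  moreover have "c powr (1 - p) = m * D" using m D_pos p_less by (simp add: c_def powr_powr)
  ultimately have c: "m * c powr p * D = c" by (simp add: algebra_simps)
  \<comment> \<open>\<open>max\<close> cuts the profile off at R0 and \<open>min\<close> freezes it
    beyond R1. Freezing keeps it bounded, and beyond R1 the subsolution inequality persists because
    \<open>T 0 v0\<close> is nondecreasing.\<close>
  define v0 where "v0 r = c * max 0 (min r R1 - R0) powr k" for r
  have k0: "0 < k" using k_gt by simp
  have cont: "continuous_on {0..<R} v0"
    unfolding v0_def using k0 by (intro continuous_intros continuous_on_powr') auto
  have nn: "0 \<le> v0 r" for r using c0 by (simp add: v0_def)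
  have ub: "v0 r \<le> c * (R1 - R0) powr k" for r
    unfolding v0_def using c0 k0 R1 by (intro mult_left_mono powr_mono2) auto
  have sub1: "v0 r \<le> T 0 v0 r" if r: "R0 \<le> r" "r \<le> R1" for r
  proof -
    have "m * c powr p * D * (r - R0) powr k \<le> T 0 v0 r"
    proof (rule T_profile_lower)
      fix s t assume st: "R0 < s" "s \<le> t" "t \<le> r"
      have "(s - R0) / (t - R0) \<le> s / t"
        using st R0 by (simp add: field_simps mult_left_mono)
      then have q: "((s - R0) / (t - R0)) ^ n \<le> (s / t) ^ n" using st R0 by (intro power_mono) auto
      have v0s: "v0 s powr p = c powr p * (s - R0) powr (k * p)"
        using st r c0 by (simp add: v0_def powr_mult powr_powr min_def max_def)
      have "m * c powr p * ((s - R0) / (t - R0)) ^ n * (s - R0) powr (k * p) * W t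
          \<le> m * c powr p * (s / t) ^ n * (s - R0) powr (k * p) * W t"
        using q m(1) W_nonneg[of t] st R0 by (intro mult_right_mono mult_left_mono) auto
      also have "\<dots> = (m * (s / t) ^ n * W t) * v0 s powr p" by (simp add: v0s)
      also have "\<dots> \<le> W s * A s * v0 s powr p"
        using m(2)[of s t] st R0 r by (intro mult_right_mono) auto
      also have "\<dots> \<le> W s * src v0 s"
        using W_nonneg[of s] P_nonneg[of s] nn[of s] st R0 r R1 by (simp add: src_def algebra_simps)
      finally show "m * c powr p * ((s - R0) / (t - R0)) ^ n * (s - R0) powr (k * p) * W t \<le> W s * src v0 s" .
    qed (use r R0 R1 nn cont in auto)
    then show ?thesis using r by (simp add: c v0_def min_def max_def)
  qed
  have sub: "v0 r \<le> T 0 v0 r" if r: "0 \<le> r" "r < R" for r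
  proof -
    consider "r \<le> R0" | "R0 \<le> r" "r \<le> R1" | "R1 \<le> r" by linarith
    then show ?thesis
    proof cases
      case 1
      then have "v0 r = 0" using k0 by (simp add: v0_def)
      then show ?thesis using T_ge[OF cont nn r, of 0] by simp
    next
      case 3
      then have "v0 r = v0 R1" by (simp add: v0_def)
      also have "\<dots> \<le> T 0 v0 R1" using sub1[of R1] R1 by simp
      also have "\<dots> \<le> T 0 v0 r" using T_mono_arg[OF cont nn, of R1 r 0] 3 r R1 R0 by simp
      finally show ?thesis .
    qed (rule sub1)
  qed
  have B0: "0 \<le> c * (R1 - R0) powr k" using c0 by simp
  obtain v where v: "solves 0 v" "\<And>r. 0 \<le> r \<Longrightarrow> r < R \<Longrightarrow> v0 r \<le> v r"
    "\<And>r. 0 \<le> r \<Longrightarrow> r < R \<Longrightarrow> v r \<le> upper_sol (c * (R1 - R0) powr k) r"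
    "\<And>r0 r. (\<And>s. 0 \<le> s \<Longrightarrow> s \<le> r0 \<Longrightarrow> v0 s = 0) \<Longrightarrow> 0 \<le> r \<Longrightarrow> r \<le> r0 \<Longrightarrow> r < R \<Longrightarrow> v r = 0"
    using solution_exists[OF cont nn sub ub _ B0] by auto
  show thesis
  proof (rule that[OF v(1) c0 R1 B0])
    show "v r \<le> upper_sol (c * (R1 - R0) powr k) r" if "0 \<le> r" "r < R" for r
      using v(3)[OF that] .
    show "v r = 0" if "0 \<le> r" "r \<le> R0" for r
      using v(4)[of R0 r] that R0 k0 by (simp add: v0_def)
    show "c * (r - R0) powr k \<le> v r" if "R0 \<le> r" "r \<le> R1" for r
      using v(2)[of r] that R0 R1 by (simp add: v0_def min_def max_def)
  qed
qed

text \<open>No sharp constant is needed for \<open>P\<close>: near the origin v is smaller than v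
  powr p by two powers of r, so this part of the source is negligible there.\<close>

lemma kernel_upper:
  assumes "r < R"
  obtains C where "0 < C" "\<And>s t. 0 < s \<Longrightarrow> s \<le> t \<Longrightarrow> t \<le> r \<Longrightarrow> W s * P s \<le> C * (s / t) ^ n * W t"
proof (cases "0 \<le> r")
  case True
  obtain a b where ab: "0 < a" "\<And>s. 0 \<le> s \<Longrightarrow> s \<le> r \<Longrightarrow> a \<le> \<phi> s \<and> \<phi> s \<le> b"
    using phi_bounds[OF assms] by blast
  have c: "continuous_on {0..r} P" by (rule cont_Icc[OF cont_P assms])
  obtain x where x: "x \<in> {0..r}" "\<And>y. y \<in> {0..r} \<Longrightarrow> P y \<le> P x"
    using continuous_attains_sup[OF compact_Icc _ c] True by fastforce
  have Px: "0 \<le> P x" using P_nonneg x assms by auto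
  have b0: "0 < b" using ab(1) ab(2)[of 0] True by simp
  show thesis
  proof (rule that[of "b\<^sup>2 * (P x + 1) / a\<^sup>2"])
    show "0 < b\<^sup>2 * (P x + 1) / a\<^sup>2" using Px ab b0 by simp
    fix s t assume st: "0 < s" "s \<le> t" "t \<le> r"
    have "(\<phi> s)\<^sup>2 * P s \<le> b\<^sup>2 * (P x + 1)"
      using ab(2)[of s] ab(1) st x(2)[of s] P_nonneg[of s] Px assms by (intro mult_mono power_mono) auto
    also have "\<dots> = b\<^sup>2 * (P x + 1) / a\<^sup>2 * a\<^sup>2" using ab by simp
    also have "\<dots> \<le> b\<^sup>2 * (P x + 1) / a\<^sup>2 * (\<phi> t)\<^sup>2"
      using ab(2)[of t] ab(1) Px st by (intro mult_left_mono power_mono) auto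
    finally have "s ^ n * ((\<phi> s)\<^sup>2 * P s) \<le> s ^ n * (b\<^sup>2 * (P x + 1) / a\<^sup>2 * (\<phi> t)\<^sup>2)"
      using st by (intro mult_left_mono) auto
    then show "W s * P s \<le> b\<^sup>2 * (P x + 1) / a\<^sup>2 * (s / t) ^ n * W t"
      using st by (simp add: W_def power_divide algebra_simps)
  qed
qed (rule that[of 1], auto)

text \<open>\<open>W s * A s\<close> equals F(s, t) (s / t)^n W t, and F is jointly continuous at
  (0, 0) with value A 0. Hence the relative error e is uniform in s and t.\<close>

lemma kernel_limit:
  assumes "0 < e"
  obtains r where "0 < r" "r < R"
    "\<And>s t. 0 < s \<Longrightarrow> s \<le> t \<Longrightarrow> t \<le> r \<Longrightarrow> (1 - e) * A 0 * (s / t) ^ n * W t \<le> W s * A s"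
    "\<And>s t. 0 < s \<Longrightarrow> s \<le> t \<Longrightarrow> t \<le> r \<Longrightarrow> W s * A s \<le> (1 + e) * A 0 * (s / t) ^ n * W t"
proof -
  define F where "F z = (\<phi> (fst z))\<^sup>2 * A (fst z) / (\<phi> (snd z))\<^sup>2" for z
  have "continuous_on ({0..<R} \<times> {0..<R}) F"
    unfolding F_def using phi_pos
    by (intro continuous_intros continuous_on_compose2[OF cont_phi] continuous_on_compose2[OF cont_A]) force+
  moreover have A0: "0 < A 0" and F0: "F (0, 0) = A 0" using A_pos[of 0] phi_pos[of 0] R_pos by (auto simp: F_def)
  ultimately obtain d where d: "0 < d" "\<And>z. z \<in> {0..<R} \<times> {0..<R} \<Longrightarrow> dist z (0,0) < d \<Longrightarrow> dist (F z) (F (0,0)) < e * A 0"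
    using assms R_pos unfolding continuous_on_iff by (metis (no_types, lifting) mem_Sigma_iff atLeastLessThan_iff mult_pos_pos order_refl)
  define r where "r = min (R / 2) (d / 3)"
  have r: "0 < r" "r < R" "2 * r < d" using R_pos d(1) by (auto simp: r_def min_def)
  have F: "\<bar>F (s, t) - A 0\<bar> < e * A 0" if "0 < s" "s \<le> t" "t \<le> r" for s t
  proof -
    have "dist (s, t) (0, 0) \<le> dist s 0 + dist t 0"
      using dist_Pair_Pair[of s t 0 0] sqrt_sum_squares_le_sum_abs[of "dist s 0" "dist t 0"] by simp
    also have "\<dots> < d" using that r by simp
    finally show ?thesis using d(2)[of "(s, t)"] that r by (simp add: F0 dist_real_def)
  qed
  have WA: "W s * A s = F (s, t) * (s / t) ^ n * W t" if "0 < s" "s \<le> t" "t \<le> r" for s t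
    using phi_pos[of t] that r by (simp add: W_def F_def power_divide)
  show thesis
  proof (rule that[OF r(1,2)])
    fix s t assume st: "0 < s" "s \<le> t" "t \<le> r"
    have FA: "(1 - e) * A 0 \<le> F (s, t)" "F (s, t) \<le> (1 + e) * A 0" using F[OF st] by (auto simp: algebra_simps)
    have z: "0 \<le> (s / t) ^ n * W t" using st W_nonneg[of t] by simp
    from mult_right_mono[OF FA(1) z] mult_right_mono[OF FA(2) z] show "(1 - e) * A 0 * (s / t) ^ n * W t \<le> W s * A s"
      "W s * A s \<le> (1 + e) * A 0 * (s / t) ^ n * W t"
      unfolding WA[OF st] by (simp_all only: mult.assoc)
  qed
qed

text \<open>Self-improvement of the infimum m of v / r powr k: inserting the profile with constant m
  into v = T 0 v returns (1 - e) A(0) D m powr p <= m, from which m is isolated. The a priori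
  constant c makes m positive.\<close>

lemma profile_lower_bound:
  assumes v: "solves 0 v" and c: "0 < c" "0 < r1" "\<And>r. 0 \<le> r \<Longrightarrow> r \<le> r1 \<Longrightarrow> c * r powr k \<le> v r"
    and e: "0 < e" "e < 1"
  obtains \<rho> where "0 < \<rho>" "\<rho> < R"
    "\<And>r. 0 < r \<Longrightarrow> r \<le> \<rho> \<Longrightarrow> ((1 - e) * A 0 * D) powr (1 / (1 - p)) \<le> v r / r powr k"
proof -
  note cv = solves_cont[OF v] and nn = solves_nonneg[OF v]
  obtain r2 where r2: "0 < r2" "r2 < R"
    "\<And>s t. 0 < s \<Longrightarrow> s \<le> t \<Longrightarrow> t \<le> r2 \<Longrightarrow> (1 - e) * A 0 * (s / t) ^ n * W t \<le> W s * A s"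
    "\<And>s t. 0 < s \<Longrightarrow> s \<le> t \<Longrightarrow> t \<le> r2 \<Longrightarrow> W s * A s \<le> (1 + e) * A 0 * (s / t) ^ n * W t"
    by (rule kernel_limit[OF e(1)]) (rule that, assumption+)
  define \<rho> where "\<rho> = min r1 r2"
  have \<rho>: "0 < \<rho>" "\<rho> < R" "\<rho> \<le> r1" "\<rho> \<le> r2" using r2 c by (auto simp: \<rho>_def)
  define m where "m = (INF r\<in>{0<..\<rho>}. v r / r powr k)"
  have ge_c: "c \<le> v r / r powr k" if "0 < r" "r \<le> \<rho>" for r
    using c(3)[of r] that \<rho> by (simp add: pos_le_divide_eq)
  have bdd: "bdd_below ((\<lambda>r. v r / r powr k) ` {0<..\<rho>})" by (rule bdd_belowI2[of _ c]) (use ge_c in auto)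
  have m0: "0 < m"
  proof -
    have "c \<le> m" unfolding m_def using ge_c \<rho> by (intro cINF_greatest) auto
    then show ?thesis using c by simp
  qed
  have vm: "m * r powr k \<le> v r" if "0 < r" "r \<le> \<rho>" for r
    using cINF_lower[OF bdd, of r] that by (simp add: m_def pos_le_divide_eq)
  define K where "K = (1 - e) * A 0 * m powr p"
  have A0: "0 < A 0" using A_pos R_pos by simp
  have "K * D * (r - 0) powr k \<le> T 0 v r" if r: "0 < r" "r \<le> \<rho>" for r
  proof (rule T_profile_lower[OF cv nn])
    fix s t :: real assume st: "0 < s" "s \<le> t" "t \<le> r"
    have "(m * s powr k) powr p \<le> v s powr p" using vm[of s] m0 st r p_pos by (intro powr_mono2) auto
    then have "m powr p * s powr (k * p) \<le> v s powr p" using m0 by (simp add: powr_mult powr_powr)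
    then have "((1 - e) * A 0 * (s / t) ^ n * W t) * (m powr p * s powr (k * p)) \<le> W s * A s * v s powr p"
      using r2(3)[of s t] st r \<rho> W_nonneg[of s] A_pos[of s] by - (rule mult_mono, auto)
    also have "\<dots> \<le> W s * src v s"
      using W_nonneg[of s] P_nonneg[of s] nn[of s] st r \<rho> by (simp add: src_def algebra_simps)
    finally show "K * ((s - 0) / (t - 0)) ^ n * (s - 0) powr (k * p) * W t \<le> W s * src v s"
      by (simp add: K_def algebra_simps)
  qed (use r \<rho> in auto)
  then have Tr: "K * D \<le> v r / r powr k" if "0 < r" "r \<le> \<rho>" for r
    using solves_eq[OF v, of r] that \<rho> by (simp add: pos_le_divide_eq)
  have "K * D \<le> m" unfolding m_def using Tr \<rho> by (intro cINF_greatest) auto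
  then have "(1 - e) * A 0 * D * m powr p \<le> m" by (simp add: K_def mult_ac)
  then have le: "((1 - e) * A 0 * D) powr (1 / (1 - p)) \<le> m"
    using e A0 D_pos p_less m0 by (intro powr_mult_self_le) auto
  show thesis
  proof (rule that[OF \<rho>(1,2)])
    fix r assume r: "0 < r" "r \<le> \<rho>"
    have "m \<le> v r / r powr k" using vm[OF r] r by (simp add: pos_le_divide_eq)
    with le show "((1 - e) * A 0 * D) powr (1 / (1 - p)) \<le> v r / r powr k" by simp
  qed
qed

text \<open>Since v is nondecreasing, its source on [0, r] is at most (A + P) times an expression in
  the end value. With \<open>growth_quadratic\<close> this gives v = O(r powr k) and hence a finite
  supremum in \<open>profile_upper_bound\<close>.\<close>

lemma solves_le_growth:
  assumes v: "solves 0 v" and r: "0 \<le> r" "r < R"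
  shows "v r \<le> growth r * (v r powr p + v r)"
proof -
  note cv = solves_cont[OF v] and nn = solves_nonneg[OF v]
  have mono: "v s \<le> v r" if "0 \<le> s" "s \<le> r" for s
    using T_mono_arg[OF cv nn, of s r 0] solves_eq[OF v, of s] solves_eq[OF v, of r] that r by simp
  have "flux (src v) t \<le> (v r powr p + v r) * flux (\<lambda>s. A s + P s) t" if t: "0 \<le> t" "t \<le> r" for t
  proof -
    have "src v s \<le> (v r powr p + v r) * (A s + P s)" if s: "0 \<le> s" "s \<le> t" for s
    proof -
      have "v s powr p \<le> v r powr p" using mono[of s] nn[of s] s t r p_pos by (intro powr_mono2) auto
      moreover have "0 \<le> v r powr p" by simp
      ultimately have "A s * v s powr p \<le> A s * (v r powr p + v r)" "P s * v s \<le> P s * (v r powr p + v r)"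
        using mono[of s] A_pos[of s] P_nonneg[of s] nn[of r] s t r by (intro mult_left_mono; linarith)+
      then show ?thesis by (simp add: src_def algebra_simps)
    qed
    then have "flux (src v) t \<le> flux (\<lambda>s. (v r powr p + v r) * (A s + P s)) t"
      using t r by (intro flux_mono cont_src cv nn continuous_on_mult continuous_on_const cont_AP) auto
    then show ?thesis by (simp add: flux_cmult)
  qed
  then have "integral {0..r} (flux (src v)) \<le> integral {0..r} (\<lambda>t. (v r powr p + v r) * flux (\<lambda>s. A s + P s) t)"
    using r by (intro integral_le integrable_cont cont_flux_src cv nn continuous_on_mult continuous_on_const
        cont_flux cont_AP) auto
  then show ?thesis using solves_eq[OF v r] by (simp add: T_def growth_def mult.commute)
qed

lemma growth_quadratic:
  assumes "r1 < R"
  obtains C where "0 < C" "\<And>r. 0 \<le> r \<Longrightarrow> r \<le> r1 \<Longrightarrow> growth r \<le> C * r\<^sup>2"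
proof -
  obtain C where C: "0 \<le> C" "\<And>t. 0 \<le> t \<Longrightarrow> t \<le> r1 \<Longrightarrow> \<bar>flux (\<lambda>s. A s + P s) t\<bar> \<le> C * t"
    using flux_linear_bound[OF cont_AP assms] by blast
  show thesis
  proof (rule that[of "C + 1"])
    fix r assume r: "0 \<le> r" "r \<le> r1"
    have "norm (integral {0..r} (flux (\<lambda>s. A s + P s))) \<le> C * r * (r - 0)"
    proof (rule integral_bound)
      fix t assume t: "t \<in> {0..r}"
      have "C * t \<le> C * r" using t C by (intro mult_left_mono) auto
      then show "norm (flux (\<lambda>s. A s + P s) t) \<le> C * r" using C(2)[of t] t r by simp
    qed (use r assms in \<open>auto intro!: cont_Icc[OF cont_flux[OF cont_AP]]\<close>)
    then have "growth r \<le> C * r * r" by (simp add: growth_def)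
    also have "\<dots> \<le> (C + 1) * r\<^sup>2" by (simp add: power2_eq_square algebra_simps)
    finally show "growth r \<le> (C + 1) * r\<^sup>2" .
  qed (use C in auto)
qed

text \<open>Counterpart of \<open>profile_lower_bound\<close> for the supremum M. Two things are
  new: M must first be shown finite, and the contribution of \<open>P\<close> cannot be dropped but
  has to be absorbed.\<close>

lemma profile_upper_bound:
  assumes v: "solves 0 v" and c: "0 < c" "0 < r1" "\<And>r. 0 \<le> r \<Longrightarrow> r \<le> r1 \<Longrightarrow> c * r powr k \<le> v r"
    and e: "0 < e" "e < 1"
  obtains \<rho> where "0 < \<rho>" "\<rho> < R"
    "\<And>r. 0 < r \<Longrightarrow> r \<le> \<rho> \<Longrightarrow> v r / r powr k \<le> ((1 + e) * A 0 * D / (1 - e)) powr (1 / (1 - p))"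
proof -
  note cv = solves_cont[OF v] and nn = solves_nonneg[OF v]
  have v0: "v 0 = 0" using solves_eq[OF v, of 0] R_pos by simp
  obtain r2 where r2: "0 < r2" "r2 < R"
    "\<And>s t. 0 < s \<Longrightarrow> s \<le> t \<Longrightarrow> t \<le> r2 \<Longrightarrow> (1 - e) * A 0 * (s / t) ^ n * W t \<le> W s * A s"
    "\<And>s t. 0 < s \<Longrightarrow> s \<le> t \<Longrightarrow> t \<le> r2 \<Longrightarrow> W s * A s \<le> (1 + e) * A 0 * (s / t) ^ n * W t"
    by (rule kernel_limit[OF e(1)]) (rule that, assumption+)
  obtain CP where CP: "0 < CP" "\<And>s t. 0 < s \<Longrightarrow> s \<le> t \<Longrightarrow> t \<le> r2 \<Longrightarrow> W s * P s \<le> CP * (s / t) ^ n * W t"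
    using kernel_upper[OF r2(2)] by blast
  obtain CG where CG: "0 < CG" "\<And>r. 0 \<le> r \<Longrightarrow> r \<le> r2 \<Longrightarrow> growth r \<le> CG * r\<^sup>2"
    using growth_quadratic[OF r2(2)] by blast
  \<comment> \<open>The square roots encode the two absorptions: CP \<rho>^2 D <= e for the
    potential term and CG \<rho>^2 <= 1/2 for the linear term in the a priori bound.\<close>
  define \<rho> where "\<rho> = Min {r1, r2, sqrt (e / (CP * D)), sqrt (1 / (2 * CG))}"
  have \<rho>: "0 < \<rho>" "\<rho> \<le> r1" "\<rho> \<le> r2" "\<rho> \<le> sqrt (e / (CP * D))" "\<rho> \<le> sqrt (1 / (2 * CG))"
    using r2 c e CP D_pos CG by (auto simp: \<rho>_def)
  have \<rho>R: "\<rho> < R" using \<rho> r2 by simp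
  have "\<rho>\<^sup>2 \<le> (sqrt (e / (CP * D)))\<^sup>2" "\<rho>\<^sup>2 \<le> (sqrt (1 / (2 * CG)))\<^sup>2" using \<rho> by (auto intro!: power_mono)
  then have "\<rho>\<^sup>2 \<le> e / (CP * D)" "\<rho>\<^sup>2 \<le> 1 / (2 * CG)" using e CP CG D_pos by simp_all
  then have \<rho>2: "CP * \<rho>\<^sup>2 * D \<le> e" "CG * \<rho>\<^sup>2 \<le> 1 / 2"
    using CP CG D_pos by (simp_all add: field_simps)
  have vpos: "0 < v r" if "0 < r" "r \<le> \<rho>" for r
  proof -
    have "0 < c * r powr k" using c that by simp
    then show ?thesis using c(3)[of r] that \<rho> by simp
  qed
  have finite: "v r / r powr k \<le> (2 * CG) powr (1 / (1 - p))" if r: "0 < r" "r \<le> \<rho>" for r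
  proof -
    have "r\<^sup>2 \<le> \<rho>\<^sup>2" using r by (intro power_mono) auto
    then have "CG * r\<^sup>2 \<le> CG * \<rho>\<^sup>2" using CG by (intro mult_left_mono) auto
    then have G: "CG * r\<^sup>2 \<le> 1 / 2" using \<rho>2 by simp
    have "v r \<le> growth r * (v r powr p + v r)" using solves_le_growth[OF v, of r] r \<rho>R by simp
    also have "\<dots> \<le> CG * r\<^sup>2 * (v r powr p + v r)"
      using CG(2)[of r] vpos[OF r] r \<rho> by (intro mult_right_mono) auto
    also have "\<dots> \<le> CG * r\<^sup>2 * v r powr p + v r / 2"
      using mult_right_mono[OF G, of "v r"] vpos[OF r] by (simp add: algebra_simps)
    finally have "v r \<le> 2 * CG * r\<^sup>2 * v r powr p" by linarith
    then have "v r \<le> (2 * CG * r\<^sup>2) powr (1 / (1 - p))" by (rule le_powr_mult_self[OF vpos[OF r] p_less])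
    also have "\<dots> = (2 * CG) powr (1 / (1 - p)) * r powr k"
    proof -
      have "r\<^sup>2 = r powr 2" using r by simp
      then have "(r\<^sup>2) powr (1 / (1 - p)) = r powr k" by (simp only: powr_powr k_def) simp
      then show ?thesis using CG by (simp add: powr_mult)
    qed
    finally show ?thesis using r by (simp add: pos_divide_le_eq)
  qed
  define M where "M = (SUP r\<in>{0<..\<rho>}. v r / r powr k)"
  have bdd: "bdd_above ((\<lambda>r. v r / r powr k) ` {0<..\<rho>})" by (rule bdd_aboveI2) (use finite in auto)
  have Mge: "v r / r powr k \<le> M" if "0 < r" "r \<le> \<rho>" for r
    unfolding M_def using cSUP_upper[OF _ bdd, of r] that by simp
  have M0: "0 < M" using Mge[of \<rho>] vpos[of \<rho>] \<rho> by (smt (verit) divide_pos_pos powr_gt_zero)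
  have vM: "v r \<le> M * r powr k" if "0 < r" "r \<le> \<rho>" for r
    using Mge[of r] that by (simp add: pos_divide_le_eq)
  define K where "K = (1 + e) * A 0 * M powr p + CP * \<rho>\<^sup>2 * M"
  have A0: "0 < A 0" using A_pos R_pos by simp
  have "T 0 v r \<le> K * D * r powr k" if r: "0 < r" "r \<le> \<rho>" for r
  proof (rule T_profile_upper[OF cv nn])
    fix s t :: real assume st: "0 < s" "s \<le> t" "t \<le> r"
    have "v s powr p \<le> (M * s powr k) powr p" using vM[of s] nn[of s] st r \<rho>R p_pos by (intro powr_mono2) auto
    then have "v s powr p \<le> M powr p * s powr (k * p)" using M0 by (simp add: powr_mult powr_powr)
    then have 1: "W s * A s * v s powr p \<le> ((1 + e) * A 0 * (s / t) ^ n * W t) * (M powr p * s powr (k * p))"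
      using r2(4)[of s t] st r \<rho> W_nonneg[of t] A0 e by - (rule mult_mono, auto)
    \<comment> \<open>The two spare powers of s are bounded by \<rho>^2, which gives the potential
      term the form of the main term with a small factor.\<close>
    have "s powr k = s powr (k * p + 2)" using kp by simp
    then have "s powr k = s powr (k * p) * s\<^sup>2" using st by (simp add: powr_add)
    also have "\<dots> \<le> s powr (k * p) * \<rho>\<^sup>2" using st r by (intro mult_left_mono power_mono) auto
    finally have "M * s powr k \<le> M * (s powr (k * p) * \<rho>\<^sup>2)" using M0 by simp
    then have "v s \<le> M * (s powr (k * p) * \<rho>\<^sup>2)" using vM[of s] st r by simp
    then have 2: "W s * P s * v s \<le> (CP * (s / t) ^ n * W t) * (M * (s powr (k * p) * \<rho>\<^sup>2))"
      using CP(2)[of s t] CP(1) st r \<rho> \<rho>R W_nonneg[of t] nn[of s] by - (rule mult_mono, auto)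
    show "W s * src v s \<le> K * (s / t) ^ n * s powr (k * p) * W t"
      using add_mono[OF 1 2] by (simp add: K_def src_def algebra_simps)
  qed (use r \<rho>R v0 in auto)
  then have Tr: "v r / r powr k \<le> K * D" if "0 < r" "r \<le> \<rho>" for r
    using solves_eq[OF v, of r] that \<rho>R by (simp add: pos_divide_le_eq)
  have "M \<le> K * D" unfolding M_def using Tr \<rho> by (intro cSUP_least) auto
  \<comment> \<open>The potential contributes at most e M; moved to the left-hand side it produces
    the denominator 1 - e.\<close>
  also have "\<dots> \<le> (1 + e) * A 0 * D * M powr p + e * M"
    using mult_right_mono[OF \<rho>2(1), of M] M0 by (simp add: K_def algebra_simps)
  finally have "(1 - e) * M \<le> (1 + e) * A 0 * D * M powr p" by (simp add: algebra_simps)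
  then have "M \<le> (1 + e) * A 0 * D / (1 - e) * M powr p"
    using e by (simp add: pos_le_divide_eq mult.commute)
  then have le: "M \<le> ((1 + e) * A 0 * D / (1 - e)) powr (1 / (1 - p))" by (rule le_powr_mult_self[OF M0 p_less])
  show thesis by (rule that[OF \<rho>(1) \<rho>R]) (use Mge le in \<open>auto intro: order_trans\<close>)
qed

text \<open>The two bounds hold for every e in (0, 1), each on its own neighbourhood of 0, and their
  constants tend to the same limit as e tends to 0.\<close>

lemma profile_limit:
  assumes v: "solves 0 v" and c: "0 < c" "0 < r1" "\<And>r. 0 \<le> r \<Longrightarrow> r \<le> r1 \<Longrightarrow> c * r powr k \<le> v r"
  shows "((\<lambda>r. v r / r powr k) \<longlongrightarrow> (A 0 * D) powr (1 / (1 - p))) (at_right 0)"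
proof (rule order_tendstoI)
  have AD: "0 < A 0 * D" using A_pos[of 0] R_pos D_pos by simp
  have small: "eventually (\<lambda>e::real. e < 1 \<and> 0 < e) (at_right 0)"
    by (auto simp: eventually_at_right_field intro!: exI[of _ 1])
  {
    fix a assume a: "a < (A 0 * D) powr (1 / (1 - p))"
    have "((\<lambda>e. ((1 - e) * A 0 * D) powr (1 / (1 - p))) \<longlongrightarrow> ((1 - 0) * A 0 * D) powr (1 / (1 - p))) (at_right 0)"
      using AD by (intro tendsto_intros tendsto_powr) auto
    then have "eventually (\<lambda>e. a < ((1 - e) * A 0 * D) powr (1 / (1 - p))) (at_right 0)"
      using a by (intro order_tendstoD(1)) auto
    with small have "eventually (\<lambda>e. a < ((1 - e) * A 0 * D) powr (1 / (1 - p)) \<and> e < 1 \<and> 0 < e) (at_right 0)"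
      by eventually_elim auto
    then obtain e where e: "a < ((1 - e) * A 0 * D) powr (1 / (1 - p))" "0 < e" "e < 1"
      using eventually_happens'[OF trivial_limit_at_right_real] by blast
    obtain \<rho> where "0 < \<rho>" "\<rho> < R"
      "\<And>r. 0 < r \<Longrightarrow> r \<le> \<rho> \<Longrightarrow> ((1 - e) * A 0 * D) powr (1 / (1 - p)) \<le> v r / r powr k"
      using profile_lower_bound[OF v c e(2,3)] by blast
    then show "eventually (\<lambda>r. a < v r / r powr k) (at_right 0)"
      using e(1) unfolding eventually_at_right_field by (intro exI[of _ \<rho>]) force
  }
  {
    fix a assume a: "(A 0 * D) powr (1 / (1 - p)) < a"
    have "((\<lambda>e. ((1 + e) * A 0 * D / (1 - e)) powr (1 / (1 - p))) \<longlongrightarrow> ((1 + 0) * A 0 * D / (1 - 0)) powr (1 / (1 - p))) (at_right 0)"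
      using AD by (intro tendsto_intros tendsto_powr) auto
    then have "eventually (\<lambda>e. ((1 + e) * A 0 * D / (1 - e)) powr (1 / (1 - p)) < a) (at_right 0)"
      using a by (intro order_tendstoD(2)) auto
    with small have "eventually (\<lambda>e. ((1 + e) * A 0 * D / (1 - e)) powr (1 / (1 - p)) < a \<and> e < 1 \<and> 0 < e) (at_right 0)"
      by eventually_elim auto
    then obtain e where e: "((1 + e) * A 0 * D / (1 - e)) powr (1 / (1 - p)) < a" "0 < e" "e < 1"
      using eventually_happens'[OF trivial_limit_at_right_real] by blast
    obtain \<rho> where "0 < \<rho>" "\<rho> < R"
      "\<And>r. 0 < r \<Longrightarrow> r \<le> \<rho> \<Longrightarrow> v r / r powr k \<le> ((1 + e) * A 0 * D / (1 - e)) powr (1 / (1 - p))"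
      using profile_upper_bound[OF v c e(2,3)] by blast
    then show "eventually (\<lambda>r. v r / r powr k < a) (at_right 0)"
      using e(1) unfolding eventually_at_right_field by (intro exI[of _ \<rho>]) force
  }
qed

end


section \<open>Radial functions\<close>

lemma partial_deriv_line:
  assumes "(F has_derivative F') (at x)"
  shows "((\<lambda>t. F (x + t *\<^sub>R b)) has_real_derivative F' b) (at 0)"
proof -
  have "((\<lambda>t::real. x + t *\<^sub>R b) has_derivative (\<lambda>t. 0 + t *\<^sub>R b)) (at 0)"
    by (intro has_derivative_add has_derivative_const has_derivative_scaleR_left has_derivative_ident)
  moreover have "(F has_derivative F') (at (x + 0 *\<^sub>R b))" using assms by simp
  ultimately have "((\<lambda>t. F (x + t *\<^sub>R b)) has_derivative (\<lambda>t. F' (0 + t *\<^sub>R b))) (at 0)"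
    by (rule has_derivative_compose)
  moreover have "F' (0 + t *\<^sub>R b) = F' b * t" for t
    using linear_simps(5)[OF has_derivative_bounded_linear[OF assms], of t b] by simp
  ultimately show ?thesis by (simp add: has_field_derivative_def)
qed

lemma partial_deriv_eq: "(F has_derivative F') (at x) \<Longrightarrow> partial_deriv b F x = F' b"
  unfolding partial_deriv_def by (intro DERIV_imp_deriv partial_deriv_line)

lemma DERIV_transfer_ev:
  fixes f g :: "real \<Rightarrow> real"
  assumes "eventually (\<lambda>x. g x = f x) (nhds x)" "(f has_real_derivative D) (at x)"
  shows "(g has_real_derivative D) (at x)"
  using DERIV_cong_ev[OF refl assms(1) refl] assms(2) by blast

lemma lim_norm_at_right: "filterlim norm (at_right 0) (at (0::'a::real_normed_vector))"
proof -
  have "(norm \<longlongrightarrow> 0) (at (0::'a))" by (rule tendsto_norm_zero[OF tendsto_ident_at])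
  then show ?thesis unfolding filterlim_at by (simp add: eventually_at_filter)
qed

text \<open>The integrated form of (r^n f')' = r^n k, with no constant of integration, encodes the
  equation together with f'(0) = 0. In dimension n + 1 the function \<open>k\<close> becomes the
  Laplacian.\<close>

locale radial_fun =
  fixes R :: real and n :: nat and f k :: "real \<Rightarrow> real"
  assumes R_pos: "0 < R" and cont_k: "continuous_on {0..<R} k" and cont_f: "continuous_on {0..<R} f"
    and deriv_f: "\<And>r. 0 < r \<Longrightarrow> r < R \<Longrightarrow>
      (f has_real_derivative integral {0..r} (\<lambda>s. s ^ n * k s) / r ^ n) (at r)"
begin

text \<open>
  \<open>q\<close> is \<open>f'(r) / r\<close>, continuously extended to \<open>0\<close>, so that \<open>q(|x|) x\<close> is the gradient of \<open>f(|x|)\<close>;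
  \<open>e\<close> is \<open>r q'(r)\<close>.
\<close>

definition q :: "real \<Rightarrow> real" where
  "q r = (if r = 0 then k 0 / (n + 1) else integral {0..r} (\<lambda>s. s ^ n * k s) / r ^ (n + 1))"

definition e :: "real \<Rightarrow> real" where "e r = k r - (n + 1) * q r"

lemma integral_deriv: "0 < r \<Longrightarrow> r < R \<Longrightarrow>
    ((\<lambda>r. integral {0..r} (\<lambda>s. s ^ n * k s)) has_real_derivative r ^ n * k r) (at r)"
  by (intro integral_real_deriv[of R "\<lambda>s. s ^ n * k s"] continuous_intros cont_k)

lemma small_right: "eventually (\<lambda>r. 0 < r \<and> r < R) (at_right (0::real))"
  using R_pos by (auto simp: eventually_at_right_field)

lemma cont_right_0: "continuous_on {0..<R} h \<Longrightarrow> (h \<longlongrightarrow> h 0) (at_right 0)" for h :: "real \<Rightarrow> real"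
proof -
  assume "continuous_on {0..<R} h"
  then have "(h \<longlongrightarrow> h 0) (at 0 within {0..<R})" using R_pos by (simp add: continuous_on_def)
  moreover have "at 0 within {0..<R} = at_right (0::real)"
    by (rule at_within_nhd[of _ "{..<R}"]) (use R_pos in auto)
  ultimately show ?thesis by simp
qed

lemma q_right: "(q \<longlongrightarrow> q 0) (at_right 0)"
proof -
  let ?I = "\<lambda>r. integral {0..r} (\<lambda>s. s ^ n * k s)"
  have "continuous_on {0..R/2} ?I"
    using R_pos by (intro indefinite_integral_continuous_1 integrable_continuous_interval continuous_intros
       continuous_on_subset[OF cont_k]) auto
  then have "(?I \<longlongrightarrow> ?I 0) (at 0 within {0..R/2})"
    using R_pos unfolding continuous_on_def by (elim bspec) simp
  then have I0: "(?I \<longlongrightarrow> 0) (at_right 0)" using R_pos by (simp add: at_within_Icc_at_right)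
  have "((\<lambda>r. ?I r / r ^ (n + 1)) \<longlongrightarrow> k 0 / (n + 1)) (at_right 0)"
  proof (rule lhopital_right_0[where f' = "\<lambda>r. r ^ n * k r" and g' = "\<lambda>r. real (n + 1) * r ^ n"])
    show "(?I \<longlongrightarrow> 0) (at_right 0)" by (rule I0)
    show "((\<lambda>r::real. r ^ (n + 1)) \<longlongrightarrow> 0) (at_right 0)" by (auto intro!: tendsto_eq_intros)
    show "eventually (\<lambda>r::real. r ^ (n + 1) \<noteq> 0) (at_right 0)"
      using small_right by eventually_elim auto
    show "eventually (\<lambda>r::real. real (n + 1) * r ^ n \<noteq> 0) (at_right 0)"
      using small_right by eventually_elim auto
    show "eventually (\<lambda>r. (?I has_real_derivative r ^ n * k r) (at r)) (at_right 0)"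
      using small_right by eventually_elim (auto intro: integral_deriv)
    show "eventually (\<lambda>r::real. ((\<lambda>r. r ^ (n + 1)) has_real_derivative real (n + 1) * r ^ n) (at r)) (at_right 0)"
      using DERIV_pow[of "n + 1"] by (intro always_eventually allI) simp
    have "((\<lambda>r. k r / (n + 1)) \<longlongrightarrow> k 0 / (n + 1)) (at_right 0)"
      by (intro tendsto_intros cont_right_0[OF cont_k]) auto
    moreover have "eventually (\<lambda>r::real. k r / real (n + 1) = r ^ n * k r / (real (n + 1) * r ^ n)) (at_right 0)"
      using small_right by eventually_elim auto
    ultimately show "((\<lambda>r::real. r ^ n * k r / (real (n + 1) * r ^ n)) \<longlongrightarrow> k 0 / (n + 1)) (at_right 0)"
      by (rule Lim_transform_eventually)
  qed
  moreover have "eventually (\<lambda>r. ?I r / r ^ (n + 1) = q r) (at_right 0)"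
    using small_right by eventually_elim (simp add: q_def)
  ultimately have "(q \<longlongrightarrow> k 0 / (n + 1)) (at_right 0)" by (rule Lim_transform_eventually)
  then show ?thesis by (simp add: q_def)
qed

lemma q_deriv:
  assumes "0 < r" "r < R"
  shows "(q has_real_derivative e r / r) (at r)"
proof -
  let ?I = "\<lambda>r. integral {0..r} (\<lambda>s. s ^ n * k s)"
  have "((\<lambda>r. r ^ (n + 1)) has_real_derivative real (n + 1) * r ^ n) (at r)"
    using DERIV_pow[of "n + 1" r] by simp
  from DERIV_divide[OF integral_deriv[OF assms] this]
  have "((\<lambda>r. ?I r / r ^ (n + 1)) has_real_derivative
      (r ^ n * k r * r ^ (n + 1) - ?I r * ((n + 1) * r ^ n)) / (r ^ (n + 1) * r ^ (n + 1))) (at r)"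
    using assms by simp
  moreover have "(X * K * (X * r) - I * (N * X)) / (X * r * (X * r)) = (K - N * (I / (X * r))) / r"
    if "X \<noteq> 0" for X K I N :: real
    using that assms by (simp add: field_simps)
  from this[of "r ^ n" "k r" "?I r" "n + 1"]
  have "(r ^ n * k r * r ^ (n + 1) - ?I r * ((n + 1) * r ^ n)) / (r ^ (n + 1) * r ^ (n + 1)) = e r / r"
    using assms by (simp add: e_def q_def mult.commute)
  ultimately have "((\<lambda>r. ?I r / r ^ (n + 1)) has_real_derivative e r / r) (at r)" by simp
  moreover have "eventually (\<lambda>r. r \<in> {0<..}) (nhds r)"
    using assms by (intro eventually_nhds_in_open) auto
  then have "eventually (\<lambda>r. q r = integral {0..r} (\<lambda>s. s ^ n * k s) / r ^ (n + 1)) (nhds r)"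
    by eventually_elim (simp add: q_def)
  ultimately show ?thesis by (rule DERIV_transfer_ev[rotated])
qed

text \<open>The value of \<open>q 0\<close> is chosen so that k 0 - (n + 1) q 0 = 0. As a result the
  direction-dependent part of the Hessian disappears at the origin.\<close>

lemma e_right: "(e \<longlongrightarrow> 0) (at_right 0)"
proof -
  have "(e \<longlongrightarrow> k 0 - (n + 1) * q 0) (at_right 0)"
    unfolding e_def by (intro tendsto_intros q_right cont_right_0[OF cont_k])
  then show ?thesis by (simp add: q_def)
qed

lemma deriv_f': "0 < r \<Longrightarrow> r < R \<Longrightarrow> (f has_real_derivative r * q r) (at r)"
  using deriv_f[of r] by (simp add: q_def)

lemma f_right: "((\<lambda>r. (f r - f 0) / r) \<longlongrightarrow> 0) (at_right 0)"
proof (rule lhopital_right_0[where f' = "\<lambda>r. r * q r" and g' = "\<lambda>r. 1"])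
  show "((\<lambda>r. f r - f 0) \<longlongrightarrow> 0) (at_right 0)"
    using cont_right_0[OF cont_f] by (auto intro!: tendsto_eq_intros)
  show "eventually (\<lambda>r. ((\<lambda>r. f r - f 0) has_real_derivative r * q r) (at r)) (at_right 0)"
    using small_right by eventually_elim (auto intro!: derivative_eq_intros deriv_f')
  show "((\<lambda>r. r * q r / 1) \<longlongrightarrow> 0) (at_right 0)"
    by (auto intro!: tendsto_eq_intros q_right)
  show "eventually (\<lambda>r::real. r \<noteq> 0) (at_right 0)"
    using small_right by eventually_elim auto
qed (auto intro!: always_eventually derivative_eq_intros)

lemma q_lim: "((\<lambda>y::'a::real_normed_vector. q (norm y)) \<longlongrightarrow> q 0) (at 0)"
  by (rule filterlim_compose[OF q_right lim_norm_at_right])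

lemma e_lim: "((\<lambda>y::'a::real_normed_vector. e (norm y)) \<longlongrightarrow> 0) (at 0)"
  by (rule filterlim_compose[OF e_right lim_norm_at_right])

lemma radial_has_derivative:
  fixes x :: "'a::euclidean_space"
  assumes "norm x < R"
  shows "((\<lambda>x. f (norm x)) has_derivative (\<lambda>h. q (norm x) * (x \<bullet> h))) (at x)"
proof (cases "x = 0")
  case True
  have "((\<lambda>y::'a. (f (norm y) - f 0) / norm y) \<longlongrightarrow> 0) (at 0)"
    by (rule filterlim_compose[OF f_right lim_norm_at_right])
  then have "((\<lambda>y::'a. norm (f (norm y) - f 0) / norm y) \<longlongrightarrow> 0) (at 0)"
    using tendsto_norm_zero by fastforce
  then show ?thesis by (simp add: True has_derivative_at)
next
  case False
  have "((\<lambda>x. f (norm x)) has_derivative (\<lambda>h. (norm x * q (norm x)) * (h \<bullet> sgn x))) (at x)"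
    by (rule has_derivative_compose[OF has_derivative_norm[OF False], of f "(*) (norm x * q (norm x))"])
       (use deriv_f'[of "norm x"] False assms in \<open>simp add: has_field_derivative_def\<close>)
  then show ?thesis
    by (rule has_derivative_eq_rhs) (use False in \<open>auto simp: fun_eq_iff sgn_div_norm inner_commute\<close>)
qed

text \<open>The Hessian of f(|x|) is q I + (e / |x|^2) x x^T. At x = 0 the second term is 0, which
  is correct because q(|y|) y differs from q(0) y by o(|y|).\<close>

lemma radial_partial_has_derivative:
  fixes x b :: "'a::euclidean_space"
  assumes "norm x < R"
  shows "((\<lambda>x. q (norm x) * (x \<bullet> b)) has_derivative
     (\<lambda>h. q (norm x) * (h \<bullet> b) + (x \<bullet> b) * (x \<bullet> h) * (e (norm x) / (norm x)\<^sup>2))) (at x)"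
proof (cases "x = 0")
  case True
  have "((\<lambda>y::'a. (q (norm y) - q 0) * norm b) \<longlongrightarrow> 0) (at 0)"
    using q_lim[where 'a = 'a] by (auto intro!: tendsto_eq_intros)
  then have "((\<lambda>y::'a. norm ((q (norm y) - q 0) * norm b)) \<longlongrightarrow> 0) (at 0)"
    by (rule tendsto_norm_zero)
  then have "((\<lambda>y::'a. norm (q (norm y) * (y \<bullet> b) - q 0 * (y \<bullet> b)) / norm y) \<longlongrightarrow> 0) (at 0)"
  proof (rule Lim_null_comparison[rotated])
    have "norm (norm (q (norm y) * (y \<bullet> b) - q 0 * (y \<bullet> b)) / norm y) \<le> norm ((q (norm y) - q 0) * norm b)" for y
    proof -
      have "norm (q (norm y) * (y \<bullet> b) - q 0 * (y \<bullet> b)) = \<bar>q (norm y) - q 0\<bar> * \<bar>y \<bullet> b\<bar>"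
        by (simp add: left_diff_distrib[symmetric] abs_mult)
      also have "\<dots> \<le> \<bar>q (norm y) - q 0\<bar> * (norm y * norm b)"
        by (intro mult_left_mono Cauchy_Schwarz_ineq2) auto
      finally have "norm (q (norm y) * (y \<bullet> b) - q 0 * (y \<bullet> b)) \<le> norm ((q (norm y) - q 0) * norm b) * norm y"
        by (simp add: abs_mult mult_ac)
      then show ?thesis by (cases "y = 0") (auto simp: pos_divide_le_eq)
    qed
    then show "eventually (\<lambda>y::'a. norm (norm (q (norm y) * (y \<bullet> b) - q 0 * (y \<bullet> b)) / norm y)
        \<le> norm ((q (norm y) - q 0) * norm b)) (at 0)" by simp
  qed
  then show ?thesis
    by (simp add: True has_derivative_at bounded_linear_mult_right bounded_linear_inner_left
        bounded_linear_compose[OF bounded_linear_mult_right bounded_linear_inner_left])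
next
  case False
  have "((\<lambda>x. q (norm x)) has_derivative (\<lambda>h. (e (norm x) / norm x) * (h \<bullet> sgn x))) (at x)"
    by (rule has_derivative_compose[OF has_derivative_norm[OF False], of q "(*) (e (norm x) / norm x)"])
       (use q_deriv[of "norm x"] False assms in \<open>simp add: has_field_derivative_def\<close>)
  then have "((\<lambda>x. q (norm x) * (x \<bullet> b)) has_derivative
     (\<lambda>h. q (norm x) * (h \<bullet> b) + (e (norm x) / norm x) * (h \<bullet> sgn x) * (x \<bullet> b))) (at x)"
    by (rule has_derivative_mult[where g' = "\<lambda>h. h \<bullet> b"]) (auto intro!: derivative_eq_intros)
  then show ?thesis
    by (rule has_derivative_eq_rhs)
       (use False in \<open>auto simp: fun_eq_iff sgn_div_norm inner_commute power2_eq_square field_simps\<close>)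
qed

context
  fixes F :: "'a::euclidean_space \<Rightarrow> real"
  defines "F \<equiv> \<lambda>x. f (norm x)"
begin

lemma partial_radial: "norm x < R \<Longrightarrow> partial_deriv b F x = q (norm x) * (x \<bullet> b)"
  unfolding F_def by (rule partial_deriv_eq[OF radial_has_derivative])

lemma partial_radial_has_derivative:
  assumes "norm x < R"
  shows "(partial_deriv b F has_derivative
     (\<lambda>h. q (norm x) * (h \<bullet> b) + (x \<bullet> b) * (x \<bullet> h) * (e (norm x) / (norm x)\<^sup>2))) (at x)"
  by (rule has_derivative_transform_within_open[OF radial_partial_has_derivative[OF assms], of "ball 0 R"])
     (use assms partial_radial in auto)

lemma second_partial_radial:
  "norm x < R \<Longrightarrow> partial_deriv c (partial_deriv b F) x =
     q (norm x) * (c \<bullet> b) + (x \<bullet> b) * (x \<bullet> c) * (e (norm x) / (norm x)\<^sup>2)"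
  by (rule partial_deriv_eq[OF partial_radial_has_derivative])

text \<open>The angular factor is bounded by Cauchy-Schwarz and e tends to 0, so the product is
  continuous at the origin although the angular factor alone need not be.\<close>

lemma e_term_continuous:
  assumes "norm x < R"
  shows "isCont (\<lambda>x::'a. (x \<bullet> b) * (x \<bullet> c) * (e (norm x) / (norm x)\<^sup>2)) x"
proof (cases "x = 0")
  case True
  have "((\<lambda>y::'a. norm (e (norm y)) * (norm b * norm c)) \<longlongrightarrow> 0) (at 0)"
    using e_lim[where 'a = 'a]
    by (intro tendsto_mult_left_zero tendsto_norm_zero)
  then have "((\<lambda>y::'a. (y \<bullet> b) * (y \<bullet> c) * (e (norm y) / (norm y)\<^sup>2)) \<longlongrightarrow> 0) (at 0)"
  proof (rule Lim_null_comparison[rotated])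
    have "norm ((y \<bullet> b) * (y \<bullet> c) * (e (norm y) / (norm y)\<^sup>2)) \<le> norm (e (norm y)) * (norm b * norm c)" for y :: 'a
    proof (cases "y = 0")
      case False
      have "\<bar>y \<bullet> b\<bar> * \<bar>y \<bullet> c\<bar> \<le> (norm y * norm b) * (norm y * norm c)"
        by (intro mult_mono Cauchy_Schwarz_ineq2) auto
      then have "\<bar>y \<bullet> b\<bar> * \<bar>y \<bullet> c\<bar> * (\<bar>e (norm y)\<bar> / (norm y)\<^sup>2) \<le>
          (norm y * norm b) * (norm y * norm c) * (\<bar>e (norm y)\<bar> / (norm y)\<^sup>2)"
        by (rule mult_right_mono) auto
      also have "\<dots> = norm (e (norm y)) * (norm b * norm c)"
        using False by (simp add: power2_eq_square)
      finally show ?thesis by (simp add: abs_mult)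
    qed simp
    then show "eventually (\<lambda>y::'a. norm ((y \<bullet> b) * (y \<bullet> c) * (e (norm y) / (norm y)\<^sup>2)) \<le>
       norm (e (norm y)) * (norm b * norm c)) (at 0)" by simp
  qed
  then show ?thesis by (simp add: True isCont_def)
next
  case False
  then have r: "0 < norm x" "norm x < R" using assms by auto
  have "isCont k (norm x)"
    by (rule continuous_on_interior[OF cont_k]) (use r in \<open>simp add: interior_atLeastLessThan\<close>)
  then have "isCont e (norm x)"
    unfolding e_def[abs_def] using DERIV_isCont[OF q_deriv[OF r]] by (intro continuous_intros)
  then have "isCont (\<lambda>x. e (norm x)) x"
    by (intro isCont_o2[of _ norm e] continuous_intros)
  then show ?thesis using False by (intro continuous_intros) auto
qed

lemma q_term_continuous:
  assumes "norm x < R"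
  shows "isCont (\<lambda>x::'a. q (norm x)) x"
proof (cases "x = 0")
  case True
  then show ?thesis using q_lim[where 'a = 'a]
    by (simp add: isCont_def)
next
  case False
  then have r: "0 < norm x" "norm x < R" using assms by auto
  show ?thesis by (intro isCont_o2[of _ norm q] continuous_intros DERIV_isCont[OF q_deriv[OF r]])
qed

lemma C2_on_radial: "C2_on (ball 0 R) F"
proof -
  have "continuous_on (ball 0 R) (partial_deriv b F)" for b
    by (intro continuous_at_imp_continuous_on ballI)
       (auto intro!: has_derivative_continuous[OF partial_radial_has_derivative])
  moreover have "continuous_on (ball 0 R) (partial_deriv c (partial_deriv b F))" for b c
  proof -
    have "continuous_on (ball 0 R) (\<lambda>x. q (norm x) * (c \<bullet> b) + (x \<bullet> b) * (x \<bullet> c) * (e (norm x) / (norm x)\<^sup>2))"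
      by (intro continuous_at_imp_continuous_on ballI continuous_add continuous_mult
          q_term_continuous e_term_continuous continuous_const) auto
    then show ?thesis by (rule continuous_on_eq) (simp add: second_partial_radial)
  qed
  moreover have "F differentiable (at x)" if "norm x < R" for x
    unfolding F_def differentiable_def using radial_has_derivative[OF that] by blast
  moreover have "partial_deriv b F differentiable (at x)" if "norm x < R" for x b
    unfolding differentiable_def using partial_radial_has_derivative[OF that] by blast
  ultimately show ?thesis by (auto simp: C2_on_def C1_on_def)
qed

text \<open>Trace of the Hessian: (n + 1) q + e = k by the definition of \<open>e\<close>. At the
  origin only the first term is left, and the value of \<open>q 0\<close> makes it k 0.\<close>

lemma laplacian_radial:
  assumes x: "norm x < R" and dim: "DIM('a) = Suc n"
  shows "laplacian F x = k (norm x)"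
proof -
  have "laplacian F x = (\<Sum>b\<in>Basis. q (norm x) + (x \<bullet> b)\<^sup>2 * (e (norm x) / (norm x)\<^sup>2))"
    unfolding laplacian_def by (intro sum.cong) (auto simp: second_partial_radial[OF x] power2_eq_square)
  also have "\<dots> = (n + 1) * q (norm x) + (norm x)\<^sup>2 * (e (norm x) / (norm x)\<^sup>2)"
  proof -
    have "(norm x)\<^sup>2 = (\<Sum>b\<in>Basis. (x \<bullet> b)\<^sup>2)"
      unfolding power2_norm_eq_inner by (subst euclidean_inner) (simp add: power2_eq_square)
    moreover have "(\<Sum>b\<in>Basis. q (norm x) + (x \<bullet> b)\<^sup>2 * E) = (n + 1) * q (norm x) + (\<Sum>b\<in>Basis. (x \<bullet> b)\<^sup>2) * E" for E
      by (simp add: sum.distrib sum_distrib_right dim)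
    ultimately show ?thesis by (simp only:)
  qed
  also have "\<dots> = k (norm x)"
  proof (cases "x = 0")
    case True
    then show ?thesis by (simp add: q_def field_simps)
  next
    case False
    then show ?thesis by (simp add: e_def)
  qed
  finally show ?thesis .
qed

end
end

lemma differentiable_along_line:
  assumes "F differentiable (at (r *\<^sub>R b))"
  shows "((\<lambda>r. F (r *\<^sub>R b)) has_real_derivative partial_deriv b F (r *\<^sub>R b)) (at r)"
proof -
  obtain F' where F: "(F has_derivative F') (at (r *\<^sub>R b))" using assms by (auto simp: differentiable_def)
  have "((\<lambda>t. F (r *\<^sub>R b + t *\<^sub>R b)) has_real_derivative F' b) (at 0)" by (rule partial_deriv_line[OF F])
  then have "((\<lambda>t. F ((t + r) *\<^sub>R b)) has_real_derivative F' b) (at 0)"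
    by (simp add: scaleR_add_left add.commute)
  then have "((\<lambda>r. F (r *\<^sub>R b)) has_real_derivative F' b) (at (0 + r))"
    by (subst DERIV_shift)
  then show ?thesis by (simp add: partial_deriv_eq[OF F])
qed

section \<open>Restriction of radial functions to a coordinate axis\<close>

context
  fixes F :: "'a::euclidean_space \<Rightarrow> real" and R :: real and b0 :: 'a
  assumes F: "C2_on (ball 0 R) F" "radial_on (ball 0 R) F" and b0: "b0 \<in> Basis" and R: "0 < R"
begin

lemma norm_b0: "norm (r *\<^sub>R b0) = \<bar>r\<bar>"
  using b0 by simp

lemma radial_deriv1:
  "\<bar>r\<bar> < R \<Longrightarrow> ((\<lambda>r. F (r *\<^sub>R b0)) has_real_derivative partial_deriv b0 F (r *\<^sub>R b0)) (at r)"
  using F b0 by (intro differentiable_along_line) (auto simp: C2_on_def C1_on_def)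

lemma radial_deriv2:
  "\<bar>r\<bar> < R \<Longrightarrow> ((\<lambda>r. partial_deriv b0 F (r *\<^sub>R b0)) has_real_derivative
     partial_deriv b0 (partial_deriv b0 F) (r *\<^sub>R b0)) (at r)"
  using F b0 by (intro differentiable_along_line) (auto simp: C2_on_def C1_on_def)

text \<open>The restriction of a radial function to a line through the origin is even, so its
  derivative at 0 equals its own negative.\<close>

lemma radial_deriv_0: "partial_deriv b0 F 0 = 0"
proof -
  let ?f = "\<lambda>r. F (r *\<^sub>R b0)"
  have d: "(?f has_real_derivative partial_deriv b0 F 0) (at 0)" using radial_deriv1[of 0] R by simp
  then have d': "(?f has_real_derivative partial_deriv b0 F 0) (at (- 0))" by simp
  have "((\<lambda>r. ?f (- r)) has_real_derivative partial_deriv b0 F 0 * (- 1)) (at 0)"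
    by (rule DERIV_chain2[where f = ?f and g = uminus, OF d']) (auto intro!: derivative_eq_intros)
  moreover have "eventually (\<lambda>r. r \<in> {-R<..<R}) (nhds (0::real))"
    using R by (intro eventually_nhds_in_open) auto
  then have "eventually (\<lambda>r. ?f (- r) = ?f r) (nhds 0)"
  proof eventually_elim
    case (elim r)
    then show ?case using F(2) norm_b0[of r] norm_b0[of "- r"] unfolding radial_on_def
      by (metis abs_minus_cancel mem_ball_0 abs_less_iff greaterThanLessThan_iff minus_less_iff)
  qed
  ultimately have "(?f has_real_derivative partial_deriv b0 F 0 * (- 1)) (at 0)"
    using DERIV_transfer_ev[of ?f "\<lambda>r. ?f (- r)" 0] by (simp add: eq_commute)
  from DERIV_unique[OF d this] show ?thesis by simp
qed

text \<open>Along a direction b orthogonal to b0 the function is f(sqrt(r^2 + t^2)), whose second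
  derivative at t = 0 is f'(r) / r. The number of such directions is the dimension minus 1.\<close>

lemma radial_laplacian:
  assumes r: "0 < r" "r < R"
  shows "laplacian F (r *\<^sub>R b0) = partial_deriv b0 (partial_deriv b0 F) (r *\<^sub>R b0)
     + (real DIM('a) - 1) * partial_deriv b0 F (r *\<^sub>R b0) / r"
proof -
  let ?f = "\<lambda>r. F (r *\<^sub>R b0)" and ?g = "\<lambda>r. partial_deriv b0 F (r *\<^sub>R b0)"
  have other: "partial_deriv b (partial_deriv b F) (r *\<^sub>R b0) = ?g r / r" if b: "b \<in> Basis" "b \<noteq> b0" for b
  proof -
    define \<rho> where "\<rho> t = sqrt (r\<^sup>2 + t\<^sup>2)" for t :: real
    have \<rho>0: "\<rho> 0 = r" using r by (simp add: \<rho>_def)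
    have \<rho>pos: "0 < \<rho> t" for t using r by (simp add: \<rho>_def add_pos_nonneg)
    have norm: "norm (r *\<^sub>R b0 + t *\<^sub>R b) = \<rho> t" for t
      using b b0 by (simp add: \<rho>_def norm_eq_sqrt_inner inner_add_left inner_add_right inner_Basis power2_eq_square)
    have d\<rho>: "(\<rho> has_real_derivative t / \<rho> t) (at t)" for t
    proof -
      have "0 < r\<^sup>2 + t\<^sup>2" using r by (simp add: add_pos_nonneg)
      then show ?thesis
        unfolding \<rho>_def by (auto intro!: derivative_eq_intros simp: field_simps)
    qed
    have cont\<rho>: "isCont \<rho> t" for t by (rule DERIV_isCont[OF d\<rho>])
    have open\<rho>: "open {t. \<rho> t < R}"
      unfolding \<rho>_def by (intro open_Collect_less continuous_intros)
    have Feq: "F (r *\<^sub>R b0 + t *\<^sub>R b) = ?f (\<rho> t)" if "\<rho> t < R" for t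
    proof -
      have "norm (\<rho> t *\<^sub>R b0) = \<rho> t" using norm_b0[of "\<rho> t"] \<rho>pos[of t] by simp
      then show ?thesis using F(2) that norm[of t] unfolding radial_on_def by (metis mem_ball_0)
    qed
    have inner: "partial_deriv b F (r *\<^sub>R b0 + t *\<^sub>R b) = ?g (\<rho> t) / \<rho> t * t" if t: "\<rho> t < R" for t
    proof -
      have "(?f has_real_derivative ?g (\<rho> t)) (at (\<rho> t))" using t \<rho>pos[of t] by (intro radial_deriv1) simp
      from DERIV_chain2[OF this d\<rho>]
      have "((\<lambda>t. ?f (\<rho> t)) has_real_derivative ?g (\<rho> t) * (t / \<rho> t)) (at t)" .
      moreover have "eventually (\<lambda>t. t \<in> {t. \<rho> t < R}) (nhds t)"
        using t open\<rho> by (intro eventually_nhds_in_open) auto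
      then have "eventually (\<lambda>t. F (r *\<^sub>R b0 + t *\<^sub>R b) = ?f (\<rho> t)) (nhds t)"
        by eventually_elim (simp add: Feq)
      ultimately have "((\<lambda>t. F (r *\<^sub>R b0 + t *\<^sub>R b)) has_real_derivative ?g (\<rho> t) * (t / \<rho> t)) (at (0 + t))"
        using DERIV_transfer_ev[of "\<lambda>t. F (r *\<^sub>R b0 + t *\<^sub>R b)" "\<lambda>t. ?f (\<rho> t)" t] by simp
      then have "((\<lambda>s. F (r *\<^sub>R b0 + (s + t) *\<^sub>R b)) has_real_derivative ?g (\<rho> t) * (t / \<rho> t)) (at 0)"
        by (subst (asm) DERIV_shift)
      then have "((\<lambda>s. F (r *\<^sub>R b0 + t *\<^sub>R b + s *\<^sub>R b)) has_real_derivative ?g (\<rho> t) * (t / \<rho> t)) (at 0)"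
        by (simp add: scaleR_add_left add_ac)
      then show ?thesis unfolding partial_deriv_def[of b] by (simp add: DERIV_imp_deriv)
    qed
    have "(?g has_real_derivative partial_deriv b0 (partial_deriv b0 F) (r *\<^sub>R b0)) (at (\<rho> 0))"
      using r unfolding \<rho>0 by (intro radial_deriv2) simp
    note d1 = DERIV_chain2[OF this d\<rho>]
    have "\<rho> 0 \<noteq> 0" using \<rho>pos[of 0] by simp
    \<comment> \<open>At t = 0 the product rule leaves only the term in which the factor t is
      differentiated.\<close>
    from DERIV_mult[OF DERIV_divide[OF d1 d\<rho> this] DERIV_ident]
    have "((\<lambda>t. ?g (\<rho> t) / \<rho> t * t) has_real_derivative ?g r / r) (at 0)"
      by (simp add: \<rho>0)
    moreover have "eventually (\<lambda>t. t \<in> {t. \<rho> t < R}) (nhds 0)"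
      using r \<rho>0 open\<rho> by (intro eventually_nhds_in_open) auto
    then have "eventually (\<lambda>t. partial_deriv b F (r *\<^sub>R b0 + t *\<^sub>R b) = ?g (\<rho> t) / \<rho> t * t) (nhds 0)"
      by eventually_elim (simp add: inner)
    ultimately have "((\<lambda>t. partial_deriv b F (r *\<^sub>R b0 + t *\<^sub>R b)) has_real_derivative ?g r / r) (at 0)"
      by (rule DERIV_transfer_ev[rotated])
    then show ?thesis unfolding partial_deriv_def[of b "partial_deriv b F"] by (rule DERIV_imp_deriv)
  qed
  have "laplacian F (r *\<^sub>R b0) = partial_deriv b0 (partial_deriv b0 F) (r *\<^sub>R b0)
      + (\<Sum>b\<in>Basis - {b0}. partial_deriv b (partial_deriv b F) (r *\<^sub>R b0))"
    unfolding laplacian_def using b0 by (simp add: sum.remove)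
  also have "(\<Sum>b\<in>Basis - {b0}. partial_deriv b (partial_deriv b F) (r *\<^sub>R b0)) = (\<Sum>b\<in>Basis - {b0}. ?g r / r)"
    by (intro sum.cong) (auto simp: other)
  also have "\<dots> = (real DIM('a) - 1) * ?g r / r"
    using b0 by (simp add: of_nat_diff)
  finally show ?thesis .
qed

end

section \<open>The comparison function\<close>

text \<open>
  With \<open>x = r / R\<close>, \<open>y = \<phi>' / \<phi> = - b x ^ m / (R - r)\<close> has the singularity of \<open>(\<delta> powr b)' / \<delta> powr b\<close> at \<open>r = R\<close> and
  vanishes at \<open>0\<close>. The exponent \<open>m\<close> is chosen so that \<open>P \<ge> 0\<close>: for \<open>b > 0\<close> one can take \<open>m = 1\<close>,
  for \<open>b < 0\<close> it has to be large.
\<close>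

locale hardy =
  fixes R p b :: real and n m :: nat
  assumes R_pos': "0 < R" and p_pos': "0 < p" and p_less': "p < 1" and b_less: "b < 1/2"
    and m_pos: "1 \<le> m" and b_pos: "0 < b \<Longrightarrow> m = 1" and b_neg: "b < 0 \<Longrightarrow> real n \<le> real m * (- b)"
begin

text \<open>The first m terms of the series of - ln (1 - x). Adding them to ln (1 - x) leaves the
  derivative - x^m / (1 - x): flat at the origin, with the singularity at x = 1 unchanged.\<close>

definition S :: "real \<Rightarrow> real" where "S x = (\<Sum>j<m. x ^ (j + 1) / real (j + 1))"

definition phi :: "real \<Rightarrow> real" where "phi r = exp (b * (ln (1 - r / R) + S (r / R)))"

definition y :: "real \<Rightarrow> real" where "y r = - b * (r / R) ^ m / (R - r)"

definition bracket :: "real \<Rightarrow> real" where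
  "bracket x = real (m + n) * x ^ (m - 1) - (\<Sum>j<m. x ^ j) * (1 - b * (1 + x ^ m))"

definition Pot :: "real \<Rightarrow> real" where "Pot r = b / (R * (R - r)) * bracket (r / R)"

text \<open>The indicial equation of the powers \<delta>^b for u'' + mu u / \<delta>^2 = 0. The root
  b is the parameter, and mu is computed from it.\<close>

definition mu :: real where "mu = b * (1 - b)"

lemma S_deriv: "(S has_real_derivative (\<Sum>j<m. x ^ j)) (at x)"
proof -
  have "((\<lambda>x. x ^ (j + 1) / real (j + 1)) has_real_derivative x ^ j) (at x)" for j
    using DERIV_cdivide[OF DERIV_pow[of "j + 1" x], of "real (j + 1)"] by simp
  then show ?thesis unfolding S_def[abs_def] by (intro DERIV_sum)
qed

lemma geometric: "(1 - x) * (\<Sum>j<m. x ^ j) = 1 - x ^ m" for x :: real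
  by (simp add: one_diff_power_eq)

lemma phi_deriv:
  assumes "r < R" shows "(phi has_real_derivative phi r * y r) (at r)"
proof -
  have pos: "0 < 1 - r / R" using assms R_pos' by simp
  have "((\<lambda>r. S (r / R)) has_real_derivative (\<Sum>j<m. (r / R) ^ j) * (1 / R)) (at r)"
    by (rule DERIV_chain2[OF S_deriv]) (use R_pos' in \<open>auto intro!: derivative_eq_intros\<close>)
  then have "(phi has_real_derivative phi r * (b * (- (1 / R) / (1 - r / R) + (\<Sum>j<m. (r / R) ^ j) * (1 / R)))) (at r)"
    unfolding phi_def[abs_def] using pos R_pos' by (auto intro!: derivative_eq_intros)
  moreover have "- (1 / R) / (1 - r / R) + (\<Sum>j<m. (r / R) ^ j) * (1 / R) = - ((r / R) ^ m / (R - r))"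
  proof -
    have d: "R - r \<noteq> 0" "R \<noteq> 0" using assms R_pos' by auto
    have "(R - r) * (\<Sum>j<m. (r / R) ^ j) = R * (1 - (r / R) ^ m)"
      using geometric[of "r / R"] d by (simp add: field_simps)
    then have s: "(\<Sum>j<m. (r / R) ^ j) = R * (1 - (r / R) ^ m) / (R - r)"
      using d by (simp add: eq_divide_eq mult.commute)
    have e: "1 - r / R = (R - r) / R" using d by (simp add: diff_divide_distrib)
    have 1: "- (1 / R) / ((R - r) / R) = - (1 / (R - r))" using d by simp
    have 2: "R * (1 - (r / R) ^ m) / (R - r) * (1 / R) = 1 / (R - r) - (r / R) ^ m / (R - r)"
      using d by (simp add: diff_divide_distrib[of 1 "(r / R) ^ m"])
    show ?thesis unfolding s e 1 2 by simp
  qed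
  ultimately show ?thesis by (simp add: y_def)
qed

lemma phi_gt_0: "0 < phi r" by (simp add: phi_def)

lemma cont_phi': "continuous_on {0..<R} phi"
  by (intro continuous_at_imp_continuous_on ballI DERIV_isCont[OF phi_deriv]) auto

lemma cont_y: "continuous_on {0..<R} y"
  unfolding y_def[abs_def] using R_pos' by (intro continuous_intros) auto

lemma y_0 [simp]: "y 0 = 0" using m_pos by (simp add: y_def)

lemma cont_Pot: "continuous_on {0..<R} Pot"
  unfolding Pot_def[abs_def] bracket_def using R_pos' by (intro continuous_intros) auto

lemma geometric_ge:
  assumes "0 \<le> x" "x \<le> (1::real)" shows "real m * x ^ (m - 1) \<le> (\<Sum>j<m. x ^ j)"
proof -
  have "(\<Sum>j<m. x ^ (m - 1)) \<le> (\<Sum>j<m. x ^ j)"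
    using assms by (intro sum_mono power_decreasing) auto
  then show ?thesis by simp
qed

text \<open>For b > 0 and m = 1 the bracket is n + b (1 + x). For b < 0 the hypothesis
  \<open>b_neg\<close> reads m + n <= m (1 - b), and the geometric sum is at least m x^(m - 1), so
  the bracket is nonpositive.\<close>

lemma b_bracket_nonneg:
  assumes "0 \<le> x" "x \<le> 1" shows "0 \<le> b * bracket x"
proof (cases "b \<ge> 0")
  case True
  show ?thesis
  proof (cases "b = 0")
    case False
    then have "m = 1" using True b_pos by simp
    then have "bracket x = real n + b * (1 + x)" unfolding bracket_def by simp
    then show ?thesis using True assms by simp
  qed simp
next
  case False
  have "real (m + n) * x ^ (m - 1) \<le> (real m * (1 - b)) * x ^ (m - 1)"
    using b_neg False assms by (intro mult_right_mono) (auto simp: algebra_simps)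
  also have "\<dots> = (real m * x ^ (m - 1)) * (1 - b)" by simp
  also have "\<dots> \<le> (\<Sum>j<m. x ^ j) * (1 - b * (1 + x ^ m))"
  proof (rule mult_mono[OF geometric_ge[OF assms]])
    have "b * x ^ m \<le> 0" using False assms by (intro mult_nonpos_nonneg) auto
    then show "1 - b \<le> 1 - b * (1 + x ^ m)" by (simp add: algebra_simps)
    show "0 \<le> (\<Sum>j<m. x ^ j)" using assms by (intro sum_nonneg) auto
  qed (use False in auto)
  finally have "bracket x \<le> 0" by (simp add: bracket_def)
  then show ?thesis using False by (simp add: mult_nonpos_nonpos)
qed

lemma Pot_nonneg: "0 \<le> r \<Longrightarrow> r < R \<Longrightarrow> 0 \<le> Pot r"
proof -
  assume r: "0 \<le> r" "r < R"
  have "Pot r = (b * bracket (r / R)) / (R * (R - r))" by (simp add: Pot_def)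
  also have "\<dots> \<ge> 0" using r R_pos' by (intro divide_nonneg_nonneg b_bracket_nonneg) auto
  finally show ?thesis .
qed

sublocale radial_volterra R p n phi "\<lambda>r. phi r powr (p - 1)" Pot
  using R_pos' p_pos' p_less' cont_phi' cont_Pot Pot_nonneg phi_gt_0
  by unfold_locales (auto intro!: continuous_intros simp: less_imp_neq[OF phi_gt_0, symmetric])

lemma y_deriv:
  assumes "0 < r" "r < R"
  shows "(y has_real_derivative - b * (real m * (r / R) ^ (m - 1) / (R * (R - r)) + (r / R) ^ m / (R - r)\<^sup>2)) (at r)"
proof -
  have "((\<lambda>r. (r / R) ^ m) has_real_derivative real m * (r / R) ^ (m - 1) * (1 / R)) (at r)"
    using R_pos' by (auto intro!: derivative_eq_intros)
  moreover have "((\<lambda>r. R - r) has_real_derivative - 1) (at r)" by (auto intro!: derivative_eq_intros)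
  ultimately have "((\<lambda>r. (r / R) ^ m / (R - r)) has_real_derivative
     (real m * (r / R) ^ (m - 1) * (1 / R) * (R - r) - (r / R) ^ m * (- 1)) / ((R - r) * (R - r))) (at r)"
    using assms by (intro DERIV_divide) auto
  from DERIV_cmult[OF this, of "- b"]
  have "(y has_real_derivative - b * ((real m * (r / R) ^ (m - 1) * (1 / R) * (R - r) - (r / R) ^ m * (- 1)) / ((R - r) * (R - r)))) (at r)"
    by (simp add: y_def[abs_def])
  moreover have "(real m * (r / R) ^ (m - 1) * (1 / R) * (R - r) - (r / R) ^ m * (- 1)) / ((R - r) * (R - r))
     = real m * (r / R) ^ (m - 1) / (R * (R - r)) + (r / R) ^ m / (R - r)\<^sup>2"
    using assms by (simp add: add_divide_distrib power2_eq_square)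
  ultimately show ?thesis by (simp only:)
qed

text \<open>Since phi'' / phi = y' + y^2, this is L phi = - Pot phi divided by phi; the first
  summand is y' from \<open>y_deriv\<close>.\<close>

lemma riccati:
  assumes "0 < r" "r < R"
  shows "- b * (real m * (r / R) ^ (m - 1) / (R * (R - r)) + (r / R) ^ m / (R - r)\<^sup>2)
    + (y r)\<^sup>2 + real n * y r / r = - Pot r - mu / (R - r)\<^sup>2"
proof -
  define d where "d = R - r"
  define \<rho> where "\<rho> = (r / R) ^ m"
  define X where "X = (r / R) ^ (m - 1)"
  define \<sigma> where "\<sigma> = (\<Sum>j<m. (r / R) ^ j)"
  have pos: "d \<noteq> 0" "R \<noteq> 0" "r \<noteq> 0" using assms by (auto simp: d_def)
  have "\<rho> = r / R * X" unfolding \<rho>_def X_def using m_pos by (simp flip: power_Suc)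
  then have \<rho>r: "\<rho> / r = X / R" using pos by simp
  have "(1 - r / R) * \<sigma> = 1 - \<rho>" unfolding \<sigma>_def \<rho>_def by (rule geometric)
  moreover have "1 - r / R = d / R" using pos by (simp add: d_def field_simps)
  ultimately have \<sigma>: "1 - \<rho> = d * \<sigma> / R" by simp
  have "real n * y r / r = - b * real n * (\<rho> / r) / d" by (simp add: y_def \<rho>_def d_def mult_ac)
  then have ny: "real n * y r / r = - b * real n * X / (R * d)" unfolding \<rho>r by simp
  have y2: "(y r)\<^sup>2 = b\<^sup>2 * \<rho>\<^sup>2 / d\<^sup>2" by (simp add: y_def \<rho>_def d_def power_divide power_mult_distrib)
  \<comment> \<open>The choice mu = b (1 - b) produces the factor 1 - \<rho>, a multiple of d. It
    cancels one power of 1 / d^2 and leaves a simple pole.\<close>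
  have main: "- b * \<rho> + b\<^sup>2 * \<rho>\<^sup>2 + b * (1 - b) = b * (1 - \<rho>) * (1 - b * (1 + \<rho>))"
    by (simp add: algebra_simps power2_eq_square)
  have "- b * \<rho> / d\<^sup>2 + b\<^sup>2 * \<rho>\<^sup>2 / d\<^sup>2 + b * (1 - b) / d\<^sup>2 = b * (1 - \<rho>) * (1 - b * (1 + \<rho>)) / d\<^sup>2"
    unfolding main[symmetric] by (simp only: add_divide_distrib)
  also have "\<dots> = b * \<sigma> * (1 - b * (1 + \<rho>)) / (R * d)"
    unfolding \<sigma> using pos by (simp add: power2_eq_square)
  finally have 1: "- b * \<rho> / d\<^sup>2 + b\<^sup>2 * \<rho>\<^sup>2 / d\<^sup>2 + b * (1 - b) / d\<^sup>2 = b * \<sigma> * (1 - b * (1 + \<rho>)) / (R * d)" .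
  have 2: "Pot r = b * real (m + n) * X / (R * d) - b * \<sigma> * (1 - b * (1 + \<rho>)) / (R * d)"
    by (simp add: Pot_def bracket_def d_def X_def \<rho>_def \<sigma>_def right_diff_distrib diff_divide_distrib mult.assoc)
  have 3: "b * real (m + n) * X / (R * d) = b * (real m * X / (R * d)) + b * real n * X / (R * d)"
    by (simp add: distrib_left distrib_right add_divide_distrib)
  have "- b * (real m * X / (R * d) + \<rho> / d\<^sup>2) + b\<^sup>2 * \<rho>\<^sup>2 / d\<^sup>2 + - b * real n * X / (R * d) = - Pot r - b * (1 - b) / d\<^sup>2"
    using 1 2 3 by (simp add: distrib_left)
  then show ?thesis unfolding y2 ny mu_def unfolding d_def X_def \<rho>_def .
qed

section \<open>Equivalence of the fixed-point equation and the radial equation\<close>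

lemma phi_flux_deriv:
  assumes "0 < r" "r < R"
  shows "((\<lambda>r. r ^ n * (phi r * y r)) has_real_derivative r ^ n * phi r * (- Pot r - mu / (R - r)\<^sup>2)) (at r)"
proof -
  let ?y' = "- b * (real m * (r / R) ^ (m - 1) / (R * (R - r)) + (r / R) ^ m / (R - r)\<^sup>2)"
  have rn: "((\<lambda>r. r ^ n) has_real_derivative real n * r ^ (n - 1)) (at r)" using DERIV_pow[of n r] by simp
  have "((\<lambda>r. r ^ n * (phi r * y r)) has_real_derivative
     real n * r ^ (n - 1) * (phi r * y r) + (phi r * y r * y r + ?y' * phi r) * r ^ n) (at r)"
    by (rule DERIV_mult[OF rn DERIV_mult[OF phi_deriv[OF assms(2)] y_deriv[OF assms]]])
  moreover have "real n * r ^ (n - 1) = r ^ n * (real n / r)"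
    using assms by (cases n) auto
  then have "real n * r ^ (n - 1) * (phi r * y r) + (phi r * y r * y r + ?y' * phi r) * r ^ n
    = r ^ n * phi r * (?y' + (y r)\<^sup>2 + real n * y r / r)"
    by (simp add: distrib_left distrib_right power2_eq_square)
  ultimately show ?thesis unfolding riccati[OF assms] by simp
qed

text \<open>This explains the coefficient \<open>phi powr (p - 1)\<close>: together with one of the
  two factors phi in \<open>W\<close> it turns v powr p into (phi v) powr p.\<close>

lemma src_phi:
  assumes "0 \<le> v r"
  shows "W r * src v r = r ^ n * phi r * ((phi r * v r) powr p + Pot r * (phi r * v r))"
proof -
  have "phi r * phi r powr (p - 1) = phi r powr p"
    using phi_gt_0[of r] by (simp add: powr_diff)
  then have "phi r * (phi r powr (p - 1) * v r powr p) = (phi r * v r) powr p"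
    using assms phi_gt_0[of r] by (simp add: powr_mult mult.assoc[symmetric])
  then have "r ^ n * phi r * (phi r * (phi r powr (p - 1) * v r powr p)) = r ^ n * phi r * (phi r * v r) powr p"
    by simp
  then show ?thesis by (simp add: W_def src_def power2_eq_square distrib_left mult_ac)
qed

text \<open>For u = phi v the auxiliary H is r^n u'. In its derivative the terms with
  \<open>Pot\<close> and those with Z y / phi cancel, which leaves the radial equation for u in
  integrated form.\<close>

lemma solves_radial_fun:
  assumes v: "solves a v"
  shows "radial_fun R n (\<lambda>r. phi r * v r)
    (\<lambda>r. (phi r * v r) powr p - mu / (R - r)\<^sup>2 * (phi r * v r))"
proof
  note cv = solves_cont[OF v] and nn = solves_nonneg[OF v]
  show "0 < R" by (rule R_pos)
  show cu: "continuous_on {0..<R} (\<lambda>r. phi r * v r)" by (intro continuous_on_mult cv cont_phi)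
  show ck: "continuous_on {0..<R} (\<lambda>r. (phi r * v r) powr p - mu / (R - r)\<^sup>2 * (phi r * v r))"
    by (intro continuous_on_diff continuous_on_mult cont_phi cv continuous_on_divide continuous_on_powr'
      continuous_on_power continuous_on_const continuous_on_id)
     (use p_pos nn phi_gt_0 in \<open>auto intro!: mult_nonneg_nonneg less_imp_le[OF phi_gt_0]\<close>)
  fix r assume r: "0 < r" "r < R"
  define Z where "Z t = integral {0..t} (\<lambda>s. W s * src v s)" for t
  have Zd: "(Z has_real_derivative W t * src v t) (at t)" if "0 < t" "t < R" for t
    unfolding Z_def[abs_def] by (rule W_integral_deriv[OF cont_src[OF cv nn] that])
  have vd: "(v has_real_derivative Z t / W t) (at t)" if t: "0 < t" "t < R" for t
  proof -
    have "eventually (\<lambda>s. s \<in> {0<..<R}) (nhds t)" using t by (intro eventually_nhds_in_open) auto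
    then have "eventually (\<lambda>s. v s = T a v s) (nhds t)"
      by eventually_elim (use solves_eq[OF v] in auto)
    then show ?thesis
      using T_deriv[OF cv nn t, of a] unfolding flux_def Z_def[symmetric] by (rule DERIV_transfer_ev)
  qed
  define H where "H t = t ^ n * (phi t * y t) * v t + Z t / phi t" for t
  have Zc: "continuous_on {0..<R} Z"
    unfolding Z_def[abs_def] by (intro integral_cont integrable_W cont_src cv nn)
  have Hc: "continuous_on {0..<R} H"
    unfolding H_def[abs_def]
    by (intro continuous_on_add continuous_on_mult continuous_on_divide continuous_on_power cont_phi cont_y cv Zc
        continuous_on_id) (use phi_gt_0 in \<open>auto simp: less_imp_neq[OF phi_gt_0, symmetric]\<close>)
  \<comment> \<open>When n = 0 the first term vanishes because y 0 = 0.\<close>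
  have H0: "H 0 = 0" by (simp add: H_def Z_def)
  let ?k = "\<lambda>s. (phi s * v s) powr p - mu / (R - s)\<^sup>2 * (phi s * v s)"
  have Hd: "(H has_real_derivative t ^ n * ?k t) (at t)" if t: "0 < t" "t < R" for t
  proof -
    have ph: "phi t \<noteq> 0" using phi_gt_0[of t] by simp
    have "(H has_real_derivative (t ^ n * phi t * (- Pot t - mu / (R - t)\<^sup>2) * v t + Z t / W t * (t ^ n * (phi t * y t)))
        + (W t * src v t * phi t - Z t * (phi t * y t)) / (phi t * phi t)) (at t)"
      unfolding H_def[abs_def]
      by (intro DERIV_add DERIV_mult DERIV_divide phi_flux_deriv[OF t] vd[OF t] Zd[OF t] phi_deriv[OF t(2)] ph)
    moreover have "Z t / W t * (t ^ n * (phi t * y t)) = Z t * y t / phi t"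
      using t ph by (simp add: W_def power2_eq_square)
    moreover have "(W t * src v t * phi t - Z t * (phi t * y t)) / (phi t * phi t)
        = W t * src v t / phi t - Z t * y t / phi t"
      using ph by (simp add: diff_divide_distrib)
    moreover have "W t * src v t / phi t = t ^ n * ((phi t * v t) powr p + Pot t * (phi t * v t))"
      using ph nn[of t] t by (simp add: src_phi)
    ultimately have "(H has_real_derivative t ^ n * phi t * (- Pot t - mu / (R - t)\<^sup>2) * v t +
       t ^ n * ((phi t * v t) powr p + Pot t * (phi t * v t))) (at t)" by simp
    then show ?thesis by (simp add: algebra_simps)
  qed
  have "((\<lambda>s. s ^ n * ?k s) has_integral H r - H 0) {0..r}"
    using r Hd by (intro fundamental_theorem_of_calculus_interior cont_Icc[OF Hc])
      (auto simp: has_real_derivative_iff_has_vector_derivative[symmetric])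
  then have I: "integral {0..r} (\<lambda>s. s ^ n * ?k s) = H r" by (simp add: integral_unique H0)
  have "((\<lambda>r. phi r * v r) has_real_derivative phi r * y r * v r + Z r / W r * phi r) (at r)"
    by (rule DERIV_mult[OF phi_deriv[OF r(2)] vd[OF r]])
  moreover have "phi r * y r * v r + Z r / W r * phi r = H r / r ^ n"
    using r phi_gt_0[of r] by (simp add: H_def W_def power2_eq_square add_divide_distrib)
  ultimately show "((\<lambda>r. phi r * v r) has_real_derivative integral {0..r} (\<lambda>s. s ^ n * ?k s) / r ^ n) (at r)"
    by (simp only: I)
qed

lemma solves_radial_solution:
  assumes v: "solves a v" and dim: "DIM('a::euclidean_space) = Suc n"
  shows "radial_solution mu p R (\<lambda>x::'a. phi (norm x) * v (norm x))"
proof -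
  interpret rf: radial_fun R n "\<lambda>r. phi r * v r" "\<lambda>r. (phi r * v r) powr p - mu / (R - r)\<^sup>2 * (phi r * v r)"
    by (rule solves_radial_fun[OF v])
  have "C2_on (ball 0 R) (\<lambda>x::'a. phi (norm x) * v (norm x))"
    by (rule rf.C2_on_radial)
  moreover have "0 \<le> phi (norm x) * v (norm x)" if "norm x < R" for x :: 'a
    using solves_nonneg[OF v, of "norm x"] phi_gt_0[of "norm x"] that by simp
  moreover have "laplacian (\<lambda>x::'a. phi (norm x) * v (norm x)) x
      = (phi (norm x) * v (norm x)) powr p - mu / (R - norm x)\<^sup>2 * (phi (norm x) * v (norm x))"
    if "norm x < R" for x :: 'a
    by (rule rf.laplacian_radial[OF that dim])
  ultimately show ?thesis
    by (auto simp: radial_solution_def hardy_solution_def radial_on_def)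
qed

text \<open>The inverse transformation, needed to compare arbitrary classical solutions. Here H is
  the weighted Wronskian r^n (f' phi - f phi') = W V', and it starts at 0 since f'(0) = 0 and y 0 =
  0.\<close>

lemma radial_solution_solves:
  fixes u :: "'a::euclidean_space \<Rightarrow> real"
  assumes u: "radial_solution mu p R u" and dim: "DIM('a) = Suc n" and b0: "b0 \<in> Basis"
  shows "solves (u 0 / phi 0) (\<lambda>r. u (r *\<^sub>R b0) / phi r)"
proof -
  have C2: "C2_on (ball 0 R) u" and rad: "radial_on (ball 0 R) u"
    and nn: "\<And>x. norm x < R \<Longrightarrow> 0 \<le> u x"
    and pde: "\<And>x. norm x < R \<Longrightarrow> laplacian u x + mu / (R - norm x)\<^sup>2 * u x = u x powr p"
    using u by (auto simp: radial_solution_def hardy_solution_def)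
  define f where "f r = u (r *\<^sub>R b0)" for r
  define f1 where "f1 r = partial_deriv b0 u (r *\<^sub>R b0)" for r
  define f2 where "f2 r = partial_deriv b0 (partial_deriv b0 u) (r *\<^sub>R b0)" for r
  have d1: "(f has_real_derivative f1 r) (at r)" if "\<bar>r\<bar> < R" for r
    unfolding f_def[abs_def] f1_def by (rule radial_deriv1[OF C2 rad b0 R_pos that])
  have d2: "(f1 has_real_derivative f2 r) (at r)" if "\<bar>r\<bar> < R" for r
    unfolding f1_def[abs_def] f2_def by (rule radial_deriv2[OF C2 rad b0 R_pos that])
  have f10: "f1 0 = 0" unfolding f1_def using radial_deriv_0[OF C2 rad b0 R_pos] by simp
  have fnn: "0 \<le> f r" if "0 \<le> r" "r < R" for r using nn[of "r *\<^sub>R b0"] that b0 by (simp add: f_def)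
  have ode: "f2 r + real n * f1 r / r = f r powr p - mu / (R - r)\<^sup>2 * f r" if r: "0 < r" "r < R" for r
    using radial_laplacian[OF C2 rad b0 R_pos r] pde[of "r *\<^sub>R b0"] r b0 dim
    by (simp add: f_def f1_def f2_def)
  define V where "V r = f r / phi r" for r
  have ph: "phi r \<noteq> 0" for r using phi_gt_0[of r] by simp
  have fc: "continuous_on {0..<R} f" and f1c: "continuous_on {0..<R} f1"
    by (intro continuous_at_imp_continuous_on ballI DERIV_isCont[OF d1] DERIV_isCont[OF d2]; simp)+
  have Vc: "continuous_on {0..<R} V"
    unfolding V_def[abs_def] using ph by (intro continuous_on_divide fc cont_phi) auto
  have Vnn: "0 \<le> V r" if "0 \<le> r" "r < R" for r
    using fnn[OF that] phi_gt_0[of r] by (simp add: V_def)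
  define H where "H t = t ^ n * f1 t * phi t - f t * (t ^ n * (phi t * y t))" for t
  have Hc: "continuous_on {0..<R} H"
    unfolding H_def[abs_def]
    by (intro continuous_on_diff continuous_on_mult continuous_on_power cont_phi cont_y fc f1c continuous_on_id)
  have H0: "H 0 = 0" by (simp add: H_def f10)
  have Hd: "(H has_real_derivative W t * src V t) (at t)" if t: "0 < t" "t < R" for t
  proof -
    have tn: "((\<lambda>t. t ^ n) has_real_derivative real n * t ^ (n - 1)) (at t)" using DERIV_pow[of n t] by simp
    have n1: "real n * t ^ (n - 1) = t ^ n * (real n / t)" using t by (cases n) auto
    have at: "\<bar>t\<bar> < R" using t by simp
    have "(H has_real_derivative
       ((real n * t ^ (n - 1) * f1 t + f2 t * t ^ n) * phi t + phi t * y t * (t ^ n * f1 t))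
       - (f1 t * (t ^ n * (phi t * y t)) + t ^ n * phi t * (- Pot t - mu / (R - t)\<^sup>2) * f t)) (at t)"
      unfolding H_def[abs_def]
      by (rule DERIV_diff DERIV_mult phi_flux_deriv[OF t] tn d1[OF at] d2[OF at] phi_deriv[OF t(2)])+
    moreover have "((real n * t ^ (n - 1) * f1 t + f2 t * t ^ n) * phi t + phi t * y t * (t ^ n * f1 t))
       - (f1 t * (t ^ n * (phi t * y t)) + t ^ n * phi t * (- Pot t - mu / (R - t)\<^sup>2) * f t)
      = t ^ n * phi t * ((f2 t + real n * f1 t / t) + Pot t * f t + mu / (R - t)\<^sup>2 * f t)"
      unfolding n1 by (simp add: algebra_simps)
    moreover have "\<dots> = t ^ n * phi t * (f t powr p + Pot t * f t)" unfolding ode[OF t] by simp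
    moreover have "\<dots> = W t * src V t"
      using src_phi[of V t] Vnn[of t] t ph[of t] by (simp add: V_def)
    ultimately show ?thesis by simp
  qed
  have I: "integral {0..t} (\<lambda>s. W s * src V s) = H t" if t: "0 \<le> t" "t < R" for t
  proof -
    have "((\<lambda>s. W s * src V s) has_integral H t - H 0) {0..t}"
      using t Hd by (intro fundamental_theorem_of_calculus_interior cont_Icc[OF Hc])
        (auto simp: has_real_derivative_iff_has_vector_derivative[symmetric])
    then show ?thesis by (simp add: integral_unique H0)
  qed
  have Vd: "(V has_real_derivative flux (src V) t) (at t)" if t: "0 < t" "t < R" for t
  proof -
    have at: "\<bar>t\<bar> < R" using t by simp
    have "(V has_real_derivative (f1 t * phi t - f t * (phi t * y t)) / (phi t * phi t)) (at t)"
      unfolding V_def[abs_def] by (rule DERIV_divide[OF d1[OF at] phi_deriv[OF t(2)] ph])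
    moreover have "flux (src V) t = (f1 t * phi t - f t * (phi t * y t)) / (phi t * phi t)"
    proof -
      have "H t = t ^ n * (f1 t * phi t - f t * (phi t * y t))" by (simp add: H_def algebra_simps)
      then show ?thesis using I[of t] t by (simp add: flux_def W_def power2_eq_square)
    qed
    ultimately show ?thesis by simp
  qed
  have "V r = T (u 0 / phi 0) V r" if r: "0 \<le> r" "r < R" for r
  proof -
    have "(flux (src V) has_integral V r - V 0) {0..r}"
      using r Vd by (intro fundamental_theorem_of_calculus_interior cont_Icc[OF Vc])
        (auto simp: has_real_derivative_iff_has_vector_derivative[symmetric])
    then show ?thesis by (simp add: T_def integral_unique V_def f_def)
  qed
  then have "solves (u 0 / phi 0) V" using Vc Vnn by (auto simp: solves_def)
  then show ?thesis by (simp add: V_def[abs_def] f_def)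
qed

section \<open>Behaviour at the boundary of the ball\<close>

lemma S_bounds:
  assumes "0 \<le> x" "x \<le> 1" shows "0 \<le> S x" "S x \<le> S 1"
proof -
  show "0 \<le> S x" unfolding S_def using assms by (intro sum_nonneg) auto
  show "S x \<le> S 1" unfolding S_def using assms by (intro sum_mono divide_right_mono power_mono) auto
qed

lemma phi_eq:
  assumes "r < R" shows "phi r = (R - r) powr b * (R powr (- b) * exp (b * S (r / R)))"
proof -
  have "1 - r / R = (R - r) / R" using R_pos' by (simp add: field_simps)
  then have "exp (b * ln (1 - r / R)) = ((R - r) / R) powr b"
    using assms R_pos' by (simp add: powr_def)
  also have "\<dots> = (R - r) powr b * R powr (- b)"
    using assms R_pos' by (simp add: powr_divide powr_minus_divide)
  finally show ?thesis by (simp add: phi_def distrib_left exp_add mult.assoc)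
qed

lemma phi_two_sided:
  obtains c1 c2 where "0 < c1" "0 < c2"
    "\<And>r. 0 \<le> r \<Longrightarrow> r < R \<Longrightarrow> c1 * (R - r) powr b \<le> phi r"
    "\<And>r. 0 \<le> r \<Longrightarrow> r < R \<Longrightarrow> phi r \<le> c2 * (R - r) powr b"
proof (rule that[of "R powr (- b) * exp (- (\<bar>b\<bar> * S 1))" "R powr (- b) * exp (\<bar>b\<bar> * S 1)"])
  have bS: "\<bar>b * S (r / R)\<bar> \<le> \<bar>b\<bar> * S 1" if "0 \<le> r" "r < R" for r
    using S_bounds[of "r / R"] that R_pos' by (auto simp: abs_mult intro!: mult_left_mono)
  fix r assume r: "0 \<le> r" "r < R"
  have "exp (- (\<bar>b\<bar> * S 1)) \<le> exp (b * S (r / R))" "exp (b * S (r / R)) \<le> exp (\<bar>b\<bar> * S 1)"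
    using bS[OF r] by (auto simp: abs_le_iff)
  then have "(R - r) powr b * (R powr (- b) * exp (- (\<bar>b\<bar> * S 1))) \<le> phi r"
    "phi r \<le> (R - r) powr b * (R powr (- b) * exp (\<bar>b\<bar> * S 1))"
    unfolding phi_eq[OF r(2)] by (intro mult_left_mono; simp)+
  then show "R powr (- b) * exp (- (\<bar>b\<bar> * S 1)) * (R - r) powr b \<le> phi r"
    "phi r \<le> R powr (- b) * exp (\<bar>b\<bar> * S 1) * (R - r) powr b"
    by (simp_all only: mult.commute)
qed (use R_pos' in auto)

text \<open>\<open>bracket\<close> is a polynomial, hence bounded on [0, 1], so the potential has at
  most a simple pole.\<close>

lemma Pot_bound:
  obtains M where "0 < M" "\<And>r. 0 \<le> r \<Longrightarrow> r < R \<Longrightarrow> Pot r \<le> M / (R - r)"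
proof -
  have "continuous_on {0..1} (\<lambda>x. b * bracket x / R)"
    unfolding bracket_def by (intro continuous_intros) (use R_pos' in auto)
  then have "bounded ((\<lambda>x. b * bracket x / R) ` {0..1})"
    by (intro compact_imp_bounded compact_continuous_image compact_Icc)
  then obtain M where M: "0 < M" "\<And>x. x \<in> {0..1} \<Longrightarrow> \<bar>b * bracket x / R\<bar> \<le> M"
    by (auto simp: bounded_pos)
  show thesis
  proof (rule that[OF M(1)])
    fix r assume r: "0 \<le> r" "r < R"
    then have "b * bracket (r / R) / R \<le> M" using abs_le_D1[OF M(2)[of "r / R"]] R_pos' by simp
    then have "b * bracket (r / R) / R / (R - r) \<le> M / (R - r)" using r by (intro divide_right_mono) auto
    then show "Pot r \<le> M / (R - r)" by (simp add: Pot_def)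
  qed
qed

text \<open>The parameter \<alpha> takes both signs: positive for the inner integral, which may blow
  up at R, and negative for the outer one, which stays bounded.\<close>

lemma powr_diff_has_integral:
  assumes "0 \<le> t" "t < R" "\<alpha> \<noteq> 0"
  shows "((\<lambda>s. (R - s) powr (- 1 - \<alpha>)) has_integral ((R - t) powr (- \<alpha>) - R powr (- \<alpha>)) / \<alpha>) {0..t}"
proof -
  have d: "((\<lambda>s. (R - s) powr (- \<alpha>) / \<alpha>) has_real_derivative (R - s) powr (- 1 - \<alpha>)) (at s)" if "s < R" for s
  proof -
    have "((\<lambda>s. R - s) has_real_derivative - 1) (at s)" by (auto intro!: derivative_eq_intros)
    from DERIV_cdivide[OF DERIV_fun_powr[OF this, of "- \<alpha>"], of \<alpha>] that
    have "((\<lambda>s. (R - s) powr (- \<alpha>) / \<alpha>) has_real_derivative - \<alpha> * (R - s) powr (- \<alpha> - 1) * - 1 / \<alpha>) (at s)"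
      by simp
    moreover have "- \<alpha> * (R - s) powr (- \<alpha> - 1) * - 1 / \<alpha> = (R - s) powr (- 1 - \<alpha>)"
    proof -
      have "- \<alpha> - 1 = - 1 - \<alpha>" by simp
      then show ?thesis using assms(3) by (simp only:) simp
    qed
    ultimately show ?thesis by (simp only:)
  qed
  have "((\<lambda>s. (R - s) powr (- 1 - \<alpha>)) has_integral (R - t) powr (- \<alpha>) / \<alpha> - (R - 0) powr (- \<alpha>) / \<alpha>) {0..t}"
  proof (rule fundamental_theorem_of_calculus_interior[OF assms(1)])
    show "continuous_on {0..t} (\<lambda>s. (R - s) powr (- \<alpha>) / \<alpha>)"
      using assms(2) by (intro continuous_at_imp_continuous_on ballI DERIV_isCont[OF d]) auto
    fix s assume "s \<in> {0<..<t}"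
    then show "((\<lambda>s. (R - s) powr (- \<alpha>) / \<alpha>) has_vector_derivative (R - s) powr (- 1 - \<alpha>)) (at s)"
      unfolding has_real_derivative_iff_has_vector_derivative[symmetric] using assms(2) by (intro d) simp
  qed
  then show ?thesis by (simp add: diff_divide_distrib)
qed

lemma powr_exponent_le:
  assumes "0 < x" "x \<le> R" "\<alpha> \<le> \<gamma>"
  shows "x powr \<gamma> \<le> R powr (\<gamma> - \<alpha>) * x powr \<alpha>"
proof -
  have "x powr \<gamma> = x powr (\<gamma> - \<alpha>) * x powr \<alpha>" by (simp add: powr_add[symmetric])
  also have "\<dots> \<le> R powr (\<gamma> - \<alpha>) * x powr \<alpha>"
    using assms by (intro mult_right_mono powr_mono2) auto
  finally show ?thesis .
qed

text \<open>With d = R - t the inner integral is at most a multiple of t^n d powr (- \<theta>).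
  Dividing by W, which is of order t^n d powr (2 b), gives d powr (- \<gamma>) with \<gamma> = 2 b +
  \<theta>; it is integrable because b < 1/2 leaves room for \<gamma> < 1.\<close>

lemma growth_bounded: obtains K where "\<And>r. 0 \<le> r \<Longrightarrow> r < R \<Longrightarrow> growth r \<le> K"
proof -
  obtain c1 c2 where c: "0 < c1" "0 < c2"
    "\<And>r. 0 \<le> r \<Longrightarrow> r < R \<Longrightarrow> c1 * (R - r) powr b \<le> phi r"
    "\<And>r. 0 \<le> r \<Longrightarrow> r < R \<Longrightarrow> phi r \<le> c2 * (R - r) powr b"
    by (rule phi_two_sided) (rule that, assumption+)
  obtain M where M: "0 < M" "\<And>r. 0 \<le> r \<Longrightarrow> r < R \<Longrightarrow> Pot r \<le> M / (R - r)"
    by (rule Pot_bound) (rule that, assumption+)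
  \<comment> \<open>The two cases give \<gamma> = b + 1/2 and \<gamma> = 1/2. The condition 0 <= 2 b
    + \<theta> admits the simple pole of \<open>Pot\<close>, and with \<theta> > 0 it also admits
    the nonlinear term, by \<open>bp\<close>.\<close>
  define \<theta> where "\<theta> = (if 0 \<le> b then (1 - 2 * b) / 2 else 1 / 2 - 2 * b)"
  have \<theta>: "0 < \<theta>" "0 \<le> 2 * b + \<theta>" "2 * b + \<theta> < 1" using b_less by (auto simp: \<theta>_def field_simps)
  have bp: "- 1 - \<theta> \<le> b * (1 + p)"
  proof (cases "0 \<le> b")
    case True
    then have "0 \<le> b * (1 + p)" using p_pos by simp
    then show ?thesis using \<theta> by linarith
  next
    case False
    then have "b * 2 \<le> b * (1 + p)" using p_less by (intro mult_left_mono_neg) auto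
    then show ?thesis using \<theta> by linarith
  qed
  define C where "C = c2 powr (1 + p) * R powr (b * (1 + p) - (- 1 - \<theta>)) + c2\<^sup>2 * M * R powr ((2 * b - 1) - (- 1 - \<theta>))"
  have C0: "0 < C" unfolding C_def using c M R_pos' by (intro add_pos_pos mult_pos_pos) auto
  have J: "(phi s)\<^sup>2 * (phi s powr (p - 1) + Pot s) \<le> C * (R - s) powr (- 1 - \<theta>)" if s: "0 \<le> s" "s < R" for s
  proof -
    let ?d = "R - s"
    have d: "0 < ?d" "?d \<le> R" using s by auto
    have "(phi s)\<^sup>2 * phi s powr (p - 1) = phi s powr 2 * phi s powr (p - 1)"
      using phi_gt_0[of s] by simp
    also have "\<dots> = phi s powr (1 + p)" by (simp add: powr_add[symmetric] del: powr_numeral)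
    also have "\<dots> \<le> (c2 * ?d powr b) powr (1 + p)"
      using c(4)[OF s] phi_gt_0[of s] p_pos by (intro powr_mono2) auto
    also have "\<dots> = c2 powr (1 + p) * ?d powr (b * (1 + p))"
      using c d by (simp add: powr_mult powr_powr)
    also have "\<dots> \<le> c2 powr (1 + p) * (R powr (b * (1 + p) - (- 1 - \<theta>)) * ?d powr (- 1 - \<theta>))"
      by (intro mult_left_mono powr_exponent_le d bp) auto
    finally have 1: "(phi s)\<^sup>2 * phi s powr (p - 1) \<le> c2 powr (1 + p) * (R powr (b * (1 + p) - (- 1 - \<theta>)) * ?d powr (- 1 - \<theta>))" .
    have "(phi s)\<^sup>2 \<le> (c2 * ?d powr b)\<^sup>2"
      using c(4)[OF s] phi_gt_0[of s] by (intro power_mono) auto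
    also have "(c2 * ?d powr b)\<^sup>2 = c2\<^sup>2 * ?d powr (2 * b)"
      by (simp add: power_mult_distrib power2_eq_square powr_add[symmetric])
    finally have "(phi s)\<^sup>2 * Pot s \<le> (c2\<^sup>2 * ?d powr (2 * b)) * (M / ?d)"
      using M(2)[OF s] Pot_nonneg[OF s] by (intro mult_mono) auto
    also have "\<dots> = c2\<^sup>2 * M * ?d powr (2 * b - 1)" using d by (simp add: powr_diff)
    also have "\<dots> \<le> c2\<^sup>2 * M * (R powr ((2 * b - 1) - (- 1 - \<theta>)) * ?d powr (- 1 - \<theta>))"
      using M \<theta> by (intro mult_left_mono powr_exponent_le d) auto
    finally have 2: "(phi s)\<^sup>2 * Pot s \<le> c2\<^sup>2 * M * (R powr ((2 * b - 1) - (- 1 - \<theta>)) * ?d powr (- 1 - \<theta>))" .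
    have "(phi s)\<^sup>2 * (phi s powr (p - 1) + Pot s) = (phi s)\<^sup>2 * phi s powr (p - 1) + (phi s)\<^sup>2 * Pot s"
      by (rule distrib_left)
    also have "\<dots> \<le> C * ?d powr (- 1 - \<theta>)"
      using add_mono[OF 1 2] unfolding C_def distrib_right mult.assoc .
    finally show ?thesis .
  qed
  define \<gamma> where "\<gamma> = 2 * b + \<theta>"
  have \<gamma>: "\<gamma> < 1" "- 1 - (\<gamma> - 1) = - \<gamma>" "\<gamma> - 1 \<noteq> 0" using \<theta> by (auto simp: \<gamma>_def)
  define K where "K = C / \<theta> / c1\<^sup>2"
  have K0: "0 < K" using C0 \<theta> c by (simp add: K_def)
  have fl: "flux (\<lambda>s. phi s powr (p - 1) + Pot s) t \<le> K * (R - t) powr (- \<gamma>)" if t: "0 \<le> t" "t < R" for t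
  proof (cases "t = 0")
    case True
    then show ?thesis using K0 by simp
  next
    case False
    then have t0: "0 < t" using t by simp
    let ?d = "R - t"
    have d: "0 < ?d" using t by simp
    have "integral {0..t} (\<lambda>s. W s * (phi s powr (p - 1) + Pot s)) \<le>
        t ^ n * (C * ((?d powr (- \<theta>) - R powr (- \<theta>)) / \<theta>))"
    proof (rule has_integral_le)
      show "((\<lambda>s. W s * (phi s powr (p - 1) + Pot s)) has_integral
          integral {0..t} (\<lambda>s. W s * (phi s powr (p - 1) + Pot s))) {0..t}"
        by (rule integrable_integral[OF integrable_W[OF cont_AP t(2)]])
      show "((\<lambda>s. t ^ n * (C * (R - s) powr (- 1 - \<theta>))) has_integral
          t ^ n * (C * ((?d powr (- \<theta>) - R powr (- \<theta>)) / \<theta>))) {0..t}"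
        using t \<theta> by (intro has_integral_mult_right powr_diff_has_integral) auto
      fix s assume s: "s \<in> {0..t}"
      have "0 \<le> (phi s)\<^sup>2 * (phi s powr (p - 1) + Pot s)"
        using s t Pot_nonneg[of s] by (intro mult_nonneg_nonneg add_nonneg_nonneg) auto
      moreover have "(phi s)\<^sup>2 * (phi s powr (p - 1) + Pot s) \<le> C * (R - s) powr (- 1 - \<theta>)"
        using s t by (intro J) auto
      \<comment> \<open>Pulling out t^n, rather than a power of R, lets it cancel against
        \<open>W t\<close>, so the bound is uniform down to the origin.\<close>
      moreover have "s ^ n \<le> t ^ n" using s by (intro power_mono) auto
      ultimately have "s ^ n * ((phi s)\<^sup>2 * (phi s powr (p - 1) + Pot s)) \<le> t ^ n * (C * (R - s) powr (- 1 - \<theta>))"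
        using t by - (rule mult_mono, auto)
      then show "W s * (phi s powr (p - 1) + Pot s) \<le> t ^ n * (C * (R - s) powr (- 1 - \<theta>))"
        by (simp add: W_def mult.assoc)
    qed
    also have "\<dots> \<le> t ^ n * (C * (?d powr (- \<theta>) / \<theta>))"
      using t C0 \<theta> by (intro mult_left_mono divide_right_mono) auto
    also have "\<dots> = C / \<theta> * ?d powr (- \<theta>) * t ^ n" by simp
    also have "\<dots> \<le> K * ?d powr (- \<gamma>) * W t"
    proof -
      have "(c1 * ?d powr b)\<^sup>2 \<le> (phi t)\<^sup>2"
        using c(1) c(3)[OF t] by (intro power_mono) auto
      moreover have "(c1 * ?d powr b)\<^sup>2 = c1\<^sup>2 * ?d powr (2 * b)"
        by (simp add: power_mult_distrib power2_eq_square powr_add[symmetric])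
      ultimately have "K * ?d powr (- \<gamma>) * (c1\<^sup>2 * ?d powr (2 * b)) * t ^ n \<le> K * ?d powr (- \<gamma>) * (phi t)\<^sup>2 * t ^ n"
        using K0 t by (intro mult_right_mono mult_left_mono) auto
      moreover have "K * ?d powr (- \<gamma>) * (c1\<^sup>2 * ?d powr (2 * b)) = C / \<theta> * ?d powr (- \<theta>)"
      proof -
        have "?d powr (- \<gamma>) * ?d powr (2 * b) = ?d powr (- \<theta>)" by (simp add: \<gamma>_def powr_add[symmetric])
        moreover have "K * c1\<^sup>2 = C / \<theta>" using c by (simp add: K_def)
        moreover have "K * ?d powr (- \<gamma>) * (c1\<^sup>2 * ?d powr (2 * b)) = (K * c1\<^sup>2) * (?d powr (- \<gamma>) * ?d powr (2 * b))"
          by (simp only: mult_ac)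
        ultimately show ?thesis by simp
      qed
      ultimately have "C / \<theta> * ?d powr (- \<theta>) * t ^ n \<le> K * ?d powr (- \<gamma>) * (phi t)\<^sup>2 * t ^ n"
        by (simp only:)
      then show ?thesis by (simp only: W_def mult_ac)
    qed
    finally show ?thesis using W_pos[OF t0 t(2)] by (simp add: flux_def pos_divide_le_eq)
  qed
  show thesis
  proof (rule that)
    fix r assume r: "0 \<le> r" "r < R"
    have "growth r \<le> K * (((R - r) powr (- (\<gamma> - 1)) - R powr (- (\<gamma> - 1))) / (\<gamma> - 1))"
      unfolding growth_def
    proof (rule has_integral_le)
      show "(flux (\<lambda>s. phi s powr (p - 1) + Pot s) has_integral
         integral {0..r} (flux (\<lambda>s. phi s powr (p - 1) + Pot s))) {0..r}"
        by (rule integrable_integral[OF integrable_cont[OF cont_flux[OF cont_AP] r(2)]])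
      show "((\<lambda>t. K * (R - t) powr (- \<gamma>)) has_integral
          K * (((R - r) powr (- (\<gamma> - 1)) - R powr (- (\<gamma> - 1))) / (\<gamma> - 1))) {0..r}"
        using has_integral_mult_right[OF powr_diff_has_integral[OF r \<gamma>(3)], of K] unfolding \<gamma>(2) .
    qed (use fl r in auto)
    also have "\<dots> = K * ((R powr (1 - \<gamma>) - (R - r) powr (1 - \<gamma>)) / (1 - \<gamma>))"
      using \<gamma> by (simp add: divide_simps) (simp add: algebra_simps)
    also have "\<dots> \<le> K * (R powr (1 - \<gamma>) / (1 - \<gamma>))"
      using K0 \<gamma> by (intro mult_left_mono divide_right_mono) auto
    finally show "growth r \<le> K * (R powr (1 - \<gamma>) / (1 - \<gamma>))" .
  qed
qed

lemma solves_mono: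
  assumes v: "solves a v" and "0 \<le> r" "r \<le> s" "s < R" shows "v r \<le> v s"
  using T_mono_arg[OF solves_cont[OF v] solves_nonneg[OF v], of r s a] solves_eq[OF v, of r] solves_eq[OF v, of s]
    assms by simp

text \<open>A bounded nondecreasing v tends to its supremum, which is positive because v is positive
  somewhere; \<open>phi_eq\<close> shows that phi / \<delta> powr b has a positive limit.\<close>

lemma solves_boundary:
  assumes v: "solves a v" and B: "0 \<le> B" "\<And>r. 0 \<le> r \<Longrightarrow> r < R \<Longrightarrow> v r \<le> upper_sol B r"
    and r0: "0 \<le> r0" "r0 < R" "0 < v r0"
  shows "\<exists>c>0. boundary_behaviour R b c (\<lambda>x::'a::real_normed_vector. phi (norm x) * v (norm x))"
proof -
  obtain K where K: "\<And>r. 0 \<le> r \<Longrightarrow> r < R \<Longrightarrow> growth r \<le> K" by (rule growth_bounded) (rule that, assumption+)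
  have ub: "v r \<le> (1 + B) * exp K" if r: "0 \<le> r" "r < R" for r
  proof -
    have "v r \<le> (1 + B) * exp (growth r) - 1" using B(2)[OF r] by (simp add: upper_sol_def)
    also have "\<dots> \<le> (1 + B) * exp K - 1" using K[OF r] B by (intro diff_right_mono mult_left_mono) auto
    finally show ?thesis by simp
  qed
  define L where "L = (SUP r\<in>{0..<R}. v r)"
  have bdd: "bdd_above (v ` {0..<R})" by (rule bdd_aboveI2) (use ub in auto)
  have le: "v r \<le> L" if "0 \<le> r" "r < R" for r unfolding L_def using cSUP_upper[OF _ bdd, of r] that by simp
  have L0: "0 < L" using le[OF r0(1,2)] r0(3) by simp
  have small: "eventually (\<lambda>d. 0 < d \<and> d < R) (at_right (0::real))"
    using R_pos' by (auto simp: eventually_at_right_field)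
  have vlim: "((\<lambda>d. v (R - d)) \<longlongrightarrow> L) (at_right 0)"
  proof (rule order_tendstoI)
    fix a assume "a < L"
    then obtain r where r: "0 \<le> r" "r < R" "a < v r"
      unfolding L_def using less_cSUP_iff[OF _ bdd] R_pos' by auto
    have "a < v (R - d)" if "0 < d" "d < R - r" for d
      using solves_mono[OF v, of r "R - d"] r that by simp
    then show "eventually (\<lambda>d. a < v (R - d)) (at_right 0)"
      unfolding eventually_at_right_field using r by (intro exI[of _ "R - r"]) auto
  next
    fix a assume "L < a"
    show "eventually (\<lambda>d. v (R - d) < a) (at_right 0)"
      using small by eventually_elim (use le \<open>L < a\<close> in \<open>auto intro!: le_less_trans[OF le]\<close>)
  qed
  define E where "E d = R powr (- b) * exp (b * S ((R - d) / R))" for d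
  have "((\<lambda>d. S ((R - d) / R)) \<longlongrightarrow> S ((R - 0) / R)) (at_right 0)"
  proof (rule isCont_tendsto_compose[OF DERIV_isCont[OF S_deriv]])
    show "((\<lambda>d. (R - d) / R) \<longlongrightarrow> (R - 0) / R) (at_right 0)"
      using R_pos' by (intro tendsto_intros) auto
  qed
  then have Elim: "(E \<longlongrightarrow> E 0) (at_right 0)"
    unfolding E_def[abs_def] by (intro tendsto_mult tendsto_exp tendsto_const)
  have "((\<lambda>d. E d * v (R - d)) \<longlongrightarrow> E 0 * L) (at_right 0)"
    by (intro tendsto_mult Elim vlim)
  moreover have "eventually (\<lambda>d. E d * v (R - d) = phi (R - d) * v (R - d) / d powr b) (at_right 0)"
    using small by eventually_elim (simp add: phi_eq E_def)
  ultimately have "((\<lambda>d. phi (R - d) * v (R - d) / d powr b) \<longlongrightarrow> E 0 * L) (at_right 0)"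
    by (rule Lim_transform_eventually)
  \<comment> \<open>The boundary filter is the preimage of the right-sided filter at 0 under R -
    |x|, so the one-dimensional limit transfers by composition.\<close>
  then have "((\<lambda>x::'a. phi (R - (R - norm x)) * v (R - (R - norm x)) / (R - norm x) powr b) \<longlongrightarrow> E 0 * L)
      (filtercomap (\<lambda>x. R - norm x) (at_right 0))"
    by (rule filterlim_compose[OF _ filterlim_filtercomap])
  then have "boundary_behaviour R b (E 0 * L) (\<lambda>x::'a. phi (norm x) * v (norm x))"
    by (simp add: boundary_behaviour_def)
  moreover have "0 < E 0 * L" using L0 R_pos' by (simp add: E_def)
  ultimately show ?thesis by blast
qed

text \<open>With this normalisation u(0) = v(0), and the coefficient A 0 in the limiting profile is
  1.\<close>

lemma phi_0 [simp]: "phi 0 = 1"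
  by (simp add: phi_def S_def)

lemma phi_radial_quotient:
  fixes u :: "'a::euclidean_space \<Rightarrow> real"
  assumes "radial_solution mu p R u" "b0 \<in> Basis" "norm x < R"
  shows "u x = phi (norm x) * (u (norm x *\<^sub>R b0) / phi (norm x))"
proof -
  have "u x = u (norm x *\<^sub>R b0)"
    using assms(1)[unfolded radial_solution_def radial_on_def, THEN conjunct2, rule_format, of x "norm x *\<^sub>R b0"]
      assms(2,3) by simp
  then show ?thesis using phi_gt_0[of "norm x"] by simp
qed

section \<open>Radial solutions of the Hardy equation\<close>

lemma positive_solution_exists:
  assumes "0 < a" and dim: "DIM('a::euclidean_space) = Suc n"
  shows "\<exists>u :: 'a \<Rightarrow> real. positive_radial_solution mu p R u \<and> u 0 = a \<and>
    (\<exists>c>0. boundary_behaviour R b c u)"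
proof -
  have "0 \<le> T a (\<lambda>_. 0) r" if "0 \<le> r" "r < R" for r
    using T_ge[of "\<lambda>_. 0" r a] that assms(1) by simp
  note sub = this
  have "\<exists>v. solves a v \<and> (\<forall>r. 0 \<le> r \<longrightarrow> r < R \<longrightarrow> v r \<le> upper_sol a r)"
  proof (rule solution_exists[of "\<lambda>_. 0" a a])
    fix v assume "solves a v" "\<And>r. 0 \<le> r \<Longrightarrow> r < R \<Longrightarrow> v r \<le> upper_sol a r"
    then show "\<exists>v. solves a v \<and> (\<forall>r. 0 \<le> r \<longrightarrow> r < R \<longrightarrow> v r \<le> upper_sol a r)" by blast
  qed (use sub assms(1) in auto)
  then obtain v where v: "solves a v" "\<And>r. 0 \<le> r \<Longrightarrow> r < R \<Longrightarrow> v r \<le> upper_sol a r" by blast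
  have va: "a \<le> v r" if "0 \<le> r" "r < R" for r
    using T_ge[OF solves_cont[OF v(1)] solves_nonneg[OF v(1)] that, of a] solves_eq[OF v(1) that] by simp
  have v0: "v 0 = a" using solves_eq[OF v(1), of 0] R_pos by simp
  have "0 < phi (norm x) * v (norm x)" if "norm x < R" for x :: 'a
    using va[of "norm x"] that assms(1) phi_gt_0[of "norm x"] by simp
  then have "positive_radial_solution mu p R (\<lambda>x::'a. phi (norm x) * v (norm x))"
    using solves_radial_solution[OF v(1) dim] by (simp add: positive_radial_solution_def)
  moreover have "\<exists>c>0. boundary_behaviour R b c (\<lambda>x::'a. phi (norm x) * v (norm x))"
    by (rule solves_boundary[OF v(1) _ v(2), of 0]) (use assms(1) v0 R_pos in auto)
  ultimately show ?thesis
    by (intro exI[of _ "\<lambda>x::'a. phi (norm x) * v (norm x)"]) (simp add: v0)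
qed

text \<open>The quantitative form serves twice: for equal values at 0 it gives uniqueness by
  exchanging u and v, and for u 0 < v 0 it gives a strict ordering because phi is positive.\<close>

lemma positive_solution_gap:
  fixes u v :: "'a::euclidean_space \<Rightarrow> real"
  assumes u: "positive_radial_solution mu p R u" and v: "positive_radial_solution mu p R v"
    and le: "u 0 \<le> v 0" and dim: "DIM('a) = Suc n" and x: "norm x < R"
  shows "u x + phi (norm x) * (v 0 - u 0) \<le> v x"
proof -
  obtain b0 :: 'a where b0: "b0 \<in> Basis" using nonempty_Basis by blast
  have ru: "radial_solution mu p R u" and rv: "radial_solution mu p R v" and "0 < u 0"
    using u v R_pos by (auto simp: positive_radial_solution_def)
  have "u (norm x *\<^sub>R b0) / phi (norm x) + (v 0 / phi 0 - u 0 / phi 0) \<le> v (norm x *\<^sub>R b0) / phi (norm x)"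
    by (rule solves_gap[OF radial_solution_solves[OF ru dim b0] radial_solution_solves[OF rv dim b0]])
       (use \<open>0 < u 0\<close> le x in auto)
  from mult_left_mono[OF this less_imp_le[OF phi_gt_0[of "norm x"]]] show ?thesis
    unfolding phi_radial_quotient[OF ru b0 x] phi_radial_quotient[OF rv b0 x]
    by (simp add: distrib_left)
qed

lemma dead_core_radial_solution:
  assumes R0: "0 < R0" "R0 < R" and dim: "DIM('a::euclidean_space) = Suc n"
  shows "\<exists>u :: 'a \<Rightarrow> real. radial_solution mu p R u \<and> dead_core R0 u \<and>
    (\<exists>c>0. boundary_behaviour R b c u)"
proof -
  obtain v c R1 B where v: "solves 0 v" "0 < c" "R0 < R1" "R1 < R" "0 \<le> B"
    "\<And>r. 0 \<le> r \<Longrightarrow> r \<le> R0 \<Longrightarrow> v r = 0"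
    "\<And>r. R0 \<le> r \<Longrightarrow> r \<le> R1 \<Longrightarrow> c * (r - R0) powr k \<le> v r"
    "\<And>r. 0 \<le> r \<Longrightarrow> r < R \<Longrightarrow> v r \<le> upper_sol B r"
    by (rule dead_core_solution_exists[OF less_imp_le[OF R0(1)] R0(2)]) (rule that, assumption+)
  have pos: "0 < v r" if "R0 < r" "r \<le> R1" for r
  proof -
    have "0 < c * (r - R0) powr k" using v(2) that by simp
    then show ?thesis using v(7)[of r] that by simp
  qed
  let ?u = "\<lambda>x::'a. phi (norm x) * v (norm x)"
  have "dead_core R0 ?u"
    unfolding dead_core_def
  proof (intro conjI ballI exI[of _ "R1 - R0"] allI impI)
    show "?u x = 0" if "x \<in> ball 0 R0" for x using v(6)[of "norm x"] that by simp
    show "0 < R1 - R0" using v(3) by simp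
    show "0 < ?u x" if "R0 < norm x \<and> norm x < R0 + (R1 - R0)" for x
      using pos[of "norm x"] phi_gt_0[of "norm x"] that by simp
  qed
  moreover have "\<exists>c>0. boundary_behaviour R b c ?u"
    by (rule solves_boundary[OF v(1,5,8), of R1]) (use pos[of R1] v R0 in auto)
  ultimately show ?thesis
    by (intro exI[of _ ?u] conjI solves_radial_solution[OF v(1) dim])
qed

text \<open>1 / D = k (k - 1) + k n is the Laplacian of r powr k divided by r powr (k - 2), and for
  k = 2 / (1 - p) its first summand is \<open>mu_star p\<close>.\<close>

lemma profile_constant:
  "D powr (1 / (1 - p)) = (mu_star p + 2 * (real (Suc n) - 1) / (1 - p)) powr (1 / (p - 1))"
proof -
  have q: "1 - p \<noteq> 0" using p_less by simp
  have "mu_star p + 2 * (real (Suc n) - 1) / (1 - p) = k * (k - 1) + k * real n"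
    unfolding mu_star_def k_def using q by (simp add: field_simps power2_eq_square)
  also have "\<dots> = inverse D" by (simp add: D_def algebra_simps)
  finally have X: "mu_star p + 2 * (real (Suc n) - 1) / (1 - p) = inverse D" .
  have "(mu_star p + 2 * (real (Suc n) - 1) / (1 - p)) powr (1 / (p - 1)) = inverse D powr (- (1 / (1 - p)))"
  proof -
    have "1 / (p - 1) = - (1 / (1 - p))" by (metis minus_diff_eq minus_divide_right)
    then show ?thesis using X by (simp only:)
  qed
  also have "\<dots> = D powr (1 / (1 - p))"
    using D_pos by (simp add: powr_minus powr_divide inverse_eq_divide)
  finally show ?thesis by simp
qed

lemma profile_radial_solution:
  assumes dim: "DIM('a::euclidean_space) = Suc n"
  shows "\<exists>(u :: 'a \<Rightarrow> real) w. radial_solution mu p R u \<and> continuous_on {0..<R} w \<and> w 0 = 0 \<and>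
    (\<forall>x\<in>ball 0 R. u x = norm x powr k * (D powr (1 / (1 - p)) + w (norm x))) \<and>
    (\<exists>c>0. boundary_behaviour R b c u)"
proof -
  obtain v c R1 B where v: "solves 0 v" "0 < c" "0 < R1" "R1 < R" "0 \<le> B"
    "\<And>r. 0 \<le> r \<Longrightarrow> r \<le> 0 \<Longrightarrow> v r = 0"
    "\<And>r. 0 \<le> r \<Longrightarrow> r \<le> R1 \<Longrightarrow> c * (r - 0) powr k \<le> v r"
    "\<And>r. 0 \<le> r \<Longrightarrow> r < R \<Longrightarrow> v r \<le> upper_sol B r"
    by (rule dead_core_solution_exists[OF order_refl R_pos]) (rule that, assumption+)
  have lower: "c * r powr k \<le> v r" if "0 \<le> r" "r \<le> R1" for r using v(7)[OF that] by simp
  have "((\<lambda>r. v r / r powr k) \<longlongrightarrow> (phi 0 powr (p - 1) * D) powr (1 / (1 - p))) (at_right 0)"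
    by (rule profile_limit[OF v(1-3) lower])
  then have vlim: "((\<lambda>r. v r / r powr k) \<longlongrightarrow> D powr (1 / (1 - p))) (at_right 0)" by simp
  have right: "at 0 within {0..<R} = at_right (0::real)"
    by (rule at_within_nhd[of _ "{..<R}"]) (use R_pos in auto)
  have "(phi \<longlongrightarrow> phi 0) (at_right 0)"
    using bspec[OF cont_phi[unfolded continuous_on_def], of 0] R_pos unfolding right[symmetric] by simp
  from tendsto_mult[OF this vlim]
  have ulim: "((\<lambda>r. phi r * (v r / r powr k)) \<longlongrightarrow> D powr (1 / (1 - p))) (at_right 0)" by simp
  \<comment> \<open>The value at 0 is set by hand: r powr k vanishes there, so the form of u at the
    origin holds automatically, and \<open>ulim\<close> makes w continuous.\<close>
  define w where "w r = (if r = 0 then 0 else phi r * (v r / r powr k) - D powr (1 / (1 - p)))" for r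
  have "continuous (at r within {0..<R}) w" if r: "0 \<le> r" "r < R" for r
  proof (cases "r = 0")
    case True
    have "((\<lambda>r. phi r * (v r / r powr k) - D powr (1 / (1 - p))) \<longlongrightarrow> 0) (at_right 0)"
      using tendsto_diff[OF ulim tendsto_const[of "D powr (1 / (1 - p))"]] by simp
    moreover have "eventually (\<lambda>r. phi r * (v r / r powr k) - D powr (1 / (1 - p)) = w r) (at_right 0)"
      unfolding eventually_at_right_field w_def by (intro exI[of _ 1]) auto
    ultimately have "(w \<longlongrightarrow> 0) (at_right 0)" by (rule Lim_transform_eventually)
    then show ?thesis by (simp add: True continuous_within right w_def)
  next
    case False
    have "continuous_on {0<..<R} (\<lambda>r. phi r * (v r / r powr k) - D powr (1 / (1 - p)))"
      by (intro continuous_on_diff continuous_on_mult continuous_on_divide continuous_on_powr continuous_on_const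
          continuous_on_id continuous_on_subset[OF cont_phi] continuous_on_subset[OF solves_cont[OF v(1)]]) auto
    then have "continuous_on {0<..<R} w"
      by (rule continuous_on_eq) (simp add: w_def)
    then have "isCont w r" using r False by (simp add: continuous_on_eq_continuous_at)
    then show ?thesis by (rule continuous_at_imp_continuous_at_within)
  qed
  then have wc: "continuous_on {0..<R} w" by (auto simp: continuous_on_eq_continuous_within)
  let ?u = "\<lambda>x::'a. phi (norm x) * v (norm x)"
  have form: "?u x = norm x powr k * (D powr (1 / (1 - p)) + w (norm x))" for x
    using v(6)[of 0] by (cases "x = 0") (auto simp: w_def)
  have "0 < c * R1 powr k" using v by simp
  then have "0 < v R1" using lower[of R1] v(3) by simp
  then have "\<exists>c>0. boundary_behaviour R b c ?u"
    by (intro solves_boundary[OF v(1,5,8), of R1]) (use v(3,4) in auto)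
  moreover have "w 0 = 0" by (simp add: w_def)
  ultimately show ?thesis
    by (intro exI[of _ ?u] exI[of _ w] conjI ballI form wc solves_radial_solution[OF v(1) dim])
qed

end

theorem theorem3p1:
  fixes p R \<mu> :: real
  assumes "0 < p" and "p < 1" and "0 < R" and "\<mu> < 1/4" and "\<mu> \<noteq> 0"
  shows
    "(\<forall>a>0. \<exists>u :: real ^ 'n \<Rightarrow> real.
        positive_radial_solution \<mu> p R u \<and> u 0 = a \<and>
        (\<forall>v. positive_radial_solution \<mu> p R v \<and> v 0 = a \<longrightarrow> (\<forall>x\<in>ball 0 R. v x = u x)) \<and>
        (\<exists>c>0. boundary_behaviour R (beta_minus \<mu>) c u)) \<and>
     (\<forall>(u :: real ^ 'n \<Rightarrow> real) v.
        positive_radial_solution \<mu> p R u \<and> positive_radial_solution \<mu> p R v \<and> u 0 < v 0 \<longrightarrow>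
        (\<forall>x\<in>ball 0 R. u x < v x)) \<and>
     (\<forall>R0. 0 < R0 \<and> R0 < R \<longrightarrow>
        (\<exists>u :: real ^ 'n \<Rightarrow> real.
           radial_solution \<mu> p R u \<and> dead_core R0 u \<and>
           (\<exists>c>0. boundary_behaviour R (beta_minus \<mu>) c u))) \<and>
     (\<exists>(u :: real ^ 'n \<Rightarrow> real) (w :: real \<Rightarrow> real).
        radial_solution \<mu> p R u \<and>
        continuous_on {0..<R} w \<and> w 0 = 0 \<and>
        (\<forall>x\<in>ball 0 R. u x = norm x powr (2 / (1 - p)) *
           ((mu_star p + 2 * (real CARD('n) - 1) / (1 - p)) powr (1 / (p - 1)) + w (norm x))) \<and>
        (\<exists>c>0. boundary_behaviour R (beta_minus \<mu>) c u))"
proof -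
  define b where "b = beta_minus \<mu>"
  define n where "n = CARD('n) - 1"
  \<comment> \<open>For b < 0 the ceiling gives the least integer with n <= m (- b);
    \<open>max 1\<close> keeps the exponent positive when n = 0.\<close>
  define m where "m = (if 0 < b then 1 else max 1 (nat \<lceil>real n / (- b)\<rceil>))"
  have sq: "0 < 1/4 - \<mu>" using assms(4) by simp
  have b: "b < 1/2" "b * (1 - b) = \<mu>"
  proof -
    show "b < 1/2" using sq by (simp add: b_def beta_minus_def)
    have "(sqrt (1/4 - \<mu>))\<^sup>2 = 1/4 - \<mu>" using sq by simp
    then show "b * (1 - b) = \<mu>" by (simp add: b_def beta_minus_def algebra_simps power2_eq_square)
  qed
  have n: "CARD('n) = Suc n" by (simp add: n_def)
  have "real n \<le> real m * (- b)" if "b < 0"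
  proof -
    have "real n / (- b) \<le> real m" using that by (simp add: m_def le_max_iff_disj) linarith
    from mult_right_mono[OF this, of "- b"] show ?thesis using that by simp
  qed
  then interpret hardy R p b n m
    using assms b by unfold_locales (auto simp: m_def)
  have mu: "mu = \<mu>" using b by (simp add: mu_def)
  have bm: "beta_minus \<mu> = b" by (simp add: b_def)
  have dim: "DIM(real ^ 'n) = Suc n" using n by simp
  note ex = positive_solution_exists[where 'a = "real ^ 'n", OF _ dim]
  note gap = positive_solution_gap[where 'a = "real ^ 'n", OF _ _ _ dim]
  have uniq: "v x = u x" if "positive_radial_solution mu p R u" "positive_radial_solution mu p R v"
    "u 0 = v 0" "norm x < R" for u v :: "real ^ 'n \<Rightarrow> real" and x
    using gap[OF that(1,2) _ that(4)] gap[OF that(2,1) _ that(4)] that(3) by simp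
  have i: "\<forall>a>0. \<exists>u :: real ^ 'n \<Rightarrow> real.
        positive_radial_solution mu p R u \<and> u 0 = a \<and>
        (\<forall>v. positive_radial_solution mu p R v \<and> v 0 = a \<longrightarrow> (\<forall>x\<in>ball 0 R. v x = u x)) \<and>
        (\<exists>c>0. boundary_behaviour R b c u)"
  proof (intro allI impI)
    fix a :: real assume "0 < a"
    then obtain u :: "real ^ 'n \<Rightarrow> real" where u: "positive_radial_solution mu p R u" "u 0 = a"
      "\<exists>c>0. boundary_behaviour R b c u" using ex[of a] by blast
    have un: "\<forall>v. positive_radial_solution mu p R v \<and> v 0 = a \<longrightarrow> (\<forall>x\<in>ball 0 R. v x = u x)"
      using uniq[OF u(1)] u(2) by simp
    show "\<exists>u :: real ^ 'n \<Rightarrow> real.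
        positive_radial_solution mu p R u \<and> u 0 = a \<and>
        (\<forall>v. positive_radial_solution mu p R v \<and> v 0 = a \<longrightarrow> (\<forall>x\<in>ball 0 R. v x = u x)) \<and>
        (\<exists>c>0. boundary_behaviour R b c u)"
      by (intro exI[of _ u] conjI u un)
  qed
  have mono: "\<forall>(u :: real ^ 'n \<Rightarrow> real) v.
        positive_radial_solution mu p R u \<and> positive_radial_solution mu p R v \<and> u 0 < v 0 \<longrightarrow>
        (\<forall>x\<in>ball 0 R. u x < v x)"
  proof (intro allI impI ballI)
    fix u v :: "real ^ 'n \<Rightarrow> real" and x :: "real ^ 'n"
    assume uv: "positive_radial_solution mu p R u \<and> positive_radial_solution mu p R v \<and> u 0 < v 0"
      and x: "x \<in> ball 0 R"
    have "u x + phi (norm x) * (v 0 - u 0) \<le> v x" using uv x by (intro gap) auto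
    moreover have "0 < phi (norm x) * (v 0 - u 0)" using uv phi_gt_0 by simp
    ultimately show "u x < v x" by linarith
  qed
  have ii: "\<forall>R0. 0 < R0 \<and> R0 < R \<longrightarrow>
        (\<exists>u :: real ^ 'n \<Rightarrow> real. radial_solution mu p R u \<and> dead_core R0 u \<and>
           (\<exists>c>0. boundary_behaviour R b c u))"
    by (intro allI impI dead_core_radial_solution dim; simp)
  note iii = profile_radial_solution[where 'a = "real ^ 'n", OF dim, unfolded profile_constant k_def, folded n]
  show ?thesis
    using i mono ii iii unfolding mu bm by (intro conjI)
qed

end
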